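(* Assume, in the standing setting, that $\mathbf A^{\sharp}\mathbf A$ is Hermitian and $\mathbf B\mathbf B^{\sharp}$ is non-Hermitian. Then for all $i=1,\dots,n$, $j=1,\dots,p$ the entries of $\mathbf X=\mathbf A^{\dagger}_{M,N}\mathbf D\mathbf B^{\dagger}_{P,Q}$ satisfy the following, where in each case $\widetilde{\mathbf D}\in\mathbb H^{n\times p}$ has rows $\widetilde{\mathbf d}_{t.}$ and columns $\widetilde{\mathbf d}_{.f}$, and $\Delta_A=\sum_{\beta\in J_{r_1,n}}\det((\mathbf A^{\sharp}\mathbf A)^{\beta}_{\beta})$, $\Delta_B=\sum_{\alpha\in I_{r_2,p}}\det((\widetilde{\mathbf B}\widetilde{\mathbf B}^* )^{\alpha}_{\alpha})$. (i) If $r_1<n$, $r_2<p$: let $\widetilde{\mathbf D}=\mathbf A^{\sharp}\mathbf D\mathbf Q^{-1}\mathbf B^*\mathbf P^{1/2}$; let $\mathbf d^{\mathbf B}_{.j}\in\mathbb H^{n\times1}$ have $t$-th entry $\sum_{l=1}^{p}\sum_{\alpha\in I_{r_2,p}\{l\}}\operatorname{rdet}_l\big((\widetilde{\mathbf B}\widetilde{\mathbf B}^* )_{l.}(\widetilde{\mathbf d}_{t.})\big)^{\alpha}_{\alpha}\,p^{(1/2)}_{lj}$ and $\mathbf d^{\mathbf A}_{i.}\in\mathbb H^{1\times p}$ have $f$-th entry $\sum_{\beta\in J_{r_1,n}\{i\}}\operatorname{cdet}_i\big((\mathbf A^{\sharp}\mathbf A)_{.i}(\widetilde{\mathbf d}_{.f})\big)^{\beta}_{\beta}$.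 Then $$x_{ij}=\frac{\sum_{\beta\in J_{r_1,n}\{i\}}\operatorname{cdet}_i\big((\mathbf A^{\sharp}\mathbf A)_{.i}(\mathbf d^{\mathbf B}_{.j})\big)^{\beta}_{\beta}}{\Delta_A\Delta_B}=\frac{\sum_{l=1}^{p}\sum_{\alpha\in I_{r_2,p}\{l\}}\operatorname{rdet}_l\big((\widetilde{\mathbf B}\widetilde{\mathbf B}^* )_{l.}(\mathbf d^{\mathbf A}_{i.})\big)^{\alpha}_{\alpha}\,p^{(1/2)}_{lj}}{\Delta_A\Delta_B}.$$ (ii) If $r_1=n$, $r_2=p$: let $\widetilde{\mathbf D}=\mathbf A^{\sharp}\mathbf D\mathbf Q^{-1}\mathbf B^*$; let $\mathbf d^{\mathbf B}_{.j}$ have $t$-th entry $\operatorname{rdet}_j(\mathbf B\mathbf Q^{-1}\mathbf B^* )_{j.}(\widetilde{\mathbf d}_{t.})$ and $\mathbf d^{\mathbf A}_{i.}$ have $f$-th entry $\operatorname{cdet}_i(\mathbf A^{\sharp}\mathbf A)_{.i}(\widetilde{\mathbf d}_{.f})$. Then $$x_{ij}=\frac{\operatorname{cdet}_i(\mathbf A^{\sharp}\mathbf A)_{.i}(\mathbf d^{\mathbf B}_{.j})}{\det(\mathbf A^{\sharp}\mathbf A)\det(\mathbf B\mathbf Q^{-1}\mathbf B^* )}=\frac{\operatorname{rdet}_j(\mathbf B\mathbf Q^{-1}\mathbf B^* )_{j.}(\mathbf d^{\mathbf A}_{i.})}{\det(\mathbf A^{\sharp}\mathbf A)\det(\mathbf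 B\mathbf Q^{-1}\mathbf B^* )}.$$ (iii) If $r_1=n$, $r_2<p$: let $\widetilde{\mathbf D}=\mathbf A^{\sharp}\mathbf D\mathbf Q^{-1}\mathbf B^*\mathbf P^{1/2}$; define $\mathbf d^{\mathbf B}_{.j}$ by the formula of (i) and $\mathbf d^{\mathbf A}_{i.}$ by the formula of (ii), using this $\widetilde{\mathbf D}$. Then $$x_{ij}=\frac{\operatorname{cdet}_i(\mathbf A^{\sharp}\mathbf A)_{.i}(\mathbf d^{\mathbf B}_{.j})}{\det(\mathbf A^{\sharp}\mathbf A)\,\Delta_B}=\frac{\sum_{l=1}^{p}\sum_{\alpha\in I_{r_2,p}\{l\}}\operatorname{rdet}_l\big((\widetilde{\mathbf B}\widetilde{\mathbf B}^* )_{l.}(\mathbf d^{\mathbf A}_{i.})\big)^{\alpha}_{\alpha}\,p^{(1/2)}_{lj}}{\det(\mathbf A^{\sharp}\mathbf A)\,\Delta_B}.$$ (iv) If $r_1<n$, $r_2=p$: let $\widetilde{\mathbf D}=\mathbf A^{\sharp}\mathbf D\mathbf Q^{-1}\mathbf B^*$; define $\mathbf d^{\mathbf B}_{.j}$ by the formula of (ii) and $\mathbf d^{\mathbf A}_{i.}$ by the formula of (i), using this $\widetilde{\mathbf D}$. Then $$x_{ij}=\frac{\operatorname{rdet}_j(\mathbf B\mathbf Q^{-1}\mathbf B^* )_{j.}(\mathbf d^{\mathbf A}_{i.})}{\Delta_A\det(\mathbf B\mathbf Q^{-1}\mathbf B^* )}=\frac{\sum_{\beta\in J_{r_1,n}\{i\}}\operatorname{cdet}_i\big((\mathbf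 A^{\sharp}\mathbf A)_{.i}(\mathbf d^{\mathbf B}_{.j})\big)^{\beta}_{\beta}}{\Delta_A\det(\mathbf B\mathbf Q^{-1}\mathbf B^* )}.$$
   Context: $\mathbb H$ is the real quaternion skew field; $\mathbb H^{m\times n}$ the $m\times n$ quaternion matrices; $\mathrm M(n,\mathbb H)=\mathbb H^{n\times n}$; $\mathbf C^*$ the conjugate transpose; rank is the maximal number of right-linearly independent columns. A square $\mathbf H$ is Hermitian if $\mathbf H^*=\mathbf H$, positive definite if also $\mathbf x^*\mathbf H\mathbf x>0$ for all nonzero $\mathbf x$. For Hermitian positive definite $\mathbf H$, $\mathbf H^{1/2}$ is its unique Hermitian positive definite square root and $\mathbf H^{-1/2}=(\mathbf H^{1/2})^{-1}$. Row and column determinants of $\mathbf C=(c_{ij})\in\mathrm M(n,\mathbb H)$: for $i\in\{1,\dots,n\}$, write each $\sigma\in S_n$ as a product of $r$ disjoint cycles (fixed points included) as $\sigma=(i\,i_{k_1}\,i_{k_1+1}\dots i_{k_1+l_1})(i_{k_2}\dots i_{k_2+l_2})\cdots(i_{k_r}\dots i_{k_r+l_r})$, where the first cycle contains $i$ and starts with $i$, every other cycle starts with its smallest element, and $i_{k_2}<\dots<i_{k_r}$; then $\operatorname{rdet}_i\mathbf C=\sum_{\sigma\in S_n}(-1)^{n-r}(c_{i\,i_{k_1}}c_{i_{k_1}i_{k_1+1}}\cdots c_{i_{k_1+l_1}\,i})\cdots(c_{i_{k_r}i_{k_r+1}}\cdots c_{i_{k_r+l_r}i_{k_r}})$. For $j\in\{1,\dots,n\}$,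 write each $\tau\in S_n$ as $\tau=(j_{k_r+l_r}\dots j_{k_r+1}j_{k_r})\cdots(j_{k_2+l_2}\dots j_{k_2})(j_{k_1+l_1}\dots j_{k_1+1}j_{k_1}\,j)$, where the last cycle contains $j$ and ends with $j$, every other cycle ends with its smallest element, and $j_{k_2}<\dots<j_{k_r}$; then $\operatorname{cdet}_j\mathbf C=\sum_{\tau\in S_n}(-1)^{n-r}(c_{j_{k_r}j_{k_r+l_r}}\cdots c_{j_{k_r+1}j_{k_r}})\cdots(c_{j\,j_{k_1+l_1}}\cdots c_{j_{k_1+1}j_{k_1}}c_{j_{k_1}j})$. For Hermitian $\mathbf C$ all $\operatorname{rdet}_i\mathbf C$ and $\operatorname{cdet}_j\mathbf C$ coincide and are real; this common value is $\det\mathbf C$. Notation: $\mathbf c_{.j}$, $\mathbf c_{i.}$ are the $j$-th column and $i$-th row of $\mathbf C$; $\mathbf C_{.j}(\mathbf b)$ (resp. $\mathbf C_{i.}(\mathbf b)$) is $\mathbf C$ with its $j$-th column (resp. $i$-th row) replaced by $\mathbf b$. $\mathbf C^{\alpha}_{\beta}$ is the submatrix with rows indexed by $\alpha$ and columns by $\beta$. $L_{k,n}$ is the set of strictly increasing sequences of $k$ integers from $\{1,\dots,n\}$; $I_{r,m}\{i\}=\{\alpha\in L_{r,m}: i\in\alpha\}$, $J_{r,n}\{j\}=\{\beta\in L_{r,n}: j\in\beta\}$, and $I_{r,m}=L_{r,m}$, $J_{r,n}=L_{r,n}$. For $i\in\beta$, $\operatorname{cdet}_i(\mathbf C_{.i}(\mathbf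 b))^{\beta}_{\beta}$ is the column determinant of the square matrix $(\mathbf C_{.i}(\mathbf b))^{\beta}_{\beta}$ with respect to its column corresponding to index $i$; similarly $\operatorname{rdet}_j(\mathbf C_{j.}(\mathbf b))^{\alpha}_{\alpha}$ for $j\in\alpha$ with respect to the row corresponding to $j$. Weighted Moore–Penrose inverse: for $\mathbf A\in\mathbb H^{m\times n}$ and Hermitian positive definite $\mathbf M$ (order $m$), $\mathbf N$ (order $n$), $\mathbf A^{\dagger}_{M,N}$ is the unique $\mathbf Y\in\mathbb H^{n\times m}$ with $\mathbf A\mathbf Y\mathbf A=\mathbf A$, $\mathbf Y\mathbf A\mathbf Y=\mathbf Y$, $(\mathbf M\mathbf A\mathbf Y)^*=\mathbf M\mathbf A\mathbf Y$, $(\mathbf N\mathbf Y\mathbf A)^*=\mathbf N\mathbf Y\mathbf A$. Standing setting: $\mathbf A\in\mathbb H^{m\times n}$ of rank $r_1\ge1$, $\mathbf B\in\mathbb H^{p\times q}$ of rank $r_2\ge1$, $\mathbf D\in\mathbb H^{m\times q}$; $\mathbf M,\mathbf N,\mathbf P,\mathbf Q$ Hermitian positive definite of orders $m,n,p,q$. $\mathbf A^{\sharp}=\mathbf N^{-1}\mathbf A^*\mathbf M$, $\mathbf B^{\sharp}=\mathbf Q^{-1}\mathbf B^*\mathbf P$, $\widetilde{\mathbf A}=\mathbf M^{1/2}\mathbf A\mathbf N^{-1/2}$, $\widetilde{\mathbf B}=\mathbf P^{1/2}\mathbf B\mathbf Q^{-1/2}$; $n^{(-1/2)}_{ik}$ are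 the entries of $\mathbf N^{-1/2}$ and $p^{(1/2)}_{lj}$ those of $\mathbf P^{1/2}$. $\mathbf X=(x_{ij}):=\mathbf A^{\dagger}_{M,N}\mathbf D\mathbf B^{\dagger}_{P,Q}\in\mathbb H^{n\times p}$ (this is the unique solution of $\mathbf A\mathbf X\mathbf B=\mathbf D$ under the paper's range restrictions). *)

theory Defs
  imports Complex_Main "HOL-Combinatorics.Permutations"
begin

datatype quat = Quat (qre: real) (qi: real) (qj: real) (qk: real)

instantiation quat :: ring_1
begin
definition "0 = Quat 0 0 0 0"
definition "1 = Quat 1 0 0 0"
definition "x + y = Quat (qre x + qre y) (qi x + qi y) (qj x + qj y) (qk x + qk y)"
definition "x - y = Quat (qre x - qre y) (qi x - qi y) (qj x - qj y) (qk x - qk y)"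
definition "- x = Quat (- qre x) (- qi x) (- qj x) (- qk x)"
definition "x * y = Quat
   (qre x * qre y - qi x * qi y - qj x * qj y - qk x * qk y)
   (qre x * qi y + qi x * qre y + qj x * qk y - qk x * qj y)
   (qre x * qj y - qi x * qk y + qj x * qre y + qk x * qi y)
   (qre x * qk y + qi x * qj y - qj x * qi y + qk x * qre y)"
instance
  by standard (auto simp: zero_quat_def one_quat_def plus_quat_def minus_quat_def
      uminus_quat_def times_quat_def algebra_simps)
end

definition cnj :: "quat \<Rightarrow> quat" where
  "cnj x = Quat (qre x) (- qi x) (- qj x) (- qk x)"

definition qscale :: "real \<Rightarrow> quat \<Rightarrow> quat" where
  "qscale r x = Quat (r * qre x) (r * qi x) (r * qj x) (r * qk x)"

text \<open>Matrices are functions nat => nat => quat with explicit dimensions;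
  indices are 0-based, an m x n matrix uses the entries with i < m, j < n.\<close>
type_synonym qmat = "nat \<Rightarrow> nat \<Rightarrow> quat"

definition mmult :: "nat \<Rightarrow> qmat \<Rightarrow> qmat \<Rightarrow> qmat" where
  "mmult k A B = (\<lambda>i j. \<Sum>l<k. A i l * B l j)"

definition adj :: "qmat \<Rightarrow> qmat" where
  "adj A = (\<lambda>i j. cnj (A j i))"

definition idm :: qmat where
  "idm = (\<lambda>i j. if i = j then 1 else 0)"

definition meq :: "nat \<Rightarrow> nat \<Rightarrow> qmat \<Rightarrow> qmat \<Rightarrow> bool" where
  "meq m n X Y \<longleftrightarrow> (\<forall>i<m. \<forall>j<n. X i j = Y i j)"

definition zero_out :: "nat \<Rightarrow> nat \<Rightarrow> qmat \<Rightarrow> bool" where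
  "zero_out m n X \<longleftrightarrow> (\<forall>i j. \<not> (i < m \<and> j < n) \<longrightarrow> X i j = 0)"

definition herm :: "nat \<Rightarrow> qmat \<Rightarrow> bool" where
  "herm n H \<longleftrightarrow> (\<forall>i<n. \<forall>j<n. H i j = cnj (H j i))"

definition hpd :: "nat \<Rightarrow> qmat \<Rightarrow> bool" where
  "hpd n H \<longleftrightarrow> herm n H \<and>
     (\<forall>x::nat \<Rightarrow> quat. (\<exists>i<n. x i \<noteq> 0) \<longrightarrow>
        0 < qre (\<Sum>i<n. \<Sum>j<n. cnj (x i) * H i j * x j))"

definition minv :: "nat \<Rightarrow> qmat \<Rightarrow> qmat" where
  "minv n H = (THE Y. zero_out n n Y \<and> meq n n (mmult n H Y) idm \<and> meq n n (mmult n Y H) idm)"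

definition msqrt :: "nat \<Rightarrow> qmat \<Rightarrow> qmat" where
  "msqrt n H = (THE S. zero_out n n S \<and> hpd n S \<and> meq n n (mmult n S S) H)"

definition rlin_indep :: "nat \<Rightarrow> qmat \<Rightarrow> nat set \<Rightarrow> bool" where
  "rlin_indep m A S \<longleftrightarrow>
     (\<forall>c::nat \<Rightarrow> quat. (\<forall>k<m. (\<Sum>j\<in>S. A k j * c j) = 0) \<longrightarrow> (\<forall>j\<in>S. c j = 0))"

definition mrank :: "nat \<Rightarrow> nat \<Rightarrow> qmat \<Rightarrow> nat" where
  "mrank m n A = Max {card S | S. S \<subseteq> {..<n} \<and> rlin_indep m A S}"

definition wmp :: "nat \<Rightarrow> nat \<Rightarrow> qmat \<Rightarrow> qmat \<Rightarrow> qmat \<Rightarrow> qmat" where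
  "wmp m n A M N = (THE Y. zero_out n m Y
      \<and> meq m n (mmult m (mmult n A Y) A) A
      \<and> meq n m (mmult n (mmult m Y A) Y) Y
      \<and> herm m (mmult m M (mmult n A Y))
      \<and> herm n (mmult n N (mmult m Y A)))"

text \<open>All determinants are taken of the principal submatrix with index set S
  (a finite set of row/column indices, in increasing order).
  For a permutation s of S, the cycle through x is walked as x, s x, s(s x), ...\<close>

definition cyc_len :: "(nat \<Rightarrow> nat) \<Rightarrow> nat \<Rightarrow> nat" where
  "cyc_len s x = (LEAST k. 0 < k \<and> (s ^^ k) x = x)"

definition cyc_prod :: "qmat \<Rightarrow> (nat \<Rightarrow> nat) \<Rightarrow> nat \<Rightarrow> quat" where
  "cyc_prod C s x = prod_list (map (\<lambda>k. C ((s ^^ k) x) ((s ^^ Suc k) x)) [0..<cyc_len s x])"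

definition cyc_reps :: "(nat \<Rightarrow> nat) \<Rightarrow> nat set \<Rightarrow> nat set" where
  "cyc_reps s S = {x \<in> S. \<forall>k. x \<le> (s ^^ k) x}"

definition other_reps :: "(nat \<Rightarrow> nat) \<Rightarrow> nat set \<Rightarrow> nat \<Rightarrow> nat set" where
  "other_reps s S i = {x \<in> cyc_reps s S. \<forall>k. (s ^^ k) x \<noteq> i}"

definition rdet_on :: "qmat \<Rightarrow> nat set \<Rightarrow> nat \<Rightarrow> quat" where
  "rdet_on C S i = (\<Sum>s | s permutes S.
      (- 1) ^ (card S - card (cyc_reps s S)) *
      (cyc_prod C s i * prod_list (map (cyc_prod C s) (sorted_list_of_set (other_reps s S i)))))"

definition cdet_on :: "qmat \<Rightarrow> nat set \<Rightarrow> nat \<Rightarrow> quat" where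
  "cdet_on C S j = (\<Sum>s | s permutes S.
      (- 1) ^ (card S - card (cyc_reps s S)) *
      (prod_list (map (cyc_prod C s) (rev (sorted_list_of_set (other_reps s S j)))) * cyc_prod C s j))"

text \<open>Determinant of a Hermitian matrix (principal submatrix on S): the common real value
  of all row/column determinants; we take the real part of rdet at the least index.\<close>
definition hdet :: "qmat \<Rightarrow> nat set \<Rightarrow> real" where
  "hdet C S = qre (rdet_on C S (Min S))"

definition row_repl :: "qmat \<Rightarrow> nat \<Rightarrow> (nat \<Rightarrow> quat) \<Rightarrow> qmat" where
  "row_repl C l b = (\<lambda>a c. if a = l then b c else C a c)"

definition col_repl :: "qmat \<Rightarrow> nat \<Rightarrow> (nat \<Rightarrow> quat) \<Rightarrow> qmat" where
  "col_repl C i b = (\<lambda>a c. if c = i then b a else C a c)"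

definition idx_sets :: "nat \<Rightarrow> nat \<Rightarrow> nat set set" where
  "idx_sets n r = {b. b \<subseteq> {..<n} \<and> card b = r}"

definition asharp :: "nat \<Rightarrow> nat \<Rightarrow> qmat \<Rightarrow> qmat \<Rightarrow> qmat \<Rightarrow> qmat" where
  "asharp m n A M N = mmult n (minv n N) (mmult m (adj A) M)"

definition btilde :: "nat \<Rightarrow> nat \<Rightarrow> qmat \<Rightarrow> qmat \<Rightarrow> qmat \<Rightarrow> qmat" where
  "btilde p q B P Q = mmult q (mmult p (msqrt p P) B) (minv q (msqrt q Q))"

definition dB_minor :: "nat \<Rightarrow> nat \<Rightarrow> qmat \<Rightarrow> qmat \<Rightarrow> qmat \<Rightarrow> nat \<Rightarrow> qmat \<Rightarrow> nat \<Rightarrow> nat \<Rightarrow> quat" where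
  "dB_minor p q B P Q r2 Dt j t =
     (\<Sum>l<p. \<Sum>a\<in>{a \<in> idx_sets p r2. l \<in> a}.
        rdet_on (row_repl (mmult q (btilde p q B P Q) (adj (btilde p q B P Q))) l (\<lambda>c. Dt t c)) a l
        * msqrt p P l j)"

definition dA_minor :: "nat \<Rightarrow> nat \<Rightarrow> qmat \<Rightarrow> qmat \<Rightarrow> qmat \<Rightarrow> nat \<Rightarrow> qmat \<Rightarrow> nat \<Rightarrow> nat \<Rightarrow> quat" where
  "dA_minor m n A M N r1 Dt i f =
     (\<Sum>b\<in>{b \<in> idx_sets n r1. i \<in> b}.
        cdet_on (col_repl (mmult m (asharp m n A M N) A) i (\<lambda>a. Dt a f)) b i)"

definition dB_full :: "nat \<Rightarrow> nat \<Rightarrow> qmat \<Rightarrow> qmat \<Rightarrow> qmat \<Rightarrow> nat \<Rightarrow> nat \<Rightarrow> quat" where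
  "dB_full p q B Q Dt j t =
     rdet_on (row_repl (mmult q (mmult q B (minv q Q)) (adj B)) j (\<lambda>c. Dt t c)) {..<p} j"

definition dA_full :: "nat \<Rightarrow> nat \<Rightarrow> qmat \<Rightarrow> qmat \<Rightarrow> qmat \<Rightarrow> qmat \<Rightarrow> nat \<Rightarrow> nat \<Rightarrow> quat" where
  "dA_full m n A M N Dt i f =
     cdet_on (col_repl (mmult m (asharp m n A M N) A) i (\<lambda>a. Dt a f)) {..<n} i"
end

theory Submission
  imports Defs "HOL-Combinatorics.Cycles"
    "HOL-Computational_Algebra.Fundamental_Theorem_Algebra"
begin

text \<open>
  Splitting off the cycle through \<open>i\<close> expresses row and column determinants as sums over cycles
  \<open>i \<rightarrow> x\<^sub>1 \<rightarrow> \<dots> \<rightarrow> x\<^sub>k \<rightarrow> i\<close>. For Hermitian \<open>H\<close> the contribution of the remaining vertices is real (reverse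
  the cycles) and does not depend on the starting points (rotate the cycles), so sums over paths
  \<open>i \<rightarrow> \<dots> \<rightarrow> j\<close> yield an adjugate matrix, and \<open>rdet\<^sub>l\<close> and \<open>cdet\<^sub>i\<close> of \<open>H\<close> with a replaced row or column are
  products with it. The sums \<open>C\<^sub>k\<close> and \<open>d\<^sub>k\<close> of all principal adjugates and minors of order \<open>k\<close> satisfy the
  Faddeev--LeVerrier recursion \<open>H C\<^sub>k + C\<^sub>k\<^sub>+\<^sub>1 = d\<^sub>k I\<close>. If \<open>H = X\<^sup>* M X\<close> with \<open>M\<close> positive definite and
  \<open>r = rank X\<close>, then \<open>d\<^sub>r > 0\<close> and \<open>d\<^sub>k = 0\<close> for \<open>k > r\<close>, hence \<open>C\<^sub>r / d\<^sub>r\<close> is an inner inverse of \<open>H\<close> commuting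
  with \<open>H\<close>. Both weighted Moore--Penrose inverses are expressed by such inner inverses, for
  \<open>A\<^sup>\<sharp> A\<close> (which equals \<open>(A N\<^sup>-\<^sup>1\<^sup>/\<^sup>2)\<^sup>* M (A N\<^sup>-\<^sup>1\<^sup>/\<^sup>2)\<close> when it is Hermitian, because it then commutes with \<open>N\<^sup>1\<^sup>/\<^sup>2\<close>) and
  for \<open>P\<^sup>1\<^sup>/\<^sup>2 B Q\<^sup>-\<^sup>1 B\<^sup>* P\<^sup>1\<^sup>/\<^sup>2\<close> or \<open>B Q\<^sup>-\<^sup>1 B\<^sup>*\<close>. Square roots exist since the recursion provides an annihilating
  real polynomial, which positive definiteness reduces to one with simple positive roots;
  the fourth root can then be interpolated.
\<close>

section \<open>Quaternions\<close>

text \<open>Ordered products of quaternions do not regroup, so minors of matrix products are never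
  expanded. The only bridge between determinants and matrix algebra is the identity that a Hermitian
  matrix times its adjugate is its real determinant times the identity. Two facts replace
  commutativity: real numbers are central, and the real part of a product, hence of a trace, is
  cyclic.

  The quotient of the adjugate sum by the minor sum is only an inner inverse, not the Moore-Penrose
  inverse: it may act on the kernel, and for diag(1, 0) it is the identity. The outer factors from
  \<open>A\<close>, \<open>B\<close> and the weights remove this surplus. The Penrose equations come
  from cancellation: the defect of an identity, paired with itself under a positive definite weight,
  gives zero and must vanish. Summing over all index sets of size \<open>r\<close>, instead of
  choosing one regular minor, makes the inverse a polynomial in the matrix, so that it commutes with
  it.\<close>

lemma quat_eq_iff: "x = y \<longleftrightarrow> qre x = qre y \<and> qi x = qi y \<and> qj x = qj y \<and> qk x = qk y"
  for x y :: quat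
  by (auto intro: quat.expand)

lemmas quat_arith_defs = zero_quat_def one_quat_def plus_quat_def minus_quat_def
  uminus_quat_def times_quat_def

definition qnsq :: "quat \<Rightarrow> real" where
  "qnsq x = (qre x)\<^sup>2 + (qi x)\<^sup>2 + (qj x)\<^sup>2 + (qk x)\<^sup>2"

lemma qnsq_nonneg: "0 \<le> qnsq x"
  by (simp add: qnsq_def)

lemma qnsq_eq_0_iff: "qnsq x = 0 \<longleftrightarrow> x = 0"
  by (auto simp: qnsq_def quat_eq_iff zero_quat_def add_nonneg_eq_0_iff)

text \<open>With \<open>scaleR\<close> real scalars are central by the class laws, so determinants
  pass through products of quaternions; the division serves elimination among columns.\<close>

instantiation quat :: real_div_algebra
begin
definition scaleR_quat :: "real \<Rightarrow> quat \<Rightarrow> quat" where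
  "scaleR_quat = qscale"
definition inverse_quat :: "quat \<Rightarrow> quat" where
  "inverse_quat x = qscale (1 / qnsq x) (Defs.cnj x)"
definition divide_quat :: "quat \<Rightarrow> quat \<Rightarrow> quat" where
  "divide_quat x y = x * inverse y"
instance
proof
  fix x y :: quat and a b :: real
  show "a *\<^sub>R (x + y) = a *\<^sub>R x + a *\<^sub>R y" "(a + b) *\<^sub>R x = a *\<^sub>R x + b *\<^sub>R x"
    "a *\<^sub>R b *\<^sub>R x = (a * b) *\<^sub>R x" "1 *\<^sub>R x = x"
    "a *\<^sub>R x * y = a *\<^sub>R (x * y)" "x * a *\<^sub>R y = a *\<^sub>R (x * y)"
    by (auto simp: scaleR_quat_def qscale_def quat_arith_defs algebra_simps)
  show "inverse 0 = (0::quat)"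
    by (auto simp: inverse_quat_def qscale_def cnj_def quat_arith_defs)
  show "x div y = x * inverse y"
    by (rule divide_quat_def)
  assume "x \<noteq> 0"
  then have "qnsq x \<noteq> 0"
    by (simp add: qnsq_eq_0_iff)
  then show "inverse x * x = 1" "x * inverse x = 1"
    by (auto simp: inverse_quat_def qscale_def cnj_def quat_arith_defs field_simps)
      (auto simp: qnsq_def power2_eq_square)
qed
end

lemma qscale_eq_scaleR: "qscale = scaleR"
  by (simp add: scaleR_quat_def)

lemma cnj_add [simp]: "Defs.cnj (x + y) = Defs.cnj x + Defs.cnj y"
  and cnj_minus [simp]: "Defs.cnj (- x) = - Defs.cnj x"
  and cnj_mult [simp]: "Defs.cnj (x * y) = Defs.cnj y * Defs.cnj x"
  and cnj_0 [simp]: "Defs.cnj 0 = 0"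
  and cnj_1 [simp]: "Defs.cnj 1 = 1"
  and cnj_cnj [simp]: "Defs.cnj (Defs.cnj x) = x"
  and cnj_scaleR [simp]: "Defs.cnj (a *\<^sub>R x) = a *\<^sub>R Defs.cnj x"
  by (auto simp: cnj_def scaleR_quat_def qscale_def quat_arith_defs algebra_simps)

lemma cnj_eq_0_iff [simp]: "Defs.cnj x = 0 \<longleftrightarrow> x = 0"
  by (auto simp: cnj_def quat_eq_iff zero_quat_def)

lemma qre_add [simp]: "qre (x + y) = qre x + qre y"
  and qre_minus [simp]: "qre (- x) = - qre x"
  and qre_diff [simp]: "qre (x - y) = qre x - qre y"
  and qre_0 [simp]: "qre 0 = 0"
  and qre_1 [simp]: "qre 1 = 1"
  and qre_cnj [simp]: "qre (Defs.cnj x) = qre x"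
  and qre_scaleR [simp]: "qre (a *\<^sub>R x) = a * qre x"
  by (auto simp: cnj_def scaleR_quat_def qscale_def quat_arith_defs)

lemma qre_sum: "qre (sum f S) = (\<Sum>x\<in>S. qre (f x))"
  by (induction S rule: infinite_finite_induct) auto

lemma cnj_sum: "Defs.cnj (sum f S) = (\<Sum>x\<in>S. Defs.cnj (f x))"
  by (induction S rule: infinite_finite_induct) auto

text \<open>This lets a cycle be rotated to another starting point and makes the real trace
  cyclic.\<close>

lemma qre_mult_commute: "qre (x * y) = qre (y * x)"
  by (simp add: times_quat_def algebra_simps)

lemma qre_cnj_mult_self: "qre (Defs.cnj x * x) = qnsq x"
  by (simp add: cnj_def times_quat_def qnsq_def power2_eq_square)

lemma qre_of_real [simp]: "qre (of_real a) = a"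
  by (simp add: of_real_def)

lemma cnj_of_real [simp]: "Defs.cnj (of_real a) = of_real a"
  by (simp add: of_real_def)

lemma cnj_eq_self_imp_real: "Defs.cnj x = x \<Longrightarrow> x = of_real (qre x)"
  by (auto simp: cnj_def quat_eq_iff of_real_def scaleR_quat_def qscale_def one_quat_def)

lemma of_real_quat_commute: "of_real a * x = x * (of_real a :: quat)"
  by (simp add: of_real_def)

section \<open>Sums over lists of distinct elements\<close>

text \<open>A cycle through \<open>i\<close> in \<open>S\<close> is \<open>i # xs\<close> with
  \<open>xs\<close> in \<open>dlists (S - {i})\<close>; the empty list stands for a fixed
  point.\<close>

definition dlists :: "'a set \<Rightarrow> 'a list set" where
  "dlists T = {xs. distinct xs \<and> set xs \<subseteq> T}"

text \<open>The two halves of a path cut at a vertex, or two disjoint cycles without their starting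
  points. The description is symmetric, so the components can be exchanged.\<close>

definition dlist_pairs :: "'a set \<Rightarrow> ('a list \<times> 'a list) set" where
  "dlist_pairs T = {(u, v). distinct (u @ v) \<and> set (u @ v) \<subseteq> T}"

lemma finite_dlists: "finite T \<Longrightarrow> finite (dlists T)"
  unfolding dlists_def using finite_subset_distinct[of T] by (simp add: conj_commute)

lemma dlist_pairs_Sigma: "dlist_pairs T = Sigma (dlists T) (\<lambda>u. dlists (T - set u))"
  by (auto simp: dlist_pairs_def dlists_def)

lemma sum_dlist_pairs:
  assumes "finite T"
  shows "(\<Sum>u\<in>dlists T. \<Sum>v\<in>dlists (T - set u). f u v) = (\<Sum>(u, v)\<in>dlist_pairs T. f u v)"
  unfolding dlist_pairs_Sigma
  by (rule sum.Sigma) (auto intro: finite_dlists assms)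

lemma sum_dlist_pairs_swap: "(\<Sum>(u, v)\<in>dlist_pairs T. f u v) = (\<Sum>(u, v)\<in>dlist_pairs T. f v u)"
  by (rule sum.reindex_bij_witness[where i = prod.swap and j = prod.swap])
     (auto simp: dlist_pairs_def)

lemma sum_dlists_rev: "(\<Sum>xs\<in>dlists T. f (rev xs)) = (\<Sum>xs\<in>dlists T. f xs)"
  by (rule sum.reindex_bij_witness[where i = rev and j = rev]) (auto simp: dlists_def)

lemma sum_dlists_Cons:
  fixes f :: "'a list \<Rightarrow> 'b::comm_monoid_add"
  assumes "finite T"
  shows "(\<Sum>xs\<in>dlists T. f xs) = f [] + (\<Sum>l\<in>T. \<Sum>ys\<in>dlists (T - {l}). f (l # ys))"
proof -
  have eq: "dlists T = insert [] ((\<lambda>(l, ys). l # ys) ` Sigma T (\<lambda>l. dlists (T - {l})))"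
  proof (intro set_eqI iffI)
    fix xs assume "xs \<in> dlists T"
    then show "xs \<in> insert [] ((\<lambda>(l, ys). l # ys) ` Sigma T (\<lambda>l. dlists (T - {l})))"
      by (cases xs) (auto simp: dlists_def image_iff)
  qed (auto simp: dlists_def)
  have fin: "finite (Sigma T (\<lambda>l. dlists (T - {l})))"
    by (intro finite_SigmaI finite_dlists) (use assms in auto)
  have inj: "inj_on (\<lambda>(l, ys). l # ys) (Sigma T (\<lambda>l. dlists (T - {l})))"
    by (auto simp: inj_on_def)
  have "(\<Sum>xs\<in>dlists T. f xs) = f [] + (\<Sum>xs\<in>(\<lambda>(l, ys). l # ys) ` Sigma T (\<lambda>l. dlists (T - {l})). f xs)"
    unfolding eq by (rule sum.insert) (use fin in auto)
  also have "\<dots> = f [] + (\<Sum>(l, ys)\<in>Sigma T (\<lambda>l. dlists (T - {l})). f (l # ys))"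
    by (subst sum.reindex[OF inj]) (simp add: case_prod_unfold)
  also have "\<dots> = f [] + (\<Sum>l\<in>T. \<Sum>ys\<in>dlists (T - {l}). f (l # ys))"
    by (subst sum.Sigma) (auto intro!: finite_dlists assms)
  finally show ?thesis .
qed

lemma sum_dlists_snoc:
  fixes f :: "'a list \<Rightarrow> 'b::comm_monoid_add"
  assumes "finite T"
  shows "(\<Sum>xs\<in>dlists T. f xs) = f [] + (\<Sum>l\<in>T. \<Sum>ys\<in>dlists (T - {l}). f (ys @ [l]))"
proof -
  have "(\<Sum>xs\<in>dlists T. f xs) = (\<Sum>xs\<in>dlists T. f (rev xs))"
    by (simp add: sum_dlists_rev)
  also have "\<dots> = f [] + (\<Sum>l\<in>T. \<Sum>ys\<in>dlists (T - {l}). f (rev ys @ [l]))"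
    by (subst sum_dlists_Cons[OF assms]) simp
  also have "\<dots> = f [] + (\<Sum>l\<in>T. \<Sum>ys\<in>dlists (T - {l}). f (ys @ [l]))"
    by (subst sum_dlists_rev[where f = "\<lambda>ys. f (ys @ [_])"]) simp
  finally show ?thesis .
qed

text \<open>A list of distinct vertices avoids \<open>j\<close> or is cut uniquely at
  \<open>j\<close> into disjoint halves. Cutting and joining cycles below always goes through this
  split.\<close>

lemma sum_dlists_split:
  fixes f :: "'a list \<Rightarrow> 'b::comm_monoid_add"
  assumes fin: "finite T" and j: "j \<in> T"
  shows "(\<Sum>xs\<in>dlists T. f xs)
    = (\<Sum>(u, v)\<in>dlist_pairs (T - {j}). f (u @ j # v)) + (\<Sum>xs\<in>dlists (T - {j}). f xs)"
proof -
  have eq: "dlists T = (\<lambda>(u, v). u @ j # v) ` dlist_pairs (T - {j}) \<union> dlists (T - {j})"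
  proof (intro set_eqI iffI)
    fix xs assume xs: "xs \<in> dlists T"
    show "xs \<in> (\<lambda>(u, v). u @ j # v) ` dlist_pairs (T - {j}) \<union> dlists (T - {j})"
    proof (cases "j \<in> set xs")
      case True
      then obtain u v where uv: "xs = u @ j # v"
        by (meson split_list)
      then have "(u, v) \<in> dlist_pairs (T - {j})"
        using xs by (auto simp: dlists_def dlist_pairs_def)
      then show ?thesis
        unfolding uv by (intro UnI1 image_eqI[of _ _ "(u, v)"]) auto
    qed (use xs in \<open>auto simp: dlists_def\<close>)
  qed (use j in \<open>auto simp: dlists_def dlist_pairs_def\<close>)
  have inj: "inj_on (\<lambda>(u, v). u @ j # v) (dlist_pairs (T - {j}))"
    by (auto simp: inj_on_def dlist_pairs_def subset_Diff_insert append_Cons_eq_iff)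
  have fin': "finite (dlist_pairs (T - {j}))"
    unfolding dlist_pairs_Sigma by (intro finite_SigmaI finite_dlists) (use fin in auto)
  have "(\<Sum>xs\<in>dlists T. f xs) = (\<Sum>xs\<in>(\<lambda>(u, v). u @ j # v) ` dlist_pairs (T - {j}). f xs)
      + (\<Sum>xs\<in>dlists (T - {j}). f xs)"
    unfolding eq using fin fin'
    by (intro sum.union_disjoint) (auto intro: finite_dlists, auto simp: dlists_def)
  then show ?thesis
    unfolding sum.reindex[OF inj] by (simp add: case_prod_unfold)
qed

section \<open>Row and column determinants as sums over cycles\<close>

text \<open>The weight of a path, with one sign per edge: the sign of a permutation is then carried by its
  cycles, a cycle of weight \<open>w\<close> contributing the factor \<open>- w\<close>.\<close>

fun spw :: "qmat \<Rightarrow> nat list \<Rightarrow> quat" where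
  "spw H (x # y # ys) = - H x y * spw H (y # ys)"
| "spw H _ = 1"

lemma spw_append: "spw H (u @ x # v) = spw H (u @ [x]) * spw H (x # v)"
  by (induction H u rule: spw.induct) (auto simp: mult.assoc)

lemma spw_cong: "(\<And>x y. x \<in> set xs \<Longrightarrow> y \<in> set xs \<Longrightarrow> C x y = C' x y) \<Longrightarrow> spw C xs = spw C' xs"
  by (induction C xs rule: spw.induct) auto

lemma cnj_spw:
  assumes "\<And>i j. H j i = Defs.cnj (H i j)"
  shows "Defs.cnj (spw H xs) = spw H (rev xs)"
  using assms
proof (induction H xs rule: spw.induct)
  case (1 H x y ys)
  have "spw H (rev (x # y # ys)) = spw H (rev (y # ys)) * - H y x"
    using spw_append[of H "rev ys" y "[x]"] by simp
  then show ?case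
    using 1(1)[OF 1(2)] 1(2)[of y x] by simp
qed auto

lemma spw_eq_prod_list:
  "spw H ys = prod_list (map (\<lambda>k. - H (ys ! k) (ys ! Suc k)) [0..<length ys - 1])"
proof (induction H ys rule: spw.induct)
  case (1 H x y ys)
  have "[0..<length (x # y # ys) - 1] = 0 # map Suc [0..<length (y # ys) - 1]"
    by (simp only: map_Suc_upt) (simp add: upt_conv_Cons del: upt_Suc)
  then show ?case
    using 1 by (simp add: o_def)
qed auto

lemma prod_list_uminus:
  "prod_list (map (\<lambda>k. - f k) ks) = (- 1) ^ length ks * prod_list (map f ks)" for f :: "'a \<Rightarrow> 'b::ring_1"
proof (induction ks)
  case (Cons k ks)
  have "f k * ((- 1) ^ length ks * p) = (- 1) ^ length ks * (f k * p)" for p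
    by (cases "even (length ks)") auto
  with Cons show ?case by simp
qed simp

text \<open>What remains of a row determinant once one cycle is removed: every cycle starts at its
  least element. Unlike a row determinant it needs no distinguished index, so it makes sense for the
  empty set.\<close>

definition psum :: "qmat \<Rightarrow> nat set \<Rightarrow> quat" where
  "psum C T = (\<Sum>t | t permutes T. (- 1) ^ (card T - card (cyc_reps t T)) *
      prod_list (map (cyc_prod C t) (sorted_list_of_set (cyc_reps t T))))"

definition psum_rev :: "qmat \<Rightarrow> nat set \<Rightarrow> quat" where
  "psum_rev C T = (\<Sum>t | t permutes T. (- 1) ^ (card T - card (cyc_reps t T)) *
      prod_list (map (cyc_prod C t) (rev (sorted_list_of_set (cyc_reps t T)))))"

text \<open>A permutation is its cycle through \<open>i\<close>, read off as a list from
  \<open>i\<close>, together with its restriction to the other vertices. The assumption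
  \<open>supp\<close> says that the composite really has the prescribed cycle; the locale below
  supplies it.\<close>

lemma sum_permutes_cycle:
  fixes f :: "(nat \<Rightarrow> nat) \<Rightarrow> 'b::comm_monoid_add"
  assumes S: "finite S" "i \<in> S"
    and supp: "\<And>xs t. xs \<in> dlists (S - {i}) \<Longrightarrow> t permutes (S - set (i # xs)) \<Longrightarrow>
       support (cycle_of_list (i # xs) \<circ> t) i = i # xs"
  shows "(\<Sum>s | s permutes S. f s) = (\<Sum>xs\<in>dlists (S - {i}).
     \<Sum>t | t permutes (S - set (i # xs)). f (cycle_of_list (i # xs) \<circ> t))"
proof -
  \<comment> \<open>The restriction of \<open>s\<close> to the complement of the cycle through
    \<open>i\<close>, extended by the identity.\<close>
  let ?R = "\<lambda>s y. if y \<in> S - set (support s i) then s y else y"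
  have "(\<Sum>s | s permutes S. f s) = (\<Sum>(xs, t)\<in>Sigma (dlists (S - {i}))
     (\<lambda>xs. {t. t permutes (S - set (i # xs))}). f (cycle_of_list (i # xs) \<circ> t))"
  proof (rule sum.reindex_bij_witness[where i = "\<lambda>(xs, t). cycle_of_list (i # xs) \<circ> t"
        and j = "\<lambda>s. (tl (support s i), ?R s)"])
    fix s assume "s \<in> {s. s permutes S}"
    then have s: "s permutes S" by simp
    then have perm: "permutation s"
      using S(1) permutation_permutes by blast
    have "0 < least_power s i"
      by (rule least_power_of_permutation[OF perm])
    then have Cons: "i # tl (support s i) = support s i"
      by (simp add: upt_conv_Cons)
    have dist: "distinct (support s i)"
      by (rule cycle_of_permutation[OF perm])
    have sub: "set (support s i) \<subseteq> S"
      using permutes_in_image[OF permutes_funpow[OF s]] S(2) by auto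
    have semi: "?R s permutes (S - set (support s i))"
      by (rule semidecomposition[OF s S(1)])
    have "cycle_of_list (support s i) (?R s x) = s x" for x
    proof (cases "x \<in> S - set (support s i)")
      case True
      then have "?R s x \<in> S - set (support s i)"
        using permutes_in_image[OF semi, of x] by blast
      then have "cycle_of_list (support s i) (?R s x) = ?R s x"
        by (intro id_outside_supp) blast
      with True show ?thesis by simp
    next
      case False
      then have R: "?R s x = x" by auto
      show ?thesis
      proof (cases "x \<in> set (support s i)")
        case True
        then show ?thesis unfolding R using cycle_restrict[OF perm True] by simp
      next
        case False': False
        then have "x \<notin> S" using False by blast
        then have "s x = x" using s by (simp add: permutes_def)
        then show ?thesis unfolding R using id_outside_supp[OF False'] by simp
      qed
    qed
    then have inv: "cycle_of_list (support s i) \<circ> ?R s = s"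
      by (simp add: fun_eq_iff)
    show "(case (tl (support s i), ?R s) of (xs, t) \<Rightarrow> cycle_of_list (i # xs) \<circ> t) = s"
      unfolding prod.case Cons by (rule inv)
    then show "(case (tl (support s i), ?R s) of (xs, t) \<Rightarrow> f (cycle_of_list (i # xs) \<circ> t)) = f s"
      by simp
    have "distinct (i # tl (support s i))" "set (i # tl (support s i)) \<subseteq> S"
      unfolding Cons using dist sub by auto
    then have "tl (support s i) \<in> dlists (S - {i})"
      unfolding dlists_def by auto
    moreover have "?R s permutes (S - set (i # tl (support s i)))"
      unfolding Cons by (rule semi)
    ultimately show "(tl (support s i), ?R s) \<in> Sigma (dlists (S - {i})) (\<lambda>xs. {t. t permutes (S - set (i # xs))})"
      by blast
  next
    fix a assume "a \<in> Sigma (dlists (S - {i})) (\<lambda>xs. {t. t permutes (S - set (i # xs))})"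
    then obtain xs t where a: "a = (xs, t)" and xs: "xs \<in> dlists (S - {i})"
      and t: "t permutes (S - set (i # xs))" by auto
    let ?s = "cycle_of_list (i # xs) \<circ> t"
    have sup: "support ?s i = i # xs"
      by (rule supp[OF xs t])
    have sub: "set (i # xs) \<subseteq> S"
      using xs S(2) by (auto simp: dlists_def)
    have s: "?s permutes S"
      by (rule permutes_compose[OF permutes_subset[OF t] permutes_subset[OF cycle_permutes sub]]) auto
    then show "(case a of (xs, t) \<Rightarrow> cycle_of_list (i # xs) \<circ> t) \<in> {s. s permutes S}"
      by (simp add: a)
    have "?R ?s = t"
    proof
      fix y
      show "?R ?s y = t y"
        unfolding sup
      proof (cases "y \<in> S - set (i # xs)")
        case True
        then have "t y \<in> S - set (i # xs)"
          using permutes_in_image[OF t, of y] by blast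
        then have "?s y = t y"
          unfolding o_def by (intro id_outside_supp) blast
        then show "(if y \<in> S - set (i # xs) then ?s y else y) = t y"
          using True by simp
      next
        case False
        then show "(if y \<in> S - set (i # xs) then ?s y else y) = t y"
          using t by (auto simp: permutes_def)
      qed
    qed
    then show "(tl (support (case a of (xs, t) \<Rightarrow> cycle_of_list (i # xs) \<circ> t) i),
        ?R (case a of (xs, t) \<Rightarrow> cycle_of_list (i # xs) \<circ> t)) = a"
      unfolding a prod.case sup by simp
  qed
  also have "\<dots> = (\<Sum>xs\<in>dlists (S - {i}).
     \<Sum>t | t permutes (S - set (i # xs)). f (cycle_of_list (i # xs) \<circ> t))"
    by (rule sum.Sigma[symmetric]) (use S in \<open>auto intro!: finite_dlists finite_permutations\<close>)
  finally show ?thesis .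
qed

section \<open>Assembling the term of a permutation from one cycle and the rest\<close>

lemma sign_shuffle:
  fixes z p :: "'a::ring_1"
  shows "(- 1) ^ u * (- 1) ^ w * (z * p) = ((- 1) ^ w * z) * ((- 1) ^ u * p)"
    and "(- 1) ^ u * (- 1) ^ w * (p * z) = ((- 1) ^ u * p) * ((- 1) ^ w * z)"
  by (cases "even u"; cases "even w"; simp)+

text \<open>One summand of the decomposition: \<open>s\<close> runs through \<open>c\<close>
  cyclically and acts as \<open>t\<close> on the rest \<open>T\<close>. The lemmas express every
  ingredient of the determinant term of \<open>s\<close> by \<open>c\<close> and
  \<open>t\<close>.\<close>

locale cycle_extension =
  fixes S :: "nat set" and i :: nat and xs :: "nat list" and t :: "nat \<Rightarrow> nat"
  assumes finite_S: "finite S" and i_in: "i \<in> S" and xs_in: "xs \<in> dlists (S - {i})"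
    and t_perm: "t permutes (S - set (i # xs))"
begin

abbreviation "c \<equiv> i # xs"
abbreviation "T \<equiv> S - set c"

definition s :: "nat \<Rightarrow> nat" where
  "s = cycle_of_list c \<circ> t"

lemma distinct_c: "distinct c" and set_c: "set c \<subseteq> S"
  using xs_in i_in by (auto simp: dlists_def)

lemma s_T: "x \<in> T \<Longrightarrow> s x = t x"
proof -
  assume "x \<in> T"
  then have "t x \<in> T" using permutes_in_image[OF t_perm, of x] by blast
  then show ?thesis unfolding s_def o_def by (intro id_outside_supp) blast
qed

lemma funpow_t_T: "x \<in> T \<Longrightarrow> (t ^^ k) x \<in> T"
  using permutes_in_image[OF permutes_funpow[OF t_perm], of k x] by blast

lemma funpow_s_T: "x \<in> T \<Longrightarrow> (s ^^ k) x = (t ^^ k) x"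
  by (induction k) (simp_all add: s_T[OF funpow_t_T])

lemma s_c: "x \<in> set c \<Longrightarrow> s x = cycle_of_list c x"
  using t_perm by (auto simp: s_def permutes_def)

lemma funpow_cyc_c: "x \<in> set c \<Longrightarrow> (cycle_of_list c ^^ k) x \<in> set c"
  using permutes_in_image[OF permutes_funpow[OF cycle_permutes], of k c x] by blast

lemma funpow_s_c: "x \<in> set c \<Longrightarrow> (s ^^ k) x = (cycle_of_list c ^^ k) x"
  by (induction k) (simp_all add: s_c[OF funpow_cyc_c] del: cycle_of_list.simps)

lemma funpow_s_nth: "l < length c \<Longrightarrow> (s ^^ k) (c ! l) = c ! ((k + l) mod length c)"
proof -
  assume l: "l < length c"
  have "(s ^^ k) (c ! l) = map (cycle_of_list c ^^ k) c ! l"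
    unfolding nth_map[OF l] using funpow_s_c[OF nth_mem[OF l]] by blast
  also have "\<dots> = c ! ((k + l) mod length c)"
    unfolding cyclic_rotation[OF distinct_c] using l by (simp add: nth_rotate add.commute)
  finally show ?thesis .
qed

lemma funpow_s_i: "(s ^^ k) i = c ! (k mod length c)"
  using funpow_s_nth[of 0 k] by simp

lemma funpow_s_i_eq: "(s ^^ k) i = i \<longleftrightarrow> length c dvd k"
proof -
  have "(s ^^ k) i = i \<longleftrightarrow> c ! (k mod length c) = c ! 0"
    by (simp add: funpow_s_i)
  also have "\<dots> \<longleftrightarrow> k mod length c = 0"
    by (rule nth_eq_iff_index_eq[OF distinct_c]) auto
  finally show ?thesis by (simp add: dvd_eq_mod_eq_0)
qed

lemma cyc_len_s_i: "cyc_len s i = length c"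
  unfolding cyc_len_def
  by (rule Least_equality) (auto simp: funpow_s_i_eq intro: dvd_imp_le simp del: list.size)

lemma support_s_i: "support s i = c"
proof -
  have "least_power s i = length c"
    using cyc_len_s_i unfolding cyc_len_def least_power_def by (simp add: conj_commute)
  then have "support s i = map (\<lambda>k. c ! (k mod length c)) [0..<length c]"
    by (simp add: funpow_s_i)
  also have "\<dots> = map ((!) c) [0..<length c]"
    by (rule map_cong) auto
  finally show ?thesis by (simp only: map_nth)
qed

lemma cyc_prod_s_T: "x \<in> T \<Longrightarrow> cyc_prod C s x = cyc_prod C t x"
  unfolding cyc_prod_def cyc_len_def by (simp only: funpow_s_T)

text \<open>A cycle with \<open>length xs + 1\<close> vertices has signature
  \<open>(- 1) ^ length xs\<close>, whereas \<open>spw\<close> carries one sign for each of its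
  \<open>length xs + 1\<close> edges; the difference is the leading minus.\<close>

lemma cyc_prod_s_i: "(- 1) ^ length xs * cyc_prod C s i = - spw C (i # xs @ [i])"
proof -
  have "spw C (c @ [i]) = prod_list (map (\<lambda>k. - C ((c @ [i]) ! k) ((c @ [i]) ! Suc k)) [0..<length c])"
    unfolding spw_eq_prod_list by simp
  also have "\<dots> = prod_list (map (\<lambda>k. - C ((s ^^ k) i) ((s ^^ Suc k) i)) [0..<length c])"
  proof (intro arg_cong[where f = prod_list] map_cong refl)
    fix k assume "k \<in> set [0..<length c]"
    then have k: "k < length c" by (simp only: set_upt atLeastLessThan_iff)
    have 1: "(c @ [i]) ! k = (s ^^ k) i"
      unfolding funpow_s_i nth_append using k by (simp only: mod_less if_True)
    have 2: "(c @ [i]) ! Suc k = (s ^^ Suc k) i"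
    proof (cases "Suc k < length c")
      case True
      then have "(c @ [i]) ! Suc k = c ! Suc k" by (simp only: nth_append if_True)
      then show ?thesis unfolding funpow_s_i using True by (simp only: mod_less)
    next
      case False
      \<comment> \<open>The closing edge: the index \<open>length c\<close> is reduced to 0, so the
        walk returns to \<open>i\<close>.\<close>
      then have *: "Suc k = length c" using k by simp
      then have "(c @ [i]) ! Suc k = i" by (metis nth_append_length)
      then show ?thesis unfolding funpow_s_i * by simp
    qed
    show "- C ((c @ [i]) ! k) ((c @ [i]) ! Suc k) = - C ((s ^^ k) i) ((s ^^ Suc k) i)"
      by (simp only: 1 2)
  qed
  also have "\<dots> = (- 1) ^ length c * cyc_prod C s i"
    unfolding prod_list_uminus cyc_prod_def cyc_len_s_i by simp
  finally show ?thesis by simp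
qed

lemma c_reaches:
  assumes "x \<in> set c" "y \<in> set c"
  shows "\<exists>k. (s ^^ k) x = y"
proof -
  obtain l m where l: "l < length c" "x = c ! l" and m: "m < length c" "y = c ! m"
    using assms by (metis in_set_conv_nth)
  have "(s ^^ (m + (length c - l))) x = c ! ((m + (length c - l) + l) mod length c)"
    unfolding l(2) by (rule funpow_s_nth[OF l(1)])
  also have "(m + (length c - l) + l) mod length c = m"
    using l(1) m(1) by (simp only: add.assoc le_add_diff_inverse2 less_imp_le mod_add_self2 mod_less)
  finally show ?thesis using m by blast
qed

lemma other_reps_s: "other_reps s S i = cyc_reps t T"
proof (intro set_eqI iffI)
  fix x assume x: "x \<in> other_reps s S i"
  then have "x \<notin> set c"
    using c_reaches[of x i] by (auto simp: other_reps_def)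
  then have xT: "x \<in> T" using x by (auto simp: other_reps_def cyc_reps_def)
  show "x \<in> cyc_reps t T"
    using x xT by (auto simp: other_reps_def cyc_reps_def funpow_s_T)
next
  fix x assume x: "x \<in> cyc_reps t T"
  then have xT: "x \<in> T" by (auto simp: cyc_reps_def)
  have "(s ^^ k) x \<noteq> i" for k
    using funpow_t_T[OF xT, of k] by (auto simp: funpow_s_T[OF xT])
  then show "x \<in> other_reps s S i"
    using x xT by (auto simp: other_reps_def cyc_reps_def funpow_s_T)
qed

text \<open>Every vertex of \<open>c\<close> reaches all of \<open>c\<close>, so only the minimum
  qualifies there; outside \<open>c\<close> the orbits of \<open>s\<close> and \<open>t\<close>
  agree.\<close>

lemma cyc_reps_s: "cyc_reps s S = insert (Min (set c)) (cyc_reps t T)"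
proof (intro set_eqI iffI)
  fix x assume x: "x \<in> cyc_reps s S"
  show "x \<in> insert (Min (set c)) (cyc_reps t T)"
  proof (cases "x \<in> set c")
    case True
    have "x = Min (set c)"
    proof (rule Min_eqI[symmetric])
      fix y assume "y \<in> set c"
      then show "x \<le> y" using c_reaches[OF True, of y] x by (auto simp: cyc_reps_def)
    qed (use True in auto)
    then show ?thesis by blast
  next
    case False
    then have "x \<in> T" using x by (auto simp: cyc_reps_def)
    then show ?thesis using x by (auto simp: cyc_reps_def funpow_s_T)
  qed
next
  fix x assume "x \<in> insert (Min (set c)) (cyc_reps t T)"
  then consider "x = Min (set c)" | "x \<in> cyc_reps t T" by blast
  then show "x \<in> cyc_reps s S"
  proof cases
    case 1
    then have xc: "x \<in> set c" using Min_in[of "set c"] by auto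
    have "x \<le> (s ^^ k) x" for k
      unfolding funpow_s_c[OF xc] using 1 funpow_cyc_c[OF xc, of k] by (metis List.finite_set Min_le)
    then show ?thesis using xc set_c by (auto simp: cyc_reps_def)
  next
    case 2
    then have "x \<in> other_reps s S i" by (simp add: other_reps_s)
    then show ?thesis by (simp add: other_reps_def)
  qed
qed

text \<open>The exponent counts vertices minus cycles, and \<open>c\<close> adds
  \<open>length xs + 1\<close> vertices and one cycle. The subtraction is on naturals, hence the
  bound of the number of representatives by \<open>card T\<close>.\<close>

lemma sign_s:
  "(- 1) ^ (card S - card (cyc_reps s S)) = (- 1) ^ (card T - card (cyc_reps t T)) * (- 1 :: quat) ^ length xs"
proof -
  have fin: "finite T" using finite_S by blast
  have sub: "cyc_reps t T \<subseteq> T" by (auto simp: cyc_reps_def)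
  have "Min (set c) \<in> set c" using Min_in[of "set c"] by auto
  then have "card (cyc_reps s S) = Suc (card (cyc_reps t T))"
    unfolding cyc_reps_s using finite_subset[OF sub fin] sub by (subst card_insert_disjoint) auto
  moreover have "card S = card T + length c"
    using card_Diff_subset[of "set c" S] card_mono[OF finite_S set_c] set_c distinct_card[OF distinct_c] by simp
  moreover have "card (cyc_reps t T) \<le> card T" by (rule card_mono[OF fin sub])
  ultimately have "card S - card (cyc_reps s S) = (card T - card (cyc_reps t T)) + length xs"
    by simp
  then show ?thesis by (simp add: power_add)
qed

lemma cyc_prods_s: "ks = sorted_list_of_set (cyc_reps t T) \<or> ks = rev (sorted_list_of_set (cyc_reps t T)) \<Longrightarrow>
    map (cyc_prod C s) ks = map (cyc_prod C t) ks"
  using finite_S by (intro map_cong refl cyc_prod_s_T) (auto simp: cyc_reps_def)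

lemma rdet_term:
  "(- 1) ^ (card S - card (cyc_reps s S)) *
     (cyc_prod C s i * prod_list (map (cyc_prod C s) (sorted_list_of_set (other_reps s S i))))
   = - spw C (i # xs @ [i]) * ((- 1) ^ (card T - card (cyc_reps t T)) *
       prod_list (map (cyc_prod C t) (sorted_list_of_set (cyc_reps t T))))"
  unfolding sign_s other_reps_s cyc_prods_s[OF disjI1[OF refl]] sign_shuffle(1) cyc_prod_s_i
  by (rule refl)

lemma cdet_term:
  "(- 1) ^ (card S - card (cyc_reps s S)) *
     (prod_list (map (cyc_prod C s) (rev (sorted_list_of_set (other_reps s S i)))) * cyc_prod C s i)
   = ((- 1) ^ (card T - card (cyc_reps t T)) *
       prod_list (map (cyc_prod C t) (rev (sorted_list_of_set (cyc_reps t T))))) * - spw C (i # xs @ [i])"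
  unfolding sign_s other_reps_s cyc_prods_s[OF disjI2[OF refl]] sign_shuffle(2) cyc_prod_s_i
  by (rule refl)

end

text \<open>The cycle through \<open>i\<close> is the leftmost factor of each term, so it can be
  pulled out of the sum over the permutations of the remaining vertices. In the column determinant
  it is the rightmost factor.\<close>

lemma rdet_on_cycle_sum:
  assumes S: "finite S" "i \<in> S"
  shows "rdet_on C S i = (\<Sum>xs\<in>dlists (S - {i}). - spw C (i # xs @ [i]) * psum C (S - set (i # xs)))"
proof -
  have ext: "support (cycle_of_list (i # xs) \<circ> t) i = i # xs"
    "(- 1) ^ (card S - card (cyc_reps (cycle_of_list (i # xs) \<circ> t) S)) *
       (cyc_prod C (cycle_of_list (i # xs) \<circ> t) i *
        prod_list (map (cyc_prod C (cycle_of_list (i # xs) \<circ> t))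
          (sorted_list_of_set (other_reps (cycle_of_list (i # xs) \<circ> t) S i)))) =
     - spw C (i # xs @ [i]) * ((- 1) ^ (card (S - set (i # xs)) - card (cyc_reps t (S - set (i # xs)))) *
       prod_list (map (cyc_prod C t) (sorted_list_of_set (cyc_reps t (S - set (i # xs))))))"
    if "xs \<in> dlists (S - {i})" "t permutes (S - set (i # xs))" for xs t
  proof -
    interpret cycle_extension S i xs t
      by (rule cycle_extension.intro[OF S that])
    show "support (cycle_of_list (i # xs) \<circ> t) i = i # xs"
      using support_s_i unfolding s_def .
    show "(- 1) ^ (card S - card (cyc_reps (cycle_of_list (i # xs) \<circ> t) S)) *
       (cyc_prod C (cycle_of_list (i # xs) \<circ> t) i *
        prod_list (map (cyc_prod C (cycle_of_list (i # xs) \<circ> t))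
          (sorted_list_of_set (other_reps (cycle_of_list (i # xs) \<circ> t) S i)))) =
     - spw C (i # xs @ [i]) * ((- 1) ^ (card (S - set (i # xs)) - card (cyc_reps t (S - set (i # xs)))) *
       prod_list (map (cyc_prod C t) (sorted_list_of_set (cyc_reps t (S - set (i # xs))))))"
      using rdet_term unfolding s_def .
  qed
  have "rdet_on C S i = (\<Sum>xs\<in>dlists (S - {i}). \<Sum>t | t permutes S - set (i # xs).
     - spw C (i # xs @ [i]) * ((- 1) ^ (card (S - set (i # xs)) - card (cyc_reps t (S - set (i # xs)))) *
       prod_list (map (cyc_prod C t) (sorted_list_of_set (cyc_reps t (S - set (i # xs)))))))"
    unfolding rdet_on_def
    by (subst sum_permutes_cycle[OF S], rule ext(1), assumption+, intro sum.cong refl, rule ext(2)) auto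
  then show ?thesis
    by (simp only: psum_def sum_distrib_left)
qed

lemma cdet_on_cycle_sum:
  assumes S: "finite S" "i \<in> S"
  shows "cdet_on C S i = (\<Sum>xs\<in>dlists (S - {i}). psum_rev C (S - set (i # xs)) * - spw C (i # xs @ [i]))"
proof -
  have ext: "support (cycle_of_list (i # xs) \<circ> t) i = i # xs"
    "(- 1) ^ (card S - card (cyc_reps (cycle_of_list (i # xs) \<circ> t) S)) *
       (prod_list (map (cyc_prod C (cycle_of_list (i # xs) \<circ> t))
          (rev (sorted_list_of_set (other_reps (cycle_of_list (i # xs) \<circ> t) S i)))) *
        cyc_prod C (cycle_of_list (i # xs) \<circ> t) i) =
     ((- 1) ^ (card (S - set (i # xs)) - card (cyc_reps t (S - set (i # xs)))) *
       prod_list (map (cyc_prod C t) (rev (sorted_list_of_set (cyc_reps t (S - set (i # xs))))))) *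
     - spw C (i # xs @ [i])"
    if "xs \<in> dlists (S - {i})" "t permutes (S - set (i # xs))" for xs t
  proof -
    interpret cycle_extension S i xs t
      by (rule cycle_extension.intro[OF S that])
    show "support (cycle_of_list (i # xs) \<circ> t) i = i # xs"
      using support_s_i unfolding s_def .
    show "(- 1) ^ (card S - card (cyc_reps (cycle_of_list (i # xs) \<circ> t) S)) *
       (prod_list (map (cyc_prod C (cycle_of_list (i # xs) \<circ> t))
          (rev (sorted_list_of_set (other_reps (cycle_of_list (i # xs) \<circ> t) S i)))) *
        cyc_prod C (cycle_of_list (i # xs) \<circ> t) i) =
     ((- 1) ^ (card (S - set (i # xs)) - card (cyc_reps t (S - set (i # xs)))) *
       prod_list (map (cyc_prod C t) (rev (sorted_list_of_set (cyc_reps t (S - set (i # xs))))))) *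
     - spw C (i # xs @ [i])"
      using cdet_term unfolding s_def .
  qed
  have "cdet_on C S i = (\<Sum>xs\<in>dlists (S - {i}). \<Sum>t | t permutes S - set (i # xs).
     ((- 1) ^ (card (S - set (i # xs)) - card (cyc_reps t (S - set (i # xs)))) *
       prod_list (map (cyc_prod C t) (rev (sorted_list_of_set (cyc_reps t (S - set (i # xs))))))) * - spw C (i # xs @ [i]))"
    unfolding cdet_on_def
    by (subst sum_permutes_cycle[OF S], rule ext(1), assumption+, intro sum.cong refl, rule ext(2)) auto
  then show ?thesis
    by (simp only: psum_rev_def sum_distrib_right)
qed

text \<open>The least vertex starts its own cycle and heads the list of representatives. Hence a
  remaining sum is again a determinant, at the index \<open>Min T\<close>, and can be expanded
  recursively.\<close>

lemma sorted_cyc_reps: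
  assumes "finite T" "T \<noteq> {}" and t: "t permutes T"
  shows "sorted_list_of_set (cyc_reps t T) = Min T # sorted_list_of_set (other_reps t T (Min T))"
proof -
  have pow: "(t ^^ k) x \<in> T" if "x \<in> T" for k x
    using permutes_in_image[OF permutes_funpow[OF t], of k x] that by blast
  have m: "Min T \<in> cyc_reps t T"
    using assms(1,2) pow by (auto simp: cyc_reps_def)
  have fin: "finite (cyc_reps t T)"
    using assms by (simp add: cyc_reps_def)
  have Min: "Min (cyc_reps t T) = Min T"
    by (rule Min_eqI[OF fin _ m]) (use assms in \<open>auto simp: cyc_reps_def\<close>)
  have "cyc_reps t T - {Min T} = other_reps t T (Min T)"
  proof (intro set_eqI iffI)
    fix x assume x: "x \<in> cyc_reps t T - {Min T}"
    then have "Min T < x"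
      using assms(1) by (auto simp: cyc_reps_def less_le)
    then have "(t ^^ k) x \<noteq> Min T" for k
      using x by (metis (no_types, lifting) DiffD1 cyc_reps_def leD mem_Collect_eq)
    then show "x \<in> other_reps t T (Min T)"
      using x by (auto simp: other_reps_def)
  next
    fix x assume "x \<in> other_reps t T (Min T)"
    then show "x \<in> cyc_reps t T - {Min T}"
      unfolding other_reps_def by (auto dest: spec[of _ 0])
  qed
  then show ?thesis
    using sorted_list_of_set_nonempty[OF fin] m Min by auto
qed

lemma psum_eq_rdet_on:
  assumes "finite T" "T \<noteq> {}"
  shows "psum C T = rdet_on C T (Min T)"
  unfolding psum_def rdet_on_def by (intro sum.cong refl) (simp add: sorted_cyc_reps[OF assms])

lemma psum_rev_eq_cdet_on:
  assumes "finite T" "T \<noteq> {}"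
  shows "psum_rev C T = cdet_on C T (Min T)"
  unfolding psum_rev_def cdet_on_def by (intro sum.cong refl) (simp add: sorted_cyc_reps[OF assms])

lemma psum_empty: "psum C {} = 1"
  by (simp add: psum_def cyc_reps_def permutes_empty)

lemma psum_rev_empty: "psum_rev C {} = 1"
  by (simp add: psum_rev_def cyc_reps_def permutes_empty)

section \<open>The determinant and the adjugate of a Hermitian matrix\<close>

text \<open>Taking the real part loses nothing for Hermitian matrices, as \<open>psum_real\<close>
  shows; it fixes the type before that is known.\<close>

definition mdet :: "qmat \<Rightarrow> nat set \<Rightarrow> real" where
  "mdet H T = qre (psum H T)"

text \<open>Signed paths from \<open>i\<close> to \<open>j\<close>, each times the minor of the
  vertices it misses. For commuting entries this is the path expansion of the classical
  adjugate.\<close>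

definition adjug :: "qmat \<Rightarrow> nat set \<Rightarrow> nat \<Rightarrow> nat \<Rightarrow> quat" where
  "adjug H S i j = (if i = j then of_real (mdet H (S - {i}))
     else (\<Sum>xs\<in>dlists (S - {i, j}). spw H (i # xs @ [j]) * of_real (mdet H (S - {i, j} - set xs))))"

lemma mdet_empty [simp]: "mdet H {} = 1"
  by (simp add: mdet_def psum_empty)

lemma cyc_prod_cong:
  assumes "t permutes T" "x \<in> T" and "\<And>x y. x \<in> T \<Longrightarrow> y \<in> T \<Longrightarrow> C x y = C' x y"
  shows "cyc_prod C t x = cyc_prod C' t x"
proof -
  have "(t ^^ k) x \<in> T" for k
    using permutes_in_image[OF permutes_funpow[OF assms(1)], of k x] assms(2) by blast
  then show ?thesis
    unfolding cyc_prod_def by (simp only: assms(3))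
qed

lemma psum_cong:
  assumes "\<And>x y. x \<in> T \<Longrightarrow> y \<in> T \<Longrightarrow> C x y = C' x y"
  shows "psum C T = psum C' T"
proof -
  have "map (cyc_prod C t) (sorted_list_of_set (cyc_reps t T)) = map (cyc_prod C' t) (sorted_list_of_set (cyc_reps t T))"
    if "t permutes T" for t
  proof (intro map_cong refl cyc_prod_cong[OF that _ assms])
    fix x assume "x \<in> set (sorted_list_of_set (cyc_reps t T))"
    then show "x \<in> T"
      by (cases "finite (cyc_reps t T)") (auto simp: cyc_reps_def)
  qed auto
  then show ?thesis
    unfolding psum_def by (intro sum.cong refl) (simp only: mem_Collect_eq)
qed

lemma psum_rev_cong:
  assumes "\<And>x y. x \<in> T \<Longrightarrow> y \<in> T \<Longrightarrow> C x y = C' x y"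
  shows "psum_rev C T = psum_rev C' T"
proof -
  have "map (cyc_prod C t) (rev (sorted_list_of_set (cyc_reps t T))) = map (cyc_prod C' t) (rev (sorted_list_of_set (cyc_reps t T)))"
    if "t permutes T" for t
  proof (intro map_cong refl cyc_prod_cong[OF that _ assms])
    fix x assume "x \<in> set (rev (sorted_list_of_set (cyc_reps t T)))"
    then show "x \<in> T"
      by (cases "finite (cyc_reps t T)") (auto simp: cyc_reps_def)
  qed auto
  then show ?thesis
    unfolding psum_rev_def by (intro sum.cong refl) (simp only: mem_Collect_eq)
qed

text \<open>Row \<open>l\<close> is read only on leaving \<open>l\<close>, so the last vertex
  \<open>z\<close> may be \<open>l\<close> itself. Dually, column \<open>i\<close> is read only on
  entering \<open>i\<close>, and the first vertex is free.\<close>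

lemma spw_row_repl: "l \<notin> set us \<Longrightarrow> spw (row_repl H l b) (us @ [z]) = spw H (us @ [z])"
proof (induction us)
  case (Cons x us)
  then show ?case by (cases us) (auto simp: row_repl_def)
qed simp

lemma spw_col_repl: "i \<notin> set us \<Longrightarrow> spw (col_repl H i b) (x # us) = spw H (x # us)"
  by (induction us arbitrary: x) (auto simp: col_repl_def)

section \<open>Reality of the determinant and independence of the starting index\<close>

locale hermitian =
  fixes H :: qmat
  assumes hermitian: "H j i = Defs.cnj (H i j)"
begin

text \<open>Conjugation reverses each cycle, reversal permutes the cycles through \<open>i\<close>,
  and the real cofactor sees only the set of vertices.\<close>

lemma cnj_cyc_sum:
  "Defs.cnj (\<Sum>xs\<in>dlists (S - {i}). - spw H (i # xs @ [i]) * of_real (mdet H (S - set (i # xs))))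
   = (\<Sum>xs\<in>dlists (S - {i}). - spw H (i # xs @ [i]) * of_real (mdet H (S - set (i # xs))))"
proof -
  let ?f = "\<lambda>xs. - spw H (i # xs @ [i]) * of_real (mdet H (S - set (i # xs)))"
  have "Defs.cnj (?f xs) = ?f (rev xs)" for xs
    by (simp add: cnj_spw[OF hermitian] of_real_quat_commute)
  then have "Defs.cnj (\<Sum>xs\<in>dlists (S - {i}). ?f xs) = (\<Sum>xs\<in>dlists (S - {i}). ?f (rev xs))"
    by (simp only: cnj_sum)
  also have "\<dots> = (\<Sum>xs\<in>dlists (S - {i}). ?f xs)"
    by (rule sum_dlists_rev)
  finally show ?thesis .
qed

text \<open>By induction on the number of vertices the cofactors of the cycles through the minimum
  are real, so the sum is fixed by conjugation.\<close>

lemma psum_real: "finite T \<Longrightarrow> psum H T = of_real (mdet H T)"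
proof (induction "card T" arbitrary: T rule: less_induct)
  case less
  show ?case
  proof (cases "T = {}")
    case False
    let ?m = "Min T"
    have m: "?m \<in> T" using less.prems False by simp
    have "psum H T = (\<Sum>xs\<in>dlists (T - {?m}). - spw H (?m # xs @ [?m]) * psum H (T - set (?m # xs)))"
      by (simp only: psum_eq_rdet_on[OF less.prems False] rdet_on_cycle_sum[OF less.prems m])
    also have "\<dots> = (\<Sum>xs\<in>dlists (T - {?m}). - spw H (?m # xs @ [?m]) * of_real (mdet H (T - set (?m # xs))))"
    proof (intro sum.cong refl)
      fix xs
      have "card (T - set (?m # xs)) < card T"
        using less.prems m by (intro psubset_card_mono) auto
      then show "- spw H (?m # xs @ [?m]) * psum H (T - set (?m # xs))
          = - spw H (?m # xs @ [?m]) * of_real (mdet H (T - set (?m # xs)))"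
        using less.hyps less.prems by (metis finite_Diff)
    qed
    finally have eq: "psum H T = \<dots>" .
    have "Defs.cnj (psum H T) = psum H T"
      unfolding eq by (rule cnj_cyc_sum)
    then show ?thesis
      unfolding mdet_def by (rule cnj_eq_self_imp_real)
  qed (simp add: psum_empty)
qed

text \<open>With real cofactors the order of cycle and cofactor is immaterial, so the column
  expansion at the minimum turns into the row expansion.\<close>

lemma psum_rev_real: "finite T \<Longrightarrow> psum_rev H T = of_real (mdet H T)"
proof (induction "card T" arbitrary: T rule: less_induct)
  case less
  show ?case
  proof (cases "T = {}")
    case False
    let ?m = "Min T"
    have m: "?m \<in> T" using less.prems False by simp
    have "psum_rev H T = (\<Sum>xs\<in>dlists (T - {?m}). psum_rev H (T - set (?m # xs)) * - spw H (?m # xs @ [?m]))"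
      by (simp only: psum_rev_eq_cdet_on[OF less.prems False] cdet_on_cycle_sum[OF less.prems m])
    also have "\<dots> = (\<Sum>xs\<in>dlists (T - {?m}). - spw H (?m # xs @ [?m]) * psum H (T - set (?m # xs)))"
    proof (intro sum.cong refl)
      fix xs
      have "card (T - set (?m # xs)) < card T"
        using less.prems m by (intro psubset_card_mono) auto
      then have "psum_rev H (T - set (?m # xs)) = of_real (mdet H (T - set (?m # xs)))"
        using less.hyps less.prems by (metis finite_Diff)
      then show "psum_rev H (T - set (?m # xs)) * - spw H (?m # xs @ [?m])
          = - spw H (?m # xs @ [?m]) * psum H (T - set (?m # xs))"
        using less.prems by (simp only: psum_real finite_Diff of_real_quat_commute)
    qed
    also have "\<dots> = psum H T"
      by (simp only: psum_eq_rdet_on[OF less.prems False] rdet_on_cycle_sum[OF less.prems m])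
    finally show ?thesis
      using psum_real less.prems by simp
  qed (simp add: psum_rev_empty)
qed

text \<open>Only the real part of a cycle weight is invariant under rotation of the cycle. It
  suffices, because the total is known to be real.\<close>

definition cycw :: "nat \<Rightarrow> nat list \<Rightarrow> real" where
  "cycw i xs = - qre (spw H (i # xs @ [i]))"

lemma cycw_rotate: "cycw i (u @ j # v) = cycw j (v @ i # u)"
proof -
  have "qre (spw H (i # u @ j # v @ [i])) = qre (spw H (i # u @ [j]) * spw H (j # v @ [i]))"
    using spw_append[of H "i # u" j "v @ [i]"] by simp
  also have "\<dots> = qre (spw H (j # v @ [i]) * spw H (i # u @ [j]))"
    by (rule qre_mult_commute)
  also have "\<dots> = qre (spw H (j # v @ i # u @ [j]))"
    using spw_append[of H "j # v" i "u @ [j]"] by simp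
  finally show ?thesis by (simp add: cycw_def)
qed

text \<open>To replace \<open>i\<close> by \<open>j\<close>, separate the cycles through
  \<open>i\<close> that contain \<open>j\<close> from the others. The former are rotated to start at
  \<open>j\<close>; for the latter the cofactor is expanded at \<open>j\<close> by induction, and
  the sum over two disjoint cycles is symmetric in \<open>i\<close> and \<open>j\<close>.\<close>

lemma mdet_cycle_sum_real:
  "finite S \<Longrightarrow> i \<in> S \<Longrightarrow> (\<Sum>xs\<in>dlists (S - {i}). cycw i xs * mdet H (S - set (i # xs))) = mdet H S"
proof (induction "card S" arbitrary: S i rule: less_induct)
  case less
  let ?F = "\<lambda>i. \<Sum>xs\<in>dlists (S - {i}). cycw i xs * mdet H (S - set (i # xs))"
  have swap: "?F i = ?F j" if i: "i \<in> S" and j: "j \<in> S" and ij: "i \<noteq> j" for i j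
  proof -
    define R where "R = S - {i, j}"
    have R: "finite R" "S - {i} - {j} = R" "S - {j} - {i} = R"
      using less.prems by (auto simp: R_def)
    \<comment> \<open>Stated for fresh \<open>i\<close> and \<open>j\<close>, so that the same
      expansion serves both ends of the comparison.\<close>
    have F: "?F i = (\<Sum>(u, v)\<in>dlist_pairs R. cycw i (u @ j # v) * mdet H (R - set u - set v))
       + (\<Sum>(u, v)\<in>dlist_pairs R. cycw i u * (cycw j v * mdet H (R - set u - set v)))"
      if i: "i \<in> S" and j: "j \<in> S" and ij: "i \<noteq> j" and R: "R = S - {i} - {j}" for i j R
    proof -
      have fin: "finite (S - {i})" "finite R" using less.prems R by auto
      have 1: "mdet H (S - set (i # u @ j # v)) = mdet H (R - set u - set v)" for u v
        by (rule arg_cong[where f = "mdet H"]) (auto simp: R)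
      have 2: "mdet H (S - set (i # u)) = (\<Sum>v\<in>dlists (R - set u). cycw j v * mdet H (R - set u - set v))"
        if "u \<in> dlists R" for u
      proof -
        have jin: "j \<in> S - set (i # u)" using j ij that R by (auto simp: dlists_def)
        have "card (S - set (i # u)) < card S"
          using less.prems i by (intro psubset_card_mono) auto
        then have "mdet H (S - set (i # u)) = (\<Sum>v\<in>dlists (S - set (i # u) - {j}).
            cycw j v * mdet H (S - set (i # u) - set (j # v)))"
          using less.hyps[OF _ _ jin] less.prems by simp
        moreover have "S - set (i # u) - {j} = R - set u"
          "\<And>v. S - set (i # u) - set (j # v) = R - set u - set v"
          by (auto simp: R)
        ultimately show ?thesis by (simp only:)
      qed
      have "?F i = (\<Sum>(u, v)\<in>dlist_pairs R. cycw i (u @ j # v) * mdet H (S - set (i # u @ j # v)))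
         + (\<Sum>xs\<in>dlists R. cycw i xs * mdet H (S - set (i # xs)))"
        using sum_dlists_split[OF fin(1), of j "\<lambda>xs. cycw i xs * mdet H (S - set (i # xs))"] j ij
        unfolding R[symmetric] by simp
      also have "(\<Sum>xs\<in>dlists R. cycw i xs * mdet H (S - set (i # xs)))
         = (\<Sum>u\<in>dlists R. \<Sum>v\<in>dlists (R - set u). cycw i u * (cycw j v * mdet H (R - set u - set v)))"
        by (intro sum.cong refl) (simp only: 2 sum_distrib_left)
      finally show ?thesis
        unfolding 1 sum_dlist_pairs[OF fin(2)] .
    qed
    have comm: "R - set u - set v = R - set v - set u" for u v by blast
    have "?F i = (\<Sum>(u, v)\<in>dlist_pairs R. cycw i (u @ j # v) * mdet H (R - set u - set v))
       + (\<Sum>(u, v)\<in>dlist_pairs R. cycw i u * (cycw j v * mdet H (R - set u - set v)))"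
      by (rule F[OF i j ij]) (simp add: R)
    \<comment> \<open>After exchanging the components, rotation turns \<open>v @ j # u\<close> seen
      from \<open>i\<close> into \<open>u @ i # v\<close> seen from \<open>j\<close>.\<close>
    also have "\<dots> = (\<Sum>(u, v)\<in>dlist_pairs R. cycw i (v @ j # u) * mdet H (R - set v - set u))
       + (\<Sum>(u, v)\<in>dlist_pairs R. cycw i v * (cycw j u * mdet H (R - set v - set u)))"
      by (subst (1 2) sum_dlist_pairs_swap) (rule refl)
    also have "\<dots> = (\<Sum>(u, v)\<in>dlist_pairs R. cycw j (u @ i # v) * mdet H (R - set u - set v))
       + (\<Sum>(u, v)\<in>dlist_pairs R. cycw j u * (cycw i v * mdet H (R - set u - set v)))"
      by (simp only: cycw_rotate[of i] comm mult.left_commute)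
    also have "\<dots> = ?F j"
      by (rule F[OF j i ij[symmetric], symmetric]) (simp add: R)
    finally show ?thesis .
  qed
  have ne: "S \<noteq> {}" using less.prems by auto
  have m: "Min S \<in> S" using less.prems ne by simp
  have "psum H S = (\<Sum>xs\<in>dlists (S - {Min S}). - spw H (Min S # xs @ [Min S]) * psum H (S - set (Min S # xs)))"
    by (simp only: psum_eq_rdet_on[OF less.prems(1) ne] rdet_on_cycle_sum[OF less.prems(1) m])
  then have "mdet H S = qre \<dots>"
    by (simp only: mdet_def)
  also have "\<dots> = ?F (Min S)"
    unfolding qre_sum using less.prems
    by (intro sum.cong refl)
       (simp add: psum_real cycw_def of_real_def del: set_simps)
  also have "\<dots> = ?F i"
    using swap[of "Min S" i] m less.prems by (cases "i = Min S") auto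
  finally show ?case by simp
qed

lemma mdet_cycle_sum:
  assumes S: "finite S" "i \<in> S"
  shows "(\<Sum>xs\<in>dlists (S - {i}). - spw H (i # xs @ [i]) * of_real (mdet H (S - set (i # xs)))) = of_real (mdet H S)"
    (is "?L = _")
proof -
  have "?L = of_real (qre ?L)"
    by (rule cnj_eq_self_imp_real[OF cnj_cyc_sum])
  also have "qre ?L = mdet H S"
    unfolding qre_sum mdet_cycle_sum_real[OF S, symmetric]
    by (intro sum.cong refl) (simp add: cycw_def of_real_def del: set_simps)
  finally show ?thesis .
qed

section \<open>The product of a Hermitian matrix with its adjugate\<close>

lemma cnj_adjug: "Defs.cnj (adjug H S i j) = adjug H S j i"
proof (cases "i = j")
  case False
  have "Defs.cnj (adjug H S i j) = (\<Sum>xs\<in>dlists (S - {i, j}). spw H (j # rev xs @ [i]) * of_real (mdet H (S - {i, j} - set (rev xs))))"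
    using False by (simp add: adjug_def cnj_sum cnj_spw[OF hermitian] of_real_quat_commute)
  also have "\<dots> = (\<Sum>xs\<in>dlists (S - {i, j}). spw H (j # xs @ [i]) * of_real (mdet H (S - {i, j} - set xs)))"
    by (rule sum_dlists_rev)
  finally show ?thesis
    using False by (simp add: adjug_def insert_commute)
qed (simp add: adjug_def)

text \<open>The adjugate entries are grouped by the first vertex of the path. The coefficients
  \<open>b\<close> are arbitrary because the formula is needed both for a row of \<open>H\<close>
  and for a replacement row.\<close>

lemma sum_mult_adjug:
  assumes S: "finite S" "j \<in> S"
  shows "(\<Sum>l\<in>S. b l * adjug H S l j) = b j * of_real (mdet H (S - {j}))
     + (\<Sum>l\<in>S - {j}. \<Sum>ys\<in>dlists (S - {j} - {l}). b l * (spw H (l # ys @ [j]) * of_real (mdet H (S - {j} - set (l # ys)))))"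
proof -
  have "(\<Sum>l\<in>S. b l * adjug H S l j) = b j * adjug H S j j + (\<Sum>l\<in>S - {j}. b l * adjug H S l j)"
    by (rule sum.remove[OF S])
  also have "(\<Sum>l\<in>S - {j}. b l * adjug H S l j) = (\<Sum>l\<in>S - {j}. \<Sum>ys\<in>dlists (S - {j} - {l}). b l * (spw H (l # ys @ [j]) * of_real (mdet H (S - {j} - set (l # ys)))))"
  proof (intro sum.cong refl)
    fix l assume l: "l \<in> S - {j}"
    have "S - {l, j} = S - {j} - {l}" "\<And>ys. S - {j} - set (l # ys) = S - {l, j} - set ys" by auto
    then show "b l * adjug H S l j = (\<Sum>ys\<in>dlists (S - {j} - {l}). b l * (spw H (l # ys @ [j]) * of_real (mdet H (S - {j} - set (l # ys)))))"
      using l by (simp add: adjug_def sum_distrib_left)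
  qed
  finally show ?thesis by (simp add: adjug_def)
qed

text \<open>The factor \<open>H i l\<close> prepends an edge, whose sign gives the minus. The start
  \<open>i\<close> is left free: for \<open>i = j\<close> the walks are cycles, for \<open>i\<close>
  outside \<open>S\<close> they are paths in a larger set, and for other \<open>i\<close> in
  \<open>S\<close> they may return to \<open>i\<close>.\<close>

lemma hermitian_mult_adjug:
  assumes S: "finite S" "j \<in> S"
  shows "(\<Sum>l\<in>S. H i l * adjug H S l j)
     = - (\<Sum>xs\<in>dlists (S - {j}). spw H (i # xs @ [j]) * of_real (mdet H (S - {j} - set xs)))"
  unfolding sum_mult_adjug[OF S]
  by (subst sum_dlists_Cons) (simp_all add: S sum_negf mult.assoc)

lemma hermitian_mult_adjug_diag:
  assumes S: "finite S" "i \<in> S"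
  shows "(\<Sum>l\<in>S. H i l * adjug H S l i) = of_real (mdet H S)"
proof -
  have "S - set (i # xs) = S - {i} - set xs" for xs by auto
  then show ?thesis
    unfolding hermitian_mult_adjug[OF S] mdet_cycle_sum[OF S, symmetric]
    by (simp only: mult_minus_left sum_negf)
qed

lemma hermitian_mult_adjug_outside:
  assumes S: "finite S" "j \<in> S" and i: "i \<notin> S"
  shows "(\<Sum>l\<in>S. H i l * adjug H S l j) = - adjug H (insert i S) i j"
proof -
  have "insert i S - {i, j} = S - {j}" "i \<noteq> j" using S i by auto
  then show ?thesis
    unfolding hermitian_mult_adjug[OF S] by (simp add: adjug_def)
qed

text \<open>A walk that returns to \<open>i\<close> is a cycle at \<open>i\<close> followed by a
  path from \<open>i\<close> to \<open>j\<close>. Summing over the cycles with the path fixed yields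
  minus the minor of the vertices off that path, which cancels the walks that do not return.\<close>

lemma hermitian_mult_adjug_offdiag:
  assumes S: "finite S" "j \<in> S" "i \<in> S" and ij: "i \<noteq> j"
  shows "(\<Sum>l\<in>S. H i l * adjug H S l j) = 0"
proof -
  define T where "T = S - {j} - {i}"
  have fin: "finite (S - {j})" "finite T" using S by (auto simp: T_def)
  have det: "(\<Sum>u\<in>dlists (T - set v). - spw H (i # u @ [i]) * of_real (mdet H (T - set v - set u))) = of_real (mdet H (S - {j} - set v))"
    if "v \<in> dlists T" for v
  proof -
    have "finite (S - {j} - set v)" "i \<in> S - {j} - set v"
      using that S ij by (auto simp: dlists_def T_def)
    note mdet_cycle_sum[OF this]
    moreover have "S - {j} - set v - {i} = T - set v" "\<And>u. S - {j} - set v - set (i # u) = T - set v - set u"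
      by (auto simp: T_def)
    ultimately show ?thesis by simp
  qed
  have "(\<Sum>(u, v)\<in>dlist_pairs T. spw H (i # (u @ i # v) @ [j]) * of_real (mdet H (S - {j} - set (u @ i # v))))
     = (\<Sum>(u, v)\<in>dlist_pairs T. spw H (i # u @ [i]) * spw H (i # v @ [j]) * of_real (mdet H (T - set v - set u)))"
  proof (intro sum.cong refl, clarify)
    fix u v
    have "S - {j} - set (u @ i # v) = T - set v - set u" by (auto simp: T_def)
    then show "spw H (i # (u @ i # v) @ [j]) * of_real (mdet H (S - {j} - set (u @ i # v)))
        = spw H (i # u @ [i]) * spw H (i # v @ [j]) * of_real (mdet H (T - set v - set u))"
      using spw_append[of H "i # u" i "v @ [j]"] by simp
  qed
  also have "\<dots> = (\<Sum>(v, u)\<in>dlist_pairs T. spw H (i # u @ [i]) * spw H (i # v @ [j]) * of_real (mdet H (T - set v - set u)))"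
    by (rule sum_dlist_pairs_swap)
  also have "\<dots> = (\<Sum>v\<in>dlists T. \<Sum>u\<in>dlists (T - set v). spw H (i # u @ [i]) * spw H (i # v @ [j]) * of_real (mdet H (T - set v - set u)))"
    by (rule sum_dlist_pairs[OF fin(2), symmetric])
  also have "\<dots> = (\<Sum>v\<in>dlists T. - spw H (i # v @ [j]) * of_real (mdet H (S - {j} - set v)))"
  proof (intro sum.cong refl)
    fix v assume v: "v \<in> dlists T"
    have "(\<Sum>u\<in>dlists (T - set v). spw H (i # u @ [i]) * spw H (i # v @ [j]) * of_real (mdet H (T - set v - set u)))
        = - (\<Sum>u\<in>dlists (T - set v). - spw H (i # u @ [i]) * of_real (mdet H (T - set v - set u))) * spw H (i # v @ [j])"
      unfolding sum_distrib_right sum_negf[symmetric]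
      by (intro sum.cong refl) (simp add: mult.assoc of_real_quat_commute)
    then show "(\<Sum>u\<in>dlists (T - set v). spw H (i # u @ [i]) * spw H (i # v @ [j]) * of_real (mdet H (T - set v - set u)))
        = - spw H (i # v @ [j]) * of_real (mdet H (S - {j} - set v))"
      unfolding det[OF v] by (simp add: of_real_quat_commute)
  qed
  finally have "(\<Sum>xs\<in>dlists (S - {j}). spw H (i # xs @ [j]) * of_real (mdet H (S - {j} - set xs))) = 0"
    using sum_dlists_split[OF fin(1), of i "\<lambda>xs. spw H (i # xs @ [j]) * of_real (mdet H (S - {j} - set xs))"] S ij
    unfolding T_def by (simp add: sum_negf)
  then show ?thesis
    unfolding hermitian_mult_adjug[OF S(1,2)] by simp
qed

text \<open>The new row is read only on the first edge of the cycle through \<open>l\<close>; what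
  follows is a path of \<open>H\<close> back to \<open>l\<close>, so the rest is an adjugate entry.
  The sign of the edge cancels the sign of the cycle.\<close>

lemma rdet_on_row_repl:
  assumes S: "finite S" "l \<in> S"
  shows "rdet_on (row_repl H l b) S l = (\<Sum>k\<in>S. b k * adjug H S k l)"
proof -
  let ?C = "row_repl H l b"
  have ps: "psum ?C (S - set (l # xs)) = of_real (mdet H (S - {l} - set xs))" for xs
  proof -
    have "psum ?C (S - {l} - set xs) = psum H (S - {l} - set xs)"
      by (rule psum_cong) (auto simp: row_repl_def)
    moreover have "S - set (l # xs) = S - {l} - set xs" by auto
    ultimately show ?thesis using S by (simp only: psum_real finite_Diff)
  qed
  have 1: "spw ?C (l # xs @ [l]) = - b l" if "xs = []" for xs
    using that by (simp add: row_repl_def)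
  have 2: "spw ?C (l # (k # ys) @ [l]) = - (b k * spw H (k # ys @ [l]))" if "ys \<in> dlists (S - {l} - {k})" "k \<in> S - {l}" for k ys
    using that spw_row_repl[of l "k # ys" H b l] by (auto simp: dlists_def) (auto simp: row_repl_def)
  have "rdet_on ?C S l = (\<Sum>xs\<in>dlists (S - {l}). - spw ?C (l # xs @ [l]) * of_real (mdet H (S - {l} - set xs)))"
    by (simp only: rdet_on_cycle_sum[OF S] ps)
  also have "\<dots> = (\<Sum>k\<in>S. b k * adjug H S k l)"
    unfolding sum_mult_adjug[OF S] using S
    by (subst sum_dlists_Cons) (auto simp: 1 2 mult.assoc simp del: spw.simps append.simps intro!: sum.cong)
  finally show ?thesis .
qed

text \<open>Here the new column is read only on the last edge, which enters \<open>i\<close>, so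
  paths are grouped by their last vertex.\<close>

lemma cdet_on_col_repl:
  assumes S: "finite S" "i \<in> S"
  shows "cdet_on (col_repl H i b) S i = (\<Sum>k\<in>S. adjug H S i k * b k)"
proof -
  let ?C = "col_repl H i b"
  have ps: "psum_rev ?C (S - set (i # xs)) = of_real (mdet H (S - {i} - set xs))" for xs
  proof -
    have "psum_rev ?C (S - {i} - set xs) = psum_rev H (S - {i} - set xs)"
      by (rule psum_rev_cong) (auto simp: col_repl_def)
    moreover have "S - set (i # xs) = S - {i} - set xs" by auto
    ultimately show ?thesis using S by (simp only: psum_rev_real finite_Diff)
  qed
  have 1: "spw ?C (i # xs @ [i]) = - b i" if "xs = []" for xs
    using that by (simp add: col_repl_def)
  have 2: "spw ?C (i # (ys @ [k]) @ [i]) = - (spw H (i # ys @ [k]) * b k)" if "ys \<in> dlists (S - {i} - {k})" "k \<in> S - {i}" for k ys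
  proof -
    have "spw ?C (i # (ys @ [k]) @ [i]) = spw ?C (i # ys @ [k]) * spw ?C [k, i]"
      using spw_append[of ?C "i # ys" k "[i]"] by simp
    also have "spw ?C (i # ys @ [k]) = spw H (i # ys @ [k])"
      by (rule spw_col_repl) (use that in \<open>auto simp: dlists_def\<close>)
    finally show ?thesis by (simp add: col_repl_def)
  qed
  have 3: "(\<Sum>k\<in>S. adjug H S i k * b k) = of_real (mdet H (S - {i})) * b i
     + (\<Sum>l\<in>S - {i}. \<Sum>ys\<in>dlists (S - {i} - {l}). of_real (mdet H (S - {i} - set (ys @ [l]))) * (spw H (i # ys @ [l]) * b l))"
  proof -
    have "(\<Sum>k\<in>S. adjug H S i k * b k) = adjug H S i i * b i + (\<Sum>k\<in>S - {i}. adjug H S i k * b k)"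
      by (rule sum.remove[OF S])
    also have "(\<Sum>k\<in>S - {i}. adjug H S i k * b k) = (\<Sum>l\<in>S - {i}. \<Sum>ys\<in>dlists (S - {i} - {l}). of_real (mdet H (S - {i} - set (ys @ [l]))) * (spw H (i # ys @ [l]) * b l))"
    proof (intro sum.cong refl)
      fix l assume l: "l \<in> S - {i}"
      have "S - {i, l} = S - {i} - {l}" "\<And>ys. S - {i} - set (ys @ [l]) = S - {i, l} - set ys" by auto
      then show "adjug H S i l * b l = (\<Sum>ys\<in>dlists (S - {i} - {l}). of_real (mdet H (S - {i} - set (ys @ [l]))) * (spw H (i # ys @ [l]) * b l))"
        using l by (simp add: adjug_def sum_distrib_right of_real_quat_commute mult.assoc)
    qed
    finally show ?thesis by (simp add: adjug_def)
  qed
  have "cdet_on ?C S i = (\<Sum>xs\<in>dlists (S - {i}). of_real (mdet H (S - {i} - set xs)) * - spw ?C (i # xs @ [i]))"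
    by (simp only: cdet_on_cycle_sum[OF S] ps)
  also have "\<dots> = (\<Sum>k\<in>S. adjug H S i k * b k)"
    unfolding 3 using S
    by (subst sum_dlists_snoc) (auto simp: 1 2 simp del: spw.simps append.simps append_assoc intro!: sum.cong)
  finally show ?thesis .
qed

lemma hdet_eq_mdet: "finite S \<Longrightarrow> S \<noteq> {} \<Longrightarrow> hdet H S = mdet H S"
  by (simp add: hdet_def mdet_def psum_eq_rdet_on)

end

section \<open>Sums of principal minors and adjugates\<close>

definition detsum :: "qmat \<Rightarrow> nat \<Rightarrow> nat \<Rightarrow> real" where
  "detsum H n k = (\<Sum>b\<in>idx_sets n k. mdet H b)"

text \<open>Each principal adjugate is extended by zero outside its index set. For commuting entries
  \<open>detsum\<close> is, up to sign, a coefficient of the characteristic polynomial, and these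
  are the matrices of the Faddeev-LeVerrier scheme.\<close>

definition adjsum :: "qmat \<Rightarrow> nat \<Rightarrow> nat \<Rightarrow> qmat" where
  "adjsum H n k i j = (\<Sum>b\<in>{b \<in> idx_sets n k. i \<in> b \<and> j \<in> b}. adjug H b i j)"

lemma finite_idx_sets: "finite (idx_sets n k)"
  unfolding idx_sets_def by (rule finite_subset[of _ "Pow {..<n}"]) auto

lemma idx_setsD: "b \<in> idx_sets n k \<Longrightarrow> finite b" "b \<in> idx_sets n k \<Longrightarrow> b \<subseteq> {..<n}"
  "b \<in> idx_sets n k \<Longrightarrow> card b = k"
  unfolding idx_sets_def by (auto intro: finite_subset)

lemma idx_sets_0: "idx_sets n 0 = {{}}"
  unfolding idx_sets_def by (auto simp: card_eq_0_iff dest: finite_subset[OF _ finite_lessThan])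

lemma idx_sets_full: "idx_sets n n = {{..<n}}"
  unfolding idx_sets_def using card_subset_eq[of "{..<n}"] by auto

lemma idx_sets_large: "n < k \<Longrightarrow> idx_sets n k = {}"
proof -
  assume "n < k"
  then have "card b \<noteq> k" if "b \<subseteq> {..<n}" for b
    using card_mono[OF finite_lessThan that] by simp
  then show ?thesis by (auto simp: idx_sets_def)
qed

lemma sum_idx_sets_insert:
  assumes i: "i < n"
  shows "(\<Sum>b\<in>{b \<in> idx_sets n (Suc k). i \<in> b \<and> P b}. f b)
    = (\<Sum>b\<in>{b \<in> idx_sets n k. i \<notin> b \<and> P (insert i b)}. f (insert i b))"
proof (rule sum.reindex_bij_witness[where i = "insert i" and j = "\<lambda>b. b - {i}"])
  fix b assume b: "b \<in> {b \<in> idx_sets n (Suc k). i \<in> b \<and> P b}"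
  then show "insert i (b - {i}) = b" "f (insert i (b - {i})) = f b"
    by (auto simp: insert_absorb)
  show "b - {i} \<in> {b \<in> idx_sets n k. i \<notin> b \<and> P (insert i b)}"
    using b idx_setsD(1)[of b n "Suc k"] by (auto simp: idx_sets_def insert_absorb)
next
  fix b assume b: "b \<in> {b \<in> idx_sets n k. i \<notin> b \<and> P (insert i b)}"
  then show "insert i b - {i} = b" by auto
  show "insert i b \<in> {b \<in> idx_sets n (Suc k). i \<in> b \<and> P b}"
    using b i idx_setsD(1)[of b n k] by (auto simp: idx_sets_def)
qed

context hermitian
begin

lemma hermitian_mult_adjug_eq:
  assumes "finite S" "i \<in> S" "j \<in> S"
  shows "(\<Sum>l\<in>S. H i l * adjug H S l j) = (if i = j then of_real (mdet H S) else 0)"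
  using assms hermitian_mult_adjug_diag hermitian_mult_adjug_offdiag by auto

lemma adjug_mult_hermitian_eq:
  assumes "finite S" "i \<in> S" "j \<in> S"
  shows "(\<Sum>l\<in>S. adjug H S i l * H l j) = (if i = j then of_real (mdet H S) else 0)"
proof -
  have "(\<Sum>l\<in>S. adjug H S i l * H l j) = Defs.cnj (\<Sum>l\<in>S. H j l * adjug H S l i)"
    unfolding cnj_sum cnj_mult cnj_adjug by (intro sum.cong refl) (simp add: hermitian[symmetric])
  then show ?thesis
    using hermitian_mult_adjug_eq[OF assms(1,3,2)] by auto
qed

lemma cnj_adjsum: "Defs.cnj (adjsum H n k i j) = adjsum H n k j i"
  unfolding adjsum_def cnj_sum by (rule sum.cong) (auto simp: cnj_adjug)

text \<open>Sort the index sets containing \<open>j\<close> by whether they contain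
  \<open>i\<close>. With \<open>i\<close> inside, the adjugate identity gives a minor or 0. With
  \<open>i\<close> outside, the product is minus an adjugate entry of the set enlarged by
  \<open>i\<close>, which cancels against order \<open>Suc k\<close>. On the diagonal, order
  \<open>Suc k\<close> supplies the minors of the sets without \<open>i\<close>.\<close>

lemma hermitian_mult_adjsum:
  assumes i: "i < n" and j: "j < n"
  shows "(\<Sum>l<n. H i l * adjsum H n k l j) + adjsum H n (Suc k) i j
     = (if i = j then of_real (detsum H n k) else 0)"
proof -
  let ?I = "idx_sets n k"
  define g where "g b = (\<Sum>l\<in>b. H i l * adjug H b l j)" for b
  have "(\<Sum>l<n. H i l * adjsum H n k l j)
      = (\<Sum>l<n. \<Sum>b\<in>?I. if l \<in> b \<and> j \<in> b then H i l * adjug H b l j else 0)"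
    unfolding adjsum_def sum_distrib_left
    by (intro sum.cong[OF refl] sum.inter_filter finite_idx_sets)
  also have "\<dots> = (\<Sum>b\<in>?I. \<Sum>l<n. if l \<in> b \<and> j \<in> b then H i l * adjug H b l j else 0)"
    by (rule sum.swap)
  also have "\<dots> = (\<Sum>b\<in>?I. if j \<in> b then g b else 0)"
  proof (intro sum.cong refl)
    fix b assume b: "b \<in> ?I"
    then have "{l \<in> {..<n}. l \<in> b} = b" using idx_setsD(2) by blast
    then show "(\<Sum>l<n. if l \<in> b \<and> j \<in> b then H i l * adjug H b l j else 0) = (if j \<in> b then g b else 0)"
      unfolding g_def using sum.inter_filter[of "{..<n}" "\<lambda>l. H i l * adjug H b l j" "\<lambda>l. l \<in> b"] by auto
  qed
  also have "\<dots> = (\<Sum>b\<in>{b \<in> ?I. j \<in> b}. g b)"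
    by (rule sum.inter_filter[symmetric]) (rule finite_idx_sets)
  also have "{b \<in> ?I. j \<in> b} = {b \<in> ?I. j \<in> b \<and> i \<in> b} \<union> {b \<in> ?I. i \<notin> b \<and> j \<in> b}"
    by auto
  also have "(\<Sum>b\<in>\<dots>. g b) = (\<Sum>b\<in>{b \<in> ?I. j \<in> b \<and> i \<in> b}. g b) + (\<Sum>b\<in>{b \<in> ?I. i \<notin> b \<and> j \<in> b}. g b)"
    by (rule sum.union_disjoint) (auto simp: finite_idx_sets)
  also have "(\<Sum>b\<in>{b \<in> ?I. j \<in> b \<and> i \<in> b}. g b) = (\<Sum>b\<in>{b \<in> ?I. j \<in> b \<and> i \<in> b}. if i = j then of_real (mdet H b) else 0)"
    unfolding g_def by (rule sum.cong[OF refl], rule hermitian_mult_adjug_eq) (auto dest: idx_setsD)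
  finally have L: "(\<Sum>l<n. H i l * adjsum H n k l j) =
      (\<Sum>b\<in>{b \<in> ?I. j \<in> b \<and> i \<in> b}. if i = j then of_real (mdet H b) else 0) + (\<Sum>b\<in>{b \<in> ?I. i \<notin> b \<and> j \<in> b}. g b)" .
  have R: "adjsum H n (Suc k) i j = (\<Sum>b\<in>{b \<in> ?I. i \<notin> b \<and> j \<in> insert i b}. adjug H (insert i b) i j)"
    unfolding adjsum_def by (rule sum_idx_sets_insert[OF i])
  show ?thesis
  proof (cases "i = j")
    case True
    have "{b \<in> ?I. i \<notin> b \<and> j \<in> b} = {}" using True by auto
    moreover have "adjsum H n (Suc k) i j = (\<Sum>b\<in>{b \<in> ?I. i \<notin> b}. of_real (mdet H b))"
      unfolding R using True by (intro sum.cong) (auto simp: adjug_def)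
    moreover have "(\<Sum>b\<in>{b \<in> ?I. i \<in> b}. of_real (mdet H b)) + (\<Sum>b\<in>{b \<in> ?I. i \<notin> b}. of_real (mdet H b)) = (\<Sum>b\<in>?I. of_real (mdet H b) :: quat)"
      by (subst sum.union_disjoint[symmetric]) (auto simp: finite_idx_sets intro: sum.cong)
    ultimately show ?thesis
      unfolding L detsum_def using True by (simp only: sum.empty add_0_right conj_absorb simp_thms if_True of_real_sum)
  next
    case False
    have "(\<Sum>b\<in>{b \<in> ?I. i \<notin> b \<and> j \<in> b}. g b) = (\<Sum>b\<in>{b \<in> ?I. i \<notin> b \<and> j \<in> b}. - adjug H (insert i b) i j)"
      unfolding g_def by (rule sum.cong[OF refl], rule hermitian_mult_adjug_outside) (auto dest: idx_setsD)
    moreover have "adjsum H n (Suc k) i j = (\<Sum>b\<in>{b \<in> ?I. i \<notin> b \<and> j \<in> b}. adjug H (insert i b) i j)"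
      unfolding R using False by (intro sum.cong) auto
    ultimately show ?thesis
      unfolding L using False by (simp add: sum_negf)
  qed
qed

text \<open>Induction on the index set: the form evaluated at one suitable vector is the product of
  the new minor and the previous one.\<close>

lemma mdet_pos:
  assumes "finite b" and "\<And>x. (\<exists>i\<in>b. x i \<noteq> 0) \<Longrightarrow> 0 < qre (\<Sum>i\<in>b. \<Sum>j\<in>b. Defs.cnj (x i) * H i j * x j)"
  shows "0 < mdet H b"
  using assms
proof (induction b rule: finite_induct)
  case (insert i b)
  let ?S = "insert i b"
  have S: "finite ?S" "?S - {i} = b" using insert by auto
  have pos: "0 < mdet H b"
  proof (rule insert.IH)
    fix x :: "nat \<Rightarrow> quat" assume x: "\<exists>i\<in>b. x i \<noteq> 0"
    let ?y = "x(i := 0)"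
    have "0 < qre (\<Sum>k\<in>?S. \<Sum>j\<in>?S. Defs.cnj (?y k) * H k j * ?y j)"
      by (rule insert.prems) (use x insert.hyps in auto)
    also have "(\<Sum>k\<in>?S. \<Sum>j\<in>?S. Defs.cnj (?y k) * H k j * ?y j) = (\<Sum>k\<in>b. \<Sum>j\<in>b. Defs.cnj (x k) * H k j * x j)"
      using insert.hyps by simp (intro sum.cong refl; auto)
    finally show "0 < qre (\<Sum>i\<in>b. \<Sum>j\<in>b. Defs.cnj (x i) * H i j * x j)" .
  qed
  \<comment> \<open>A column of the adjugate: \<open>H\<close> maps it to a multiple of the unit
    vector at \<open>i\<close> with factor \<open>mdet H ?S\<close>, and its own entry at
    \<open>i\<close> is \<open>mdet H b\<close>.\<close>
  define x where "x l = adjug H ?S l i" for l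
  have xi: "x i = of_real (mdet H b)" using S by (simp add: x_def adjug_def)
  then have "\<exists>k\<in>?S. x k \<noteq> 0" using pos by auto
  then have "0 < qre (\<Sum>k\<in>?S. \<Sum>j\<in>?S. Defs.cnj (x k) * H k j * x j)"
    by (rule insert.prems)
  also have "(\<Sum>k\<in>?S. \<Sum>j\<in>?S. Defs.cnj (x k) * H k j * x j) = (\<Sum>k\<in>?S. Defs.cnj (x k) * (if k = i then of_real (mdet H ?S) else 0))"
  proof (intro sum.cong refl)
    fix k assume k: "k \<in> ?S"
    have "(\<Sum>j\<in>?S. Defs.cnj (x k) * H k j * x j) = Defs.cnj (x k) * (\<Sum>j\<in>?S. H k j * adjug H ?S j i)"
      unfolding sum_distrib_left x_def by (simp only: mult.assoc)
    then show "(\<Sum>j\<in>?S. Defs.cnj (x k) * H k j * x j) = Defs.cnj (x k) * (if k = i then of_real (mdet H ?S) else 0)"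
      using hermitian_mult_adjug_eq[OF S(1) k, of i] by simp
  qed
  also have "\<dots> = (\<Sum>k\<in>?S. if k = i then of_real (mdet H b * mdet H ?S) else 0)"
    by (intro sum.cong refl) (simp add: xi)
  also have "\<dots> = of_real (mdet H b * mdet H ?S)"
    using S(1) by (subst sum.delta) auto
  finally show ?case
    using pos by (simp only: qre_of_real zero_less_mult_pos)
qed simp

text \<open>Multiplying the null vector equation by the adjugate from the left leaves the minor
  times \<open>x i\<close>.\<close>

lemma mdet_eq_0:
  assumes b: "finite b" "i \<in> b" "x i \<noteq> 0" and 0: "\<And>a. a \<in> b \<Longrightarrow> (\<Sum>l\<in>b. H a l * x l) = 0"
  shows "mdet H b = 0"
proof -
  have "of_real (mdet H b) * x i = (\<Sum>a\<in>b. (if i = a then of_real (mdet H b) else 0) * x a)"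
    using b by (simp add: if_distrib[where f = "\<lambda>c. c * _"] cong: if_cong)
  also have "\<dots> = (\<Sum>a\<in>b. (\<Sum>l\<in>b. adjug H b i l * H l a) * x a)"
    using adjug_mult_hermitian_eq[OF b(1,2)] by (intro sum.cong refl) simp
  also have "\<dots> = (\<Sum>a\<in>b. \<Sum>l\<in>b. adjug H b i l * (H l a * x a))"
    by (simp only: sum_distrib_right mult.assoc)
  also have "\<dots> = (\<Sum>l\<in>b. adjug H b i l * (\<Sum>a\<in>b. H l a * x a))"
    by (subst sum.swap) (simp only: sum_distrib_left)
  also have "\<dots> = 0"
    using 0 by simp
  finally show ?thesis
    using b(3) by simp
qed

lemma detsum_0: "detsum H n 0 = 1"
  by (simp add: detsum_def idx_sets_0)

lemma adjsum_0: "adjsum H n 0 i j = 0"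
  unfolding adjsum_def idx_sets_0 by (rule sum.neutral) auto

lemma adjsum_large: "n < k \<Longrightarrow> adjsum H n k i j = 0"
  by (simp add: adjsum_def idx_sets_large)

section \<open>Sums of determinants with a replaced row or column\<close>

lemma sum_rdet_on_row_repl:
  assumes "l < n"
  shows "(\<Sum>a\<in>{a \<in> idx_sets n k. l \<in> a}. rdet_on (row_repl H l b) a l) = (\<Sum>c<n. b c * adjsum H n k c l)"
proof -
  have "(\<Sum>a\<in>{a \<in> idx_sets n k. l \<in> a}. rdet_on (row_repl H l b) a l)
      = (\<Sum>a\<in>{a \<in> idx_sets n k. l \<in> a}. \<Sum>c<n. if c \<in> a then b c * adjug H a c l else 0)"
  proof (rule sum.cong[OF refl])
    fix a assume a: "a \<in> {a \<in> idx_sets n k. l \<in> a}"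
    then have "{c \<in> {..<n}. c \<in> a} = a" using idx_setsD(2) by blast
    then show "rdet_on (row_repl H l b) a l = (\<Sum>c<n. if c \<in> a then b c * adjug H a c l else 0)"
      using a idx_setsD(1)[of a n k] sum.inter_filter[of "{..<n}" "\<lambda>c. b c * adjug H a c l" "\<lambda>c. c \<in> a"]
      by (simp add: rdet_on_row_repl)
  qed
  also have "\<dots> = (\<Sum>c<n. \<Sum>a\<in>{a \<in> idx_sets n k. l \<in> a}. if c \<in> a then b c * adjug H a c l else 0)"
    by (rule sum.swap)
  also have "\<dots> = (\<Sum>c<n. b c * adjsum H n k c l)"
  proof (rule sum.cong[OF refl])
    fix c
    have "{a \<in> {a \<in> idx_sets n k. l \<in> a}. c \<in> a} = {a \<in> idx_sets n k. c \<in> a \<and> l \<in> a}" by auto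
    then show "(\<Sum>a\<in>{a \<in> idx_sets n k. l \<in> a}. if c \<in> a then b c * adjug H a c l else 0) = b c * adjsum H n k c l"
      using sum.inter_filter[of "{a \<in> idx_sets n k. l \<in> a}" "\<lambda>a. b c * adjug H a c l" "\<lambda>a. c \<in> a"]
      by (simp add: adjsum_def sum_distrib_left finite_idx_sets)
  qed
  finally show ?thesis .
qed

lemma sum_cdet_on_col_repl:
  assumes "i < n"
  shows "(\<Sum>a\<in>{a \<in> idx_sets n k. i \<in> a}. cdet_on (col_repl H i b) a i) = (\<Sum>c<n. adjsum H n k i c * b c)"
proof -
  have "(\<Sum>a\<in>{a \<in> idx_sets n k. i \<in> a}. cdet_on (col_repl H i b) a i)
      = (\<Sum>a\<in>{a \<in> idx_sets n k. i \<in> a}. \<Sum>c<n. if c \<in> a then adjug H a i c * b c else 0)"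
  proof (rule sum.cong[OF refl])
    fix a assume a: "a \<in> {a \<in> idx_sets n k. i \<in> a}"
    then have "{c \<in> {..<n}. c \<in> a} = a" using idx_setsD(2) by blast
    then show "cdet_on (col_repl H i b) a i = (\<Sum>c<n. if c \<in> a then adjug H a i c * b c else 0)"
      using a idx_setsD(1)[of a n k] sum.inter_filter[of "{..<n}" "\<lambda>c. adjug H a i c * b c" "\<lambda>c. c \<in> a"]
      by (simp add: cdet_on_col_repl)
  qed
  also have "\<dots> = (\<Sum>c<n. \<Sum>a\<in>{a \<in> idx_sets n k. i \<in> a}. if c \<in> a then adjug H a i c * b c else 0)"
    by (rule sum.swap)
  also have "\<dots> = (\<Sum>c<n. adjsum H n k i c * b c)"
  proof (rule sum.cong[OF refl])
    fix c
    have "{a \<in> {a \<in> idx_sets n k. i \<in> a}. c \<in> a} = {a \<in> idx_sets n k. i \<in> a \<and> c \<in> a}" by auto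
    then show "(\<Sum>a\<in>{a \<in> idx_sets n k. i \<in> a}. if c \<in> a then adjug H a i c * b c else 0) = adjsum H n k i c * b c"
      using sum.inter_filter[of "{a \<in> idx_sets n k. i \<in> a}" "\<lambda>a. adjug H a i c * b c" "\<lambda>a. c \<in> a"]
      by (simp add: adjsum_def sum_distrib_right finite_idx_sets)
  qed
  finally show ?thesis .
qed

lemma sum_hdet: "1 \<le> k \<Longrightarrow> (\<Sum>b\<in>idx_sets n k. hdet H b) = detsum H n k"
  unfolding detsum_def by (intro sum.cong refl hdet_eq_mdet) (auto dest: idx_setsD(1,3))

end

section \<open>The ring of finitely supported quaternion matrices\<close>

text \<open>Padding with zeros turns matrices of all formats into elements of one non-unital ring, in which
  the identity matrices are idempotents.\<close>

typedef fmat = "{A :: qmat. \<exists>N. \<forall>i j. N \<le> i \<or> N \<le> j \<longrightarrow> A i j = 0}"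
  morphisms ent Abs_fmat
  by (intro exI[of _ "\<lambda>_ _. 0"]) auto

setup_lifting type_definition_fmat

lemma fmat_eqI: "(\<And>i j. ent A i j = ent B i j) \<Longrightarrow> A = B"
  by (rule iffD1[OF ent_inject]) (intro ext)

lemma ent_bounded: "\<exists>N. \<forall>i j. N \<le> i \<or> N \<le> j \<longrightarrow> ent A i j = 0"
  using ent[of A] by simp

lemma ent_bounded2:
  obtains N where "\<And>i j. N \<le> i \<or> N \<le> j \<Longrightarrow> ent A i j = 0"
    "\<And>i j. N \<le> i \<or> N \<le> j \<Longrightarrow> ent B i j = 0"
proof -
  obtain a where a: "\<And>i j. a \<le> i \<or> a \<le> j \<Longrightarrow> ent A i j = 0" using ent_bounded by blast
  obtain b where b: "\<And>i j. b \<le> i \<or> b \<le> j \<Longrightarrow> ent B i j = 0" using ent_bounded by blast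
  show ?thesis by (rule that[of "max a b"]) (use a b in auto)
qed

lemma sum_support_eq:
  assumes "finite L" and "\<And>l. l \<notin> L \<Longrightarrow> f l = (0::'a::semiring_0)"
  shows "(\<Sum>l | f l \<noteq> 0. f l * g l) = (\<Sum>l\<in>L. f l * g l)"
  by (rule sum.mono_neutral_left) (use assms in auto)

instantiation fmat :: real_algebra
begin

lift_definition zero_fmat :: fmat is "\<lambda>_ _. 0" by auto

lift_definition plus_fmat :: "fmat \<Rightarrow> fmat \<Rightarrow> fmat" is "\<lambda>A B i j. A i j + B i j"
proof -
  fix A B :: qmat
  assume "\<exists>N. \<forall>i j. N \<le> i \<or> N \<le> j \<longrightarrow> A i j = 0" "\<exists>N. \<forall>i j. N \<le> i \<or> N \<le> j \<longrightarrow> B i j = 0"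
  then obtain a b where "\<forall>i j. a \<le> i \<or> a \<le> j \<longrightarrow> A i j = 0" "\<forall>i j. b \<le> i \<or> b \<le> j \<longrightarrow> B i j = 0"
    by blast
  then show "\<exists>N. \<forall>i j. N \<le> i \<or> N \<le> j \<longrightarrow> A i j + B i j = 0"
    by (intro exI[of _ "max a b"]) auto
qed

lift_definition uminus_fmat :: "fmat \<Rightarrow> fmat" is "\<lambda>A i j. - A i j" by auto

definition minus_fmat :: "fmat \<Rightarrow> fmat \<Rightarrow> fmat" where "minus_fmat A B = A + - B"

lift_definition scaleR_fmat :: "real \<Rightarrow> fmat \<Rightarrow> fmat" is "\<lambda>a A i j. a *\<^sub>R A i j"
  by fastforce

text \<open>The type records no format, so the sum runs over the nonzero entries of a row of
  \<open>A\<close>. In computations \<open>ent_mult_bound\<close> replaces this range by any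
  sufficient bound.\<close>

lift_definition times_fmat :: "fmat \<Rightarrow> fmat \<Rightarrow> fmat" is "\<lambda>A B i j. \<Sum>l | A i l \<noteq> 0. A i l * B l j"
proof -
  fix A B :: qmat
  assume "\<exists>N. \<forall>i j. N \<le> i \<or> N \<le> j \<longrightarrow> A i j = 0" "\<exists>N. \<forall>i j. N \<le> i \<or> N \<le> j \<longrightarrow> B i j = 0"
  then obtain a b where "\<forall>i j. a \<le> i \<or> a \<le> j \<longrightarrow> A i j = 0" "\<forall>i j. b \<le> i \<or> b \<le> j \<longrightarrow> B i j = 0"
    by blast
  then show "\<exists>N. \<forall>i j. N \<le> i \<or> N \<le> j \<longrightarrow> (\<Sum>l | A i l \<noteq> 0. A i l * B l j) = 0"
    by (intro exI[of _ "max a b"]) auto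
qed

lemma ent_mult_bound:
  assumes "\<And>i j. N \<le> j \<Longrightarrow> ent A i j = 0"
  shows "ent (A * B) i j = (\<Sum>l<N. ent A i l * ent B l j)"
  unfolding times_fmat.rep_eq by (rule sum_support_eq) (use assms in auto)

instance
proof
  fix A B C :: fmat and a b :: real
  show "A + B + C = A + (B + C)" "A + B = B + A" "0 + A = A" "- A + A = 0"
    by (transfer; simp add: algebra_simps fun_eq_iff)+
  show "A - B = A + - B" by (rule minus_fmat_def)
  show "a *\<^sub>R (A + B) = a *\<^sub>R A + a *\<^sub>R B" "(a + b) *\<^sub>R A = a *\<^sub>R A + b *\<^sub>R A"
    "a *\<^sub>R b *\<^sub>R A = (a * b) *\<^sub>R A" "1 *\<^sub>R A = A"
    by (transfer; simp add: algebra_simps fun_eq_iff)+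
  obtain N where N: "\<And>i j. N \<le> i \<or> N \<le> j \<Longrightarrow> ent A i j = 0" "\<And>i j. N \<le> i \<or> N \<le> j \<Longrightarrow> ent B i j = 0"
    using ent_bounded2 by blast
  note A = ent_mult_bound[of N A] and B = ent_mult_bound[of N B]
  show "A * B * C = A * (B * C)"
  proof (rule fmat_eqI)
    fix i j
    have "ent (A * B * C) i j = (\<Sum>l<N. ent (A * B) i l * ent C l j)"
      by (rule ent_mult_bound) (simp add: A N)
    also have "\<dots> = (\<Sum>l<N. \<Sum>k<N. ent A i k * (ent B k l * ent C l j))"
      by (simp add: A N sum_distrib_right mult.assoc)
    also have "\<dots> = (\<Sum>k<N. \<Sum>l<N. ent A i k * (ent B k l * ent C l j))"
      by (rule sum.swap)
    also have "\<dots> = ent (A * (B * C)) i j"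
      by (simp add: A B N sum_distrib_left)
    finally show "ent (A * B * C) i j = ent (A * (B * C)) i j" .
  qed
  have AB: "ent ((A + B) * C) i j = (\<Sum>l<N. ent (A + B) i l * ent C l j)" for i j
    by (rule ent_mult_bound) (simp add: plus_fmat.rep_eq N)
  show "(A + B) * C = A * C + B * C"
    by (rule fmat_eqI) (simp add: AB, simp add: A B N plus_fmat.rep_eq distrib_right sum.distrib)
  show "A * (B + C) = A * B + A * C"
    by (rule fmat_eqI) (simp add: A N plus_fmat.rep_eq distrib_left sum.distrib)
  have aA: "ent (a *\<^sub>R A * B) i j = (\<Sum>l<N. ent (a *\<^sub>R A) i l * ent B l j)" for i j
    by (rule ent_mult_bound) (simp add: scaleR_fmat.rep_eq N)
  show "a *\<^sub>R A * B = a *\<^sub>R (A * B)"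
    by (rule fmat_eqI) (simp add: aA, simp add: A N scaleR_fmat.rep_eq scaleR_sum_right)
  show "A * a *\<^sub>R B = a *\<^sub>R (A * B)"
    by (rule fmat_eqI) (simp add: A N scaleR_fmat.rep_eq scaleR_sum_right)
qed

end

lemma ent_simps [simp]:
  "ent 0 i j = 0" "ent (A + B) i j = ent A i j + ent B i j" "ent (- A) i j = - ent A i j"
  "ent (a *\<^sub>R A) i j = a *\<^sub>R ent A i j"
  by (simp_all add: zero_fmat.rep_eq plus_fmat.rep_eq uminus_fmat.rep_eq scaleR_fmat.rep_eq)

lift_definition star :: "fmat \<Rightarrow> fmat" is "\<lambda>A i j. Defs.cnj (A j i)"
  by fastforce

lemma ent_star [simp]: "ent (star A) i j = Defs.cnj (ent A j i)"
  by (simp add: star.rep_eq)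

lemma star_star [simp]: "star (star A) = A"
  and star_add [simp]: "star (A + B) = star A + star B"
  and star_minus [simp]: "star (- A) = - star A"
  and star_0 [simp]: "star 0 = 0"
  and star_scaleR [simp]: "star (a *\<^sub>R A) = a *\<^sub>R star A"
  by (auto intro!: fmat_eqI)

lemma star_diff [simp]: "star (A - B) = star A - star B"
  by (simp only: diff_conv_add_uminus star_add star_minus)

lemma star_mult [simp]: "star (A * B) = star B * star A"
proof -
  obtain N where N: "\<And>i j. N \<le> i \<or> N \<le> j \<Longrightarrow> ent A i j = 0" "\<And>i j. N \<le> i \<or> N \<le> j \<Longrightarrow> ent B i j = 0"
    using ent_bounded2 by blast
  have 1: "ent (A * B) i j = (\<Sum>l<N. ent A i l * ent B l j)" for i j
    by (rule ent_mult_bound) (simp add: N)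
  have 2: "ent (star B * star A) i j = (\<Sum>l<N. ent (star B) i l * ent (star A) l j)" for i j
    by (rule ent_mult_bound) (simp add: N)
  show ?thesis
    by (rule fmat_eqI) (simp add: 1 2 cnj_sum)
qed

section \<open>Passage between matrices with a format and ring elements\<close>

lift_definition fm :: "nat \<Rightarrow> nat \<Rightarrow> qmat \<Rightarrow> fmat" is "\<lambda>m n A i j. if i < m \<and> j < n then A i j else 0"
proof -
  fix m n and A :: qmat
  show "\<exists>N. \<forall>i j. N \<le> i \<or> N \<le> j \<longrightarrow> (if i < m \<and> j < n then A i j else 0) = 0"
    by (intro exI[of _ "max m n"]) auto
qed

lemma ent_fm: "ent (fm m n A) i j = (if i < m \<and> j < n then A i j else 0)"
  by (simp add: fm.rep_eq)

definition unitm :: "nat \<Rightarrow> fmat" where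
  "unitm n = fm n n idm"

lemma ent_unitm_mult: "ent (unitm n * X) i j = (if i < n then ent X i j else 0)"
proof -
  have "ent (unitm n * X) i j = (\<Sum>l<n. ent (unitm n) i l * ent X l j)"
    by (rule ent_mult_bound) (simp add: unitm_def ent_fm)
  also have "\<dots> = (\<Sum>l<n. if l = i then (if i < n then ent X i j else 0) else 0)"
    by (intro sum.cong refl) (auto simp: unitm_def ent_fm idm_def)
  finally show ?thesis by (simp add: sum.delta)
qed

lemma star_unitm [simp]: "star (unitm n) = unitm n"
  by (rule fmat_eqI) (auto simp: unitm_def ent_fm idm_def)

lemma ent_mult_unitm: "ent (X * unitm n) i j = (if j < n then ent X i j else 0)"
proof -
  have "ent (X * unitm n) i j = Defs.cnj (ent (unitm n * star X) j i)"
    unfolding ent_star[symmetric] star_mult star_star star_unitm by (rule refl)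
  then show ?thesis by (simp add: ent_unitm_mult)
qed

lemma unitm_mult_unitm [simp]: "unitm n * unitm n = unitm n"
  by (rule fmat_eqI) (simp only: ent_unitm_mult, simp add: unitm_def ent_fm)

lemma unitm_mult_fm [simp]: "unitm m * fm m n A = fm m n A"
  and fm_mult_unitm [simp]: "fm m n A * unitm n = fm m n A"
  by (rule fmat_eqI, simp only: ent_unitm_mult ent_mult_unitm, simp add: ent_fm)+

lemma unitm_mult_fm_assoc [simp]: "unitm m * (fm m n A * X) = fm m n A * X"
  by (simp flip: mult.assoc)

lemma fm_mult: "fm m k A * fm k n B = fm m n (mmult k A B)"
proof (rule fmat_eqI)
  fix i j
  have "ent (fm m k A * fm k n B) i j = (\<Sum>l<k. ent (fm m k A) i l * ent (fm k n B) l j)"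
    by (rule ent_mult_bound) (simp add: ent_fm)
  then show "ent (fm m k A * fm k n B) i j = ent (fm m n (mmult k A B)) i j"
    by (auto simp: ent_fm mmult_def)
qed

lemma star_fm: "star (fm m n A) = fm n m (adj A)"
  by (rule fmat_eqI) (auto simp: ent_fm adj_def)

lemma meq_iff_fm: "meq m n X Y \<longleftrightarrow> fm m n X = fm m n Y"
proof
  show "meq m n X Y \<Longrightarrow> fm m n X = fm m n Y"
    by (rule fmat_eqI) (auto simp: ent_fm meq_def)
  assume eq: "fm m n X = fm m n Y"
  show "meq m n X Y"
    unfolding meq_def
  proof (intro allI impI)
    fix i j assume "i < m" "j < n"
    then show "X i j = Y i j" using arg_cong[OF eq, of "\<lambda>Z. ent Z i j"] by (simp add: ent_fm)
  qed
qed

lemma herm_iff_fm: "herm n X \<longleftrightarrow> star (fm n n X) = fm n n X"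
proof -
  have "herm n X \<longleftrightarrow> meq n n (adj X) X"
    unfolding herm_def meq_def adj_def by (auto simp: eq_commute)
  then show ?thesis
    by (simp only: meq_iff_fm star_fm)
qed

lemma fm_ent: "unitm m * X = X \<Longrightarrow> X * unitm n = X \<Longrightarrow> fm m n (ent X) = X"
proof -
  assume X: "unitm m * X = X" "X * unitm n = X"
  have "ent (fm m n (ent X)) i j = ent (unitm m * (X * unitm n)) i j" for i j
    by (simp only: ent_fm ent_unitm_mult ent_mult_unitm) auto
  then show ?thesis using X by (metis fmat_eqI)
qed

lemma zero_out_iff_fm: "zero_out m n X \<longleftrightarrow> ent (fm m n X) = X"
  by (auto simp: zero_out_def fun_eq_iff ent_fm)

lemma zero_out_ent: "unitm m * X = X \<Longrightarrow> X * unitm n = X \<Longrightarrow> zero_out m n (ent X)"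
  by (simp add: zero_out_iff_fm fm_ent)

section \<open>Trace and positive definiteness\<close>

text \<open>The real part of the trace. It plays the role of the quadratic form in a ring without
  vectors, and taking real parts makes it cyclic.\<close>

definition retr :: "fmat \<Rightarrow> real" where
  "retr A = (\<Sum>i | ent A i i \<noteq> 0. qre (ent A i i))"

lemma retr_bound:
  assumes "\<And>i. N \<le> i \<Longrightarrow> ent A i i = 0"
  shows "retr A = (\<Sum>i<N. qre (ent A i i))"
proof -
  have "i < N" if "ent A i i \<noteq> 0" for i
    using assms[of i] that by (cases "i < N") auto
  then have "{i. ent A i i \<noteq> 0} \<subseteq> {..<N}"
    by auto
  then show ?thesis
    unfolding retr_def by (rule sum.mono_neutral_left[OF finite_lessThan]) auto
qed

lemma retr_add: "retr (A + B) = retr A + retr B"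
proof -
  obtain N where N: "\<And>i j. N \<le> i \<or> N \<le> j \<Longrightarrow> ent A i j = 0" "\<And>i j. N \<le> i \<or> N \<le> j \<Longrightarrow> ent B i j = 0"
    using ent_bounded2 by blast
  show ?thesis
    by (subst (1 2 3) retr_bound[of N]) (simp_all add: N sum.distrib)
qed

lemma retr_0 [simp]: "retr 0 = 0"
  by (simp add: retr_def)

lemma retr_scaleR: "retr (a *\<^sub>R A) = a * retr A"
proof -
  obtain N where N: "\<And>i j. N \<le> i \<or> N \<le> j \<Longrightarrow> ent A i j = 0"
    using ent_bounded by blast
  show ?thesis
    by (subst (1 2) retr_bound[of N]) (simp_all add: N sum_distrib_left)
qed

lemma retr_mult_commute: "retr (A * B) = retr (B * A)"
proof -
  obtain N where N: "\<And>i j. N \<le> i \<or> N \<le> j \<Longrightarrow> ent A i j = 0" "\<And>i j. N \<le> i \<or> N \<le> j \<Longrightarrow> ent B i j = 0"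
    using ent_bounded2 by blast
  have 1: "ent (A * B) i j = (\<Sum>l<N. ent A i l * ent B l j)" for i j
    by (rule ent_mult_bound) (simp add: N)
  have 2: "ent (B * A) i j = (\<Sum>l<N. ent B i l * ent A l j)" for i j
    by (rule ent_mult_bound) (simp add: N)
  have "retr (A * B) = (\<Sum>i<N. \<Sum>l<N. qre (ent A i l * ent B l i))"
    by (subst retr_bound[of N]) (simp_all add: 1 N qre_sum)
  also have "\<dots> = (\<Sum>l<N. \<Sum>i<N. qre (ent B l i * ent A i l))"
    by (subst sum.swap) (simp only: qre_mult_commute)
  also have "\<dots> = retr (B * A)"
    by (subst retr_bound[of N]) (simp_all add: 2 N qre_sum)
  finally show ?thesis .
qed

lemma retr_star_mult_self: "0 \<le> retr (star Z * Z)" "retr (star Z * Z) = 0 \<longleftrightarrow> Z = 0"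
proof -
  obtain N where N: "\<And>i j. N \<le> i \<or> N \<le> j \<Longrightarrow> ent Z i j = 0"
    using ent_bounded by blast
  have 1: "ent (star Z * Z) i j = (\<Sum>l<N. ent (star Z) i l * ent Z l j)" for i j
    by (rule ent_mult_bound) (simp add: N)
  have eq: "retr (star Z * Z) = (\<Sum>i<N. \<Sum>l<N. qnsq (ent Z l i))"
    by (subst retr_bound[of N]) (simp_all add: 1 N qre_sum qre_cnj_mult_self)
  show "0 \<le> retr (star Z * Z)"
    unfolding eq by (intro sum_nonneg qnsq_nonneg)
  show "retr (star Z * Z) = 0 \<longleftrightarrow> Z = 0"
  proof
    assume "retr (star Z * Z) = 0"
    then have "\<forall>i<N. \<forall>l<N. ent Z l i = 0"
      unfolding eq by (simp add: sum_nonneg_eq_0_iff sum_nonneg qnsq_nonneg qnsq_eq_0_iff)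
    then show "Z = 0"
      using N by (intro fmat_eqI) (metis ent_simps(1) not_le)
  qed simp
qed

lemma star_mult_self_eq_0: "star Z * Z = 0 \<Longrightarrow> Z = 0"
  using retr_star_mult_self(2)[of Z] by simp

text \<open>Tested on matrices \<open>Z\<close> instead of vectors, so that the defect of a matrix
  equation can be inserted directly.\<close>

definition pd :: "nat \<Rightarrow> fmat \<Rightarrow> bool" where
  "pd n H \<longleftrightarrow> star H = H \<and> unitm n * H = H \<and>
     (\<forall>Z. unitm n * Z = Z \<longrightarrow> Z \<noteq> 0 \<longrightarrow> 0 < retr (star Z * H * Z))"

lemma pdD:
  assumes "pd n H"
  shows "star H = H" "unitm n * H = H" "H * unitm n = H"
    "\<And>Z. unitm n * Z = Z \<Longrightarrow> Z \<noteq> 0 \<Longrightarrow> 0 < retr (star Z * H * Z)"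
proof -
  show *: "star H = H" "unitm n * H = H" "\<And>Z. unitm n * Z = Z \<Longrightarrow> Z \<noteq> 0 \<Longrightarrow> 0 < retr (star Z * H * Z)"
    using assms by (auto simp: pd_def)
  show "H * unitm n = H"
    using arg_cong[OF *(2), of star] *(1) by simp
qed

lemma pd_nonneg: "pd n H \<Longrightarrow> unitm n * Z = Z \<Longrightarrow> 0 \<le> retr (star Z * H * Z)"
  using pdD(4)[of n H Z] by (cases "Z = 0") auto

lemma pd_eq_0: "pd n H \<Longrightarrow> unitm n * Z = Z \<Longrightarrow> star Z * H * Z = 0 \<Longrightarrow> Z = 0"
  using pdD(4)[of n H Z] by force

lemma ent_quadratic:
  "ent (star Z * fm n n H * Z) c c = (\<Sum>i<n. \<Sum>j<n. Defs.cnj (ent Z i c) * H i j * ent Z j c)"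
proof -
  have 1: "ent (fm n n H * Z) i c = (\<Sum>j<n. ent (fm n n H) i j * ent Z j c)" for i
    by (rule ent_mult_bound) (simp add: ent_fm)
  have "star Z * fm n n H * Z = (star Z * unitm n) * (fm n n H * Z)"
    by (simp add: mult.assoc)
  also have "ent \<dots> c c = (\<Sum>i<n. ent (star Z * unitm n) c i * ent (fm n n H * Z) i c)"
    by (rule ent_mult_bound) (simp add: ent_mult_unitm)
  finally show ?thesis
    by (simp add: 1 ent_mult_unitm sum_distrib_left ent_fm mult.assoc)
qed

definition col :: "nat \<Rightarrow> (nat \<Rightarrow> quat) \<Rightarrow> fmat" where
  "col n x = fm n 1 (\<lambda>i _. x i)"

lemma unitm_mult_col [simp]: "unitm n * col n x = col n x"
  by (simp add: col_def)

lemma col_eq_0_iff: "col n x = 0 \<longleftrightarrow> (\<forall>i<n. x i = 0)"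
proof
  assume eq: "col n x = 0"
  show "\<forall>i<n. x i = 0"
  proof (intro allI impI)
    fix i assume "i < n"
    then show "x i = 0" using arg_cong[OF eq, of "\<lambda>Z. ent Z i 0"] by (simp add: col_def ent_fm)
  qed
qed (auto intro!: fmat_eqI simp: col_def ent_fm)

lemma ent_mult_col: "X * unitm n = X \<Longrightarrow> ent (X * col n x) i j = (if j = 0 then \<Sum>l<n. ent X i l * x l else 0)"
proof -
  assume X: "X * unitm n = X"
  have "ent (X * col n x) i j = (\<Sum>l<n. ent X i l * ent (col n x) l j)"
    by (rule ent_mult_bound) (metis X ent_mult_unitm leD)
  then show ?thesis by (simp add: col_def ent_fm)
qed

lemma retr_quadratic_col:
  "retr (star (col n x) * fm n n H * col n x) = qre (\<Sum>i<n. \<Sum>j<n. Defs.cnj (x i) * H i j * x j)"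
proof -
  have "retr (star (col n x) * fm n n H * col n x) = (\<Sum>c<1. qre (ent (star (col n x) * fm n n H * col n x) c c))"
    by (rule retr_bound) (simp add: ent_quadratic, simp add: col_def ent_fm)
  also have "\<dots> = qre (\<Sum>i<n. \<Sum>j<n. Defs.cnj (x i) * H i j * x j)"
    by (simp add: ent_quadratic) (simp add: col_def ent_fm)
  finally show ?thesis .
qed

text \<open>The trace adds up the values of the form on the columns of \<open>Z\<close>; conversely,
  a vector is a matrix with one column.\<close>

lemma hpd_iff_pd: "hpd n H \<longleftrightarrow> pd n (fm n n H)"
proof
  assume H: "hpd n H"
  have "0 < retr (star Z * fm n n H * Z)" if Z: "unitm n * Z = Z" "Z \<noteq> 0" for Z
  proof -
    obtain N where N: "\<And>i j. N \<le> i \<or> N \<le> j \<Longrightarrow> ent Z i j = 0"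
      using ent_bounded by blast
    have eq: "retr (star Z * fm n n H * Z) = (\<Sum>c<N. qre (\<Sum>i<n. \<Sum>j<n. Defs.cnj (ent Z i c) * H i j * ent Z j c))"
      by (subst retr_bound[of N]) (simp_all add: ent_quadratic N)
    obtain i c where ic: "ent Z i c \<noteq> 0"
      using Z(2) fmat_eqI[of Z 0] by auto
    then have i: "i < n" "c < N"
      using arg_cong[OF Z(1), of "\<lambda>Z. ent Z i c"] N[of i c] by (auto simp: ent_unitm_mult intro: ccontr)
    have nn: "0 \<le> qre (\<Sum>i<n. \<Sum>j<n. Defs.cnj (ent Z i c) * H i j * ent Z j c)" for c
      using H unfolding hpd_def by (cases "\<exists>i<n. ent Z i c \<noteq> 0") (auto intro: less_imp_le)
    show ?thesis
      unfolding eq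
    proof (rule sum_pos2[of _ c])
      show "0 < qre (\<Sum>i<n. \<Sum>j<n. Defs.cnj (ent Z i c) * H i j * ent Z j c)"
        using H ic i(1) unfolding hpd_def by (elim conjE allE[of _ "\<lambda>k. ent Z k c"]) blast
    qed (use i nn in auto)
  qed
  then show "pd n (fm n n H)"
    using H by (auto simp: pd_def hpd_def herm_iff_fm)
next
  assume H: "pd n (fm n n H)"
  have "0 < qre (\<Sum>i<n. \<Sum>j<n. Defs.cnj (x i) * H i j * x j)" if "\<exists>i<n. x i \<noteq> 0" for x
    using pdD(4)[OF H, of "col n x"] that by (auto simp: col_eq_0_iff retr_quadratic_col)
  then show "hpd n H"
    using pdD(1)[OF H] by (auto simp: hpd_def herm_iff_fm)
qed

section \<open>Inverses and square roots of positive definite matrices\<close>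

definition adjm :: "fmat \<Rightarrow> nat \<Rightarrow> nat \<Rightarrow> fmat" where
  "adjm H n k = fm n n (adjsum (ent H) n k)"

locale herm_fmat =
  fixes n :: nat and H :: fmat
  assumes star_H [simp]: "star H = H" and unitm_H [simp]: "unitm n * H = H"
begin

lemma H_unitm [simp]: "H * unitm n = H"
proof -
  have "star (unitm n * H) = star H" by simp
  then show ?thesis unfolding star_mult star_H star_unitm .
qed

sublocale hermitian "ent H"
proof
  fix i j
  show "ent H j i = Defs.cnj (ent H i j)"
    using ent_star[of H j i] by simp
qed

lemma fm_ent_H: "fm n n (ent H) = H"
  by (rule fm_ent) simp_all

lemma unitm_adjm [simp]: "unitm n * adjm H n k = adjm H n k"
  and adjm_unitm [simp]: "adjm H n k * unitm n = adjm H n k"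
  by (simp_all add: adjm_def)

lemma star_adjm [simp]: "star (adjm H n k) = adjm H n k"
  by (rule fmat_eqI) (auto simp: adjm_def ent_fm cnj_adjsum)

lemma mult_adjm: "H * adjm H n k + adjm H n (Suc k) = detsum (ent H) n k *\<^sub>R unitm n"
proof (rule fmat_eqI)
  fix i j
  have "H * adjm H n k = fm n n (mmult n (ent H) (adjsum (ent H) n k))"
    unfolding adjm_def by (subst (1) fm_ent_H[symmetric]) (rule fm_mult)
  then show "ent (H * adjm H n k + adjm H n (Suc k)) i j = ent (detsum (ent H) n k *\<^sub>R unitm n) i j"
    using hermitian_mult_adjsum[of i n j k]
    by (auto simp: ent_fm adjm_def mmult_def unitm_def idm_def of_real_def)
qed

lemma adjm_mult: "adjm H n k * H + adjm H n (Suc k) = detsum (ent H) n k *\<^sub>R unitm n"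
  using arg_cong[OF mult_adjm, of star] by simp

lemma adjm_commute: "H * adjm H n k = adjm H n k * H"
  using mult_adjm[of k] adjm_mult[of k] by (metis add_right_cancel)

lemma adjm_0: "adjm H n 0 = 0"
  by (rule fmat_eqI) (simp add: adjm_def ent_fm adjsum_0)

lemma adjm_large: "n < k \<Longrightarrow> adjm H n k = 0"
  by (rule fmat_eqI) (simp add: adjm_def ent_fm adjsum_large)

lemma adjm_1: "adjm H n (Suc 0) = unitm n"
  using mult_adjm[of 0] by (simp add: adjm_0 detsum_0)

text \<open>Evaluation at \<open>H\<close> by Horner's rule. The ring has no unit, so constants
  become multiples of \<open>unitm n\<close>.\<close>

definition ev :: "real poly \<Rightarrow> fmat" where
  "ev p = fold_coeffs (\<lambda>a X. a *\<^sub>R unitm n + H * X) p 0"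

lemma ev_0 [simp]: "ev 0 = 0"
  by (simp add: ev_def)

lemma ev_pCons [simp]: "ev (pCons a p) = a *\<^sub>R unitm n + H * ev p"
  by (cases "p = 0 \<and> a = 0") (auto simp: ev_def)

lemma ev_1: "ev 1 = unitm n"
  by (simp add: one_pCons)

lemma ev_add: "ev (p + q) = ev p + ev q"
  by (induction p q rule: poly_induct2) (simp_all add: algebra_simps)

lemma ev_smult: "ev (smult a p) = a *\<^sub>R ev p"
  by (induction p) (simp_all add: algebra_simps)

lemma ev_minus: "ev (- p) = - ev p"
  using ev_smult[of "- 1" p] by simp

lemma ev_diff: "ev (p - q) = ev p - ev q"
  using ev_add[of p "- q"] by (simp add: ev_minus)

lemma unitm_ev [simp]: "unitm n * ev p = ev p"
  by (induction p) (simp_all add: distrib_left flip: mult.assoc)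

lemma ev_commute: "ev p * H = H * ev p"
  by (induction p) (simp_all add: algebra_simps)

lemma ev_mult: "ev (p * q) = ev p * ev q"
  by (induction p) (simp_all add: ev_add ev_smult algebra_simps)

lemma star_ev [simp]: "star (ev p) = ev p"
  by (induction p) (simp_all add: ev_commute)

text \<open>The recursion writes \<open>adjm H n (Suc k)\<close> as a polynomial in
  \<open>H\<close>; each step shifts the previous one up and so keeps it nonzero. Beyond order
  \<open>n\<close> the adjugate sum is zero.\<close>

lemma ex_annihilator: "\<exists>p. p \<noteq> 0 \<and> ev p = 0"
proof -
  have "\<exists>p. p \<noteq> 0 \<and> ev p = adjm H n (Suc k)" for k
  proof (induction k)
    case 0
    show ?case using ev_1 adjm_1 by (intro exI[of _ 1]) simp
  next
    case (Suc k)
    then obtain p where p: "p \<noteq> 0" "ev p = adjm H n (Suc k)" by blast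
    have "ev (pCons (detsum (ent H) n (Suc k)) (- p)) = adjm H n (Suc (Suc k))"
      using mult_adjm[of "Suc k"] p(2) by (simp add: ev_minus algebra_simps)
    then show ?case using p(1) by (intro exI[of _ "pCons (detsum (ent H) n (Suc k)) (- p)"]) simp
  qed
  from this[of n] show ?thesis
    using adjm_large[of "Suc n"] by auto
qed

lemma ev_linear: "ev [:- l, 1:] = H - l *\<^sub>R unitm n"
  by simp

text \<open>The factor is Hermitian, so a vanishing square forces a vanishing Gram product. This
  removes repeated roots.\<close>

lemma ev_linear_square_cancel:
  assumes "ev [:- l, 1:] * (ev [:- l, 1:] * Z) = 0"
  shows "ev [:- l, 1:] * Z = 0"
proof (rule star_mult_self_eq_0)
  show "star (ev [:- l, 1:] * Z) * (ev [:- l, 1:] * Z) = 0"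
    using assms unfolding star_mult star_ev mult.assoc by simp
qed

text \<open>The quadratic is \<open>(x - a)\<close> squared plus \<open>b\<close> squared, so its
  trace form is a sum of nonnegative terms. This removes pairs of complex conjugate roots.\<close>

lemma ev_quadratic_cancel:
  assumes b: "b \<noteq> 0" and Z: "unitm n * Z = Z" "ev [:a\<^sup>2 + b\<^sup>2, - 2 * a, 1:] * Z = 0"
  shows "Z = 0"
proof -
  let ?L = "ev [:- a, 1:]"
  have g: "[:a\<^sup>2 + b\<^sup>2, - 2 * a, 1:] = [:- a, 1:] * [:- a, 1:] + [:b\<^sup>2:]"
    by (simp add: power2_eq_square)
  have "?L * (?L * Z) + b\<^sup>2 *\<^sub>R Z = 0"
    using Z(2) unfolding g ev_add ev_mult using Z(1)
    by (simp only: ev_pCons[of "b\<^sup>2" 0] ev_0 mult_zero_right add_0_right distrib_right mult.assoc mult_scaleR_left)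
  then have "star Z * (?L * (?L * Z)) + b\<^sup>2 *\<^sub>R (star Z * Z) = 0"
    by (metis distrib_left mult_scaleR_right mult_zero_right)
  moreover have "star Z * (?L * (?L * Z)) = star (?L * Z) * (?L * Z)"
    by (simp only: star_mult star_ev mult.assoc)
  ultimately have "retr (star (?L * Z) * (?L * Z)) + b\<^sup>2 * retr (star Z * Z) = 0"
    by (metis retr_0 retr_add retr_scaleR)
  then have "b\<^sup>2 * retr (star Z * Z) \<le> 0"
    using retr_star_mult_self(1)[of "?L * Z"] by linarith
  moreover have "0 < b\<^sup>2" using b by simp
  ultimately have "\<not> 0 < retr (star Z * Z)"
    using mult_pos_pos[of "b\<^sup>2" "retr (star Z * Z)"] by linarith
  then show ?thesis
    using retr_star_mult_self[of Z] by linarith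
qed

end

section \<open>Inverses of positive definite matrices\<close>

lemma pd_herm_fmat: "pd n H \<Longrightarrow> herm_fmat n H"
  by unfold_locales (auto dest: pdD)

lemma pd_detsum_pos:
  assumes "pd n H"
  shows "0 < detsum (ent H) n n"
proof -
  interpret herm_fmat n H by (rule pd_herm_fmat[OF assms])
  have "hpd n (ent H)"
    unfolding hpd_iff_pd fm_ent_H by (rule assms)
  then have "0 < mdet (ent H) {..<n}"
    by (intro mdet_pos) (auto simp: hpd_def)
  then show ?thesis
    by (simp add: detsum_def idx_sets_full)
qed

text \<open>At order \<open>n\<close> the recursion ends, since the next adjugate sum is zero, and
  the last minor is positive.\<close>

lemma pd_inverse:
  assumes "pd n H"
  obtains Y where "pd n Y" "H * Y = unitm n" "Y * H = unitm n"
proof -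
  interpret herm_fmat n H by (rule pd_herm_fmat[OF assms])
  let ?d = "detsum (ent H) n n"
  have d: "0 < ?d" by (rule pd_detsum_pos[OF assms])
  define Y where "Y = (1 / ?d) *\<^sub>R adjm H n n"
  have HY: "H * Y = unitm n"
    using mult_adjm[of n] d by (simp add: Y_def adjm_large)
  have YH: "Y * H = unitm n"
    using adjm_mult[of n] d by (simp add: Y_def adjm_large)
  have Y: "star Y = Y" "unitm n * Y = Y" by (simp_all add: Y_def)
  have "0 < retr (star Z * Y * Z)" if Z: "unitm n * Z = Z" "Z \<noteq> 0" for Z
  proof -
    have "H * (Y * Z) = Z" using HY Z(1) by (simp flip: mult.assoc)
    then have "Y * Z \<noteq> 0" using Z(2) by auto
    moreover have "unitm n * (Y * Z) = Y * Z" using Y(2) by (simp flip: mult.assoc)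
    ultimately have "0 < retr (star (Y * Z) * H * (Y * Z))"
      using pdD(4)[OF assms] by blast
    also have "star (Y * Z) * H * (Y * Z) = star Z * Y * Z"
      using \<open>H * (Y * Z) = Z\<close> Y(1) by (simp add: mult.assoc)
    finally show ?thesis .
  qed
  then have "pd n Y" using Y by (simp add: pd_def)
  then show ?thesis using that HY YH by blast
qed

lemma minv_props:
  assumes "hpd n H"
  shows "pd n (fm n n (minv n H))" "fm n n H * fm n n (minv n H) = unitm n"
    "fm n n (minv n H) * fm n n H = unitm n"
proof -
  let ?H = "fm n n H"
  have "pd n ?H" using assms by (simp add: hpd_iff_pd)
  then obtain Y where Y: "pd n Y" "?H * Y = unitm n" "Y * ?H = unitm n"
    using pd_inverse by blast
  have fY: "fm n n (ent Y) = Y" by (intro fm_ent pdD[OF Y(1)])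
  have "minv n H = ent Y"
    unfolding minv_def meq_iff_fm unitm_def[symmetric]
  proof (rule the_equality)
    show "zero_out n n (ent Y) \<and> fm n n (mmult n H (ent Y)) = unitm n \<and> fm n n (mmult n (ent Y) H) = unitm n"
      using Y pdD[OF Y(1)] by (simp add: zero_out_ent fY flip: fm_mult)
  next
    fix X assume X: "zero_out n n X \<and> fm n n (mmult n H X) = unitm n \<and> fm n n (mmult n X H) = unitm n"
    have "fm n n X = Y * ?H * fm n n X" using Y by simp
    also have "\<dots> = Y * (?H * fm n n X)" by (rule mult.assoc)
    also have "\<dots> = Y" using X pdD[OF Y(1)] by (simp add: fm_mult)
    finally show "X = ent Y" using X by (metis zero_out_iff_fm)
  qed
  then show "pd n (fm n n (minv n H))" "fm n n H * fm n n (minv n H) = unitm n"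
    "fm n n (minv n H) * fm n n H = unitm n"
    using Y fY by simp_all
qed

text \<open>Multiplied by \<open>star Z\<close> and traced, the Sylvester equation becomes a sum of
  a positive and a nonnegative number unless \<open>Z = 0\<close>. It yields uniqueness of square
  roots and, later, commutation with them.\<close>

lemma sylvester_eq_0:
  assumes "pd n S" "pd n T" and Z: "unitm n * Z = Z" "Z * unitm n = Z" "S * Z + Z * T = 0"
  shows "Z = 0"
proof (rule ccontr)
  assume "Z \<noteq> 0"
  have "star Z * S * Z + star Z * Z * T = 0"
    using arg_cong[OF Z(3), of "\<lambda>X. star Z * X"] by (simp add: distrib_left mult.assoc)
  then have "retr (star Z * S * Z) + retr (star Z * (Z * T)) = 0"
    by (metis mult.assoc retr_0 retr_add)
  moreover have "retr (star Z * (Z * T)) = retr (star (star Z) * T * star Z)"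
    by (simp add: retr_mult_commute[of "star Z"])
  moreover have "unitm n * star Z = star Z"
    using arg_cong[OF Z(2), of star] by simp
  ultimately show False
    using pdD(4)[OF assms(1) Z(1) \<open>Z \<noteq> 0\<close>] pd_nonneg[OF assms(2), of "star Z"] by linarith
qed

text \<open>\<open>S * (S - T) + (S - T) * T\<close> telescopes to the difference of the
  squares.\<close>

lemma pd_sqrt_unique:
  assumes "pd n S" "pd n T" "S * S = T * T"
  shows "S = T"
proof -
  have "S - T = 0"
    by (rule sylvester_eq_0[OF assms(1,2)])
       (use assms(3) in \<open>simp_all add: pdD[OF assms(1)] pdD[OF assms(2)] algebra_simps\<close>)
  then show ?thesis by simp
qed

section \<open>Existence of square roots\<close>

lemma poly_map_of_real: "poly (map_poly of_real p) (of_real x) = of_real (poly p x)"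
  for x :: real by (induction p) (simp_all add: map_poly_pCons)

text \<open>A complex root that is not real also annihilates the remainder modulo its real
  quadratic; a real polynomial of degree at most 1 with such a root is zero.\<close>

lemma real_poly_factor_cases:
  fixes p :: "real poly"
  assumes "0 < degree p"
  obtains l where "[:- l, 1:] dvd p" | a b where "b \<noteq> 0" "[:a\<^sup>2 + b\<^sup>2, - 2 * a, 1:] dvd p"
proof -
  let ?P = "map_poly of_real p :: complex poly"
  have "degree ?P = degree p" by (rule degree_map_poly) simp
  then have "\<not> constant (poly ?P)" using assms by (simp add: constant_degree)
  then obtain z where z: "poly ?P z = 0" using fundamental_theorem_of_algebra by blast
  show ?thesis
  proof (cases "Im z = 0")
    case True
    then have "z = of_real (Re z)" by (simp add: complex_eq_iff)
    then have "poly p (Re z) = 0" using z poly_map_of_real[of p "Re z"] by (metis of_real_eq_0_iff)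
    then show ?thesis using that(1) by (simp add: poly_eq_0_iff_dvd)
  next
    case False
    let ?g = "[:(Re z)\<^sup>2 + (Im z)\<^sup>2, - 2 * Re z, 1:]"
    have gz: "poly (map_poly of_real ?g) z = 0"
      by (simp add: map_poly_pCons complex_eq_iff power2_eq_square algebra_simps)
    define r where "r = p mod ?g"
    have "degree r < 2 \<or> r = 0"
      using degree_mod_less[of ?g p] by (auto simp: r_def)
    then obtain c d where r: "r = [:c, d:]"
      by (metis degree_0 degree_eq_zeroE less_2_cases_iff pCons_cases degree_pCons_eq Suc_inject One_nat_def pCons_0_0)
    have hom: "map_poly of_real (x + y) = map_poly of_real x + (map_poly of_real y :: complex poly)"
      "map_poly of_real (x * y) = map_poly of_real x * (map_poly of_real y :: complex poly)" for x y :: "real poly"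
      by (auto intro!: poly_eqI simp: coeff_map_poly coeff_mult)
    have "p = ?g * (p div ?g) + r" by (simp only: r_def mult_div_mod_eq)
    then have "map_poly of_real p = map_poly of_real ?g * map_poly of_real (p div ?g) + (map_poly of_real r :: complex poly)"
      by (metis hom)
    then have "poly (map_poly of_real r) z = 0" using z gz by simp
    then have "of_real c + z * of_real d = 0" by (simp add: r map_poly_pCons)
    then have "c = 0 \<and> d = 0" using False by (auto simp: complex_eq_iff)
    then have "?g dvd p" using r by (simp add: r_def mod_eq_0_iff_dvd)
    then show ?thesis using that(2) False by blast
  qed
qed

lemma prod_linear_dvd:
  fixes h :: "real poly"
  assumes "finite L" "\<And>l. l \<in> L \<Longrightarrow> poly h l = 0"
  shows "(\<Prod>l\<in>L. [:- l, 1:]) dvd h"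
  using assms
proof (induction L arbitrary: h rule: finite_induct)
  case (insert a L)
  then obtain q where q: "h = [:- a, 1:] * q" by (metis dvd_def insertI1 poly_eq_0_iff_dvd)
  have "(\<Prod>l\<in>L. [:- l, 1:]) dvd q"
  proof (rule insert.IH)
    fix l assume l: "l \<in> L"
    then have "(l - a) * poly q l = 0" using insert.prems[of l] by (auto simp: q)
    then show "poly q l = 0" using l insert.hyps by auto
  qed
  then show ?case using insert.hyps by (simp add: q mult_dvd_mono del: mult_pCons_left)
qed simp

lemma ex_interpolation:
  fixes g :: "real \<Rightarrow> real"
  assumes "finite L"
  shows "\<exists>f. \<forall>l\<in>L. poly f l = g l"
  using assms
proof (induction L rule: finite_induct)
  case (insert a L)
  then obtain f where f: "\<forall>l\<in>L. poly f l = g l" by blast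
  let ?m = "\<Prod>l\<in>L. [:- l, 1:]"
  have "poly ?m a \<noteq> 0" using insert.hyps by (auto simp: poly_prod)
  moreover have "poly ?m l = 0" if "l \<in> L" for l using that insert.hyps by (auto simp: poly_prod)
  ultimately show ?case
    using f by (intro exI[of _ "f + smult ((g a - poly f a) / poly ?m a) ?m"]) auto
qed simp

text \<open>Factors of an annihilator are treated one at a time: a new positive root is recorded,
  while repeated roots, nonpositive roots and irreducible quadratics can be cancelled.\<close>

lemma pd_split_annihilator:
  assumes pd: "pd n H"
  shows "\<exists>L. finite L \<and> (\<forall>l\<in>L. 0 < l) \<and> herm_fmat.ev n H (\<Prod>l\<in>L. [:- l, 1:]) = 0"
proof -
  interpret herm_fmat n H by (rule pd_herm_fmat[OF pd])
  have lin: "Z = 0" if l: "l \<le> 0" and Z: "unitm n * Z = Z" "ev [:- l, 1:] * Z = 0" for l Z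
  proof (rule ccontr)
    assume "Z \<noteq> 0"
    have "H * Z = l *\<^sub>R Z" using Z unfolding ev_linear by (simp add: left_diff_distrib)
    then have "retr (star Z * H * Z) = l * retr (star Z * Z)"
      by (simp add: mult.assoc retr_scaleR)
    also have "\<dots> \<le> 0" using l retr_star_mult_self(1)[of Z] by (rule mult_nonpos_nonneg)
    finally show False using pdD(4)[OF pd Z(1) \<open>Z \<noteq> 0\<close>] by simp
  qed
  \<comment> \<open>Invariant of the induction: \<open>p\<close> holds the factors still to be
    treated, \<open>L\<close> the distinct positive roots recorded so far.\<close>
  have "\<exists>L. finite L \<and> (\<forall>l\<in>L. 0 < l) \<and> ev (\<Prod>l\<in>L. [:- l, 1:]) = 0"
    if "p \<noteq> 0" "finite L" "\<forall>l\<in>L. 0 < l" "ev (p * (\<Prod>l\<in>L. [:- l, 1:])) = 0" for p L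
    using that
  proof (induction "degree p" arbitrary: p L rule: less_induct)
    case less
    let ?m = "\<lambda>L. \<Prod>l\<in>L. [:- l, 1::real:]"
    show ?case
    proof (cases "degree p = 0")
      case True
      then obtain c where c: "p = [:c:]" by (rule degree_eq_zeroE)
      then have "c *\<^sub>R ev (?m L) = 0" using less.prems(4) by (simp add: ev_smult)
      then show ?thesis using less.prems c by auto
    next
      case False
      then have "0 < degree p" by simp
      then show ?thesis
      proof (cases rule: real_poly_factor_cases)
        case (1 l)
        then obtain q where q: "p = [:- l, 1:] * q" by (rule dvdE)
        have q0: "q \<noteq> 0" using less.prems q by auto
        have deg: "degree q < degree p" using q0 unfolding q by (subst degree_mult_eq) auto
        have e: "ev [:- l, 1:] * ev (q * ?m L) = 0"
          using less.prems(4) unfolding q by (simp only: mult.assoc ev_mult)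
        show ?thesis
        proof (cases "l \<in> L")
          case True
          have m: "?m L = [:- l, 1:] * ?m (L - {l})" using True less.prems(2) by (rule prod.remove[rotated])
          have "q * ?m L = [:- l, 1:] * (q * ?m (L - {l}))"
            unfolding m by (simp only: mult.left_commute)
          then have "ev (q * ?m L) = 0"
            using e ev_linear_square_cancel by (simp only: ev_mult)
          then show ?thesis using less.hyps[OF deg q0 less.prems(2,3)] by blast
        next
          case F: False
          show ?thesis
          proof (cases "0 < l")
            case True
            have "q * ?m (insert l L) = [:- l, 1:] * (q * ?m L)"
              unfolding prod.insert[OF less.prems(2) F] by (rule mult.left_commute)
            then have "ev (q * ?m (insert l L)) = 0"
              using e by (simp only: ev_mult)
            then show ?thesis
              using less.hyps[OF deg q0, of "insert l L"] True less.prems(2,3) by blast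
          next
            case False
            then have "ev (q * ?m L) = 0"
              using lin[OF _ _ e] by simp
            then show ?thesis using less.hyps[OF deg q0 less.prems(2,3)] by blast
          qed
        qed
      next
        case (2 a b)
        then obtain q where q: "p = [:a\<^sup>2 + b\<^sup>2, - 2 * a, 1:] * q" by (elim dvdE)
        have q0: "q \<noteq> 0" using less.prems q by auto
        have deg: "degree q < degree p" using q0 unfolding q by (subst degree_mult_eq) auto
        have "ev [:a\<^sup>2 + b\<^sup>2, - 2 * a, 1:] * ev (q * ?m L) = 0"
          using less.prems(4) unfolding q by (simp only: mult.assoc ev_mult)
        then have "ev (q * ?m L) = 0"
          by (rule ev_quadratic_cancel[OF 2(1) unitm_ev])
        then show ?thesis using less.hyps[OF deg q0 less.prems(2,3)] by blast
      qed
    qed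
  qed
  from this[of _ "{}"] ex_annihilator show ?thesis by auto
qed

lemma pd_sqrt:
  assumes pd: "pd n H"
  obtains S where "pd n S" "S * S = H"
proof -
  interpret herm_fmat n H by (rule pd_herm_fmat[OF pd])
  obtain L where L: "finite L" "\<forall>l\<in>L. 0 < l" "ev (\<Prod>l\<in>L. [:- l, 1:]) = 0"
    using pd_split_annihilator[OF pd] by blast
  \<comment> \<open>Fourth roots, so that the square root of \<open>H\<close> is itself the square
    \<open>ev f * ev f\<close> of a Hermitian matrix and its form is visibly nonnegative.\<close>
  obtain f where f: "\<forall>l\<in>L. poly f l = sqrt (sqrt l)"
    using ex_interpolation[OF L(1), of "\<lambda>l. sqrt (sqrt l)"] by blast
  have "(\<Prod>l\<in>L. [:- l, 1:]) dvd (f * f) * (f * f) - [:0, 1:]"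
    by (rule prod_linear_dvd[OF L(1)]) (use f L(2) in \<open>auto simp: less_imp_le\<close>)
  then obtain q where "(f * f) * (f * f) - [:0, 1:] = (\<Prod>l\<in>L. [:- l, 1:]) * q" by (rule dvdE)
  then have "ev ((f * f) * (f * f) - [:0, 1:]) = 0"
    using L(3) by (simp only: ev_mult mult_zero_left)
  then have SS: "ev (f * f) * ev (f * f) = H"
    by (simp add: ev_diff ev_mult)
  have "0 < retr (star Z * ev (f * f) * Z)" if Z: "unitm n * Z = Z" "Z \<noteq> 0" for Z
  proof -
    have eq: "star Z * ev (f * f) * Z = star (ev f * Z) * (ev f * Z)"
      by (simp add: ev_mult mult.assoc)
    have "ev f * Z \<noteq> 0"
    proof
      assume "ev f * Z = 0"
      then have "ev (f * f) * (ev (f * f) * Z) = 0" by (simp add: ev_mult mult.assoc)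
      then have "H * Z = 0" by (simp only: SS flip: mult.assoc)
      then show False using pdD(4)[OF pd Z] by (simp add: mult.assoc)
    qed
    then show ?thesis
      unfolding eq using retr_star_mult_self[of "ev f * Z"] by linarith
  qed
  then have "pd n (ev (f * f))" by (simp add: pd_def)
  then show ?thesis using that SS by blast
qed

lemma msqrt_props:
  assumes "hpd n H"
  shows "pd n (fm n n (msqrt n H))" "fm n n (msqrt n H) * fm n n (msqrt n H) = fm n n H"
proof -
  have "pd n (fm n n H)" using assms by (simp add: hpd_iff_pd)
  then obtain S where S: "pd n S" "S * S = fm n n H" using pd_sqrt by blast
  have fS: "fm n n (ent S) = S" by (intro fm_ent pdD[OF S(1)])
  have "msqrt n H = ent S"
    unfolding msqrt_def meq_iff_fm hpd_iff_pd
  proof (rule the_equality)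
    show "zero_out n n (ent S) \<and> pd n (fm n n (ent S)) \<and> fm n n (mmult n (ent S) (ent S)) = fm n n H"
      using S pdD[OF S(1)] by (simp add: zero_out_ent fS flip: fm_mult)
  next
    fix X assume X: "zero_out n n X \<and> pd n (fm n n X) \<and> fm n n (mmult n X X) = fm n n H"
    then have "fm n n X * fm n n X = S * S" by (simp only: S(2) fm_mult)
    then have "fm n n X = S" using X S(1) pd_sqrt_unique by blast
    then show "X = ent S" using X by (metis zero_out_iff_fm)
  qed
  then show "pd n (fm n n (msqrt n H))" "fm n n (msqrt n H) * fm n n (msqrt n H) = fm n n H"
    using S fS by simp_all
qed

section \<open>Rank\<close>

lemma finite_rank_cards: "finite {card S | S. S \<subseteq> {..<n} \<and> rlin_indep m A S}"
  by (rule finite_subset[of _ "card ` Pow {..<n}"]) auto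

lemma mrank_witness:
  obtains S where "S \<subseteq> {..<n}" "rlin_indep m A S" "card S = mrank m n A"
proof -
  have "card {} \<in> {card S | S. S \<subseteq> {..<n} \<and> rlin_indep m A S}"
    by (intro CollectI exI[of _ "{}"]) (auto simp: rlin_indep_def)
  then have "mrank m n A \<in> {card S | S. S \<subseteq> {..<n} \<and> rlin_indep m A S}"
    unfolding mrank_def by (intro Max_in finite_rank_cards) blast
  then show ?thesis using that by auto
qed

lemma mrank_ge: "S \<subseteq> {..<n} \<Longrightarrow> rlin_indep m A S \<Longrightarrow> card S \<le> mrank m n A"
  unfolding mrank_def by (intro Max_ge finite_rank_cards) auto

lemma rlin_indep_cong:
  assumes "\<And>i j. i < m \<Longrightarrow> j \<in> S \<Longrightarrow> A i j = A' i j"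
  shows "rlin_indep m A S \<longleftrightarrow> rlin_indep m A' S"
proof -
  have "(\<Sum>j\<in>S. A k j * c j) = (\<Sum>j\<in>S. A' k j * c j)" if "k < m" for k c
    by (rule sum.cong) (use that assms in auto)
  then show ?thesis unfolding rlin_indep_def by simp
qed

lemma mrank_ent_fm: "mrank m n (ent (fm m n A)) = mrank m n A"
proof -
  have "rlin_indep m (ent (fm m n A)) S \<longleftrightarrow> rlin_indep m A S" if "S \<subseteq> {..<n}" for S
    by (rule rlin_indep_cong) (use that in \<open>auto simp: ent_fm\<close>)
  then have "{card S | S. S \<subseteq> {..<n} \<and> rlin_indep m (ent (fm m n A)) S} = {card S | S. S \<subseteq> {..<n} \<and> rlin_indep m A S}"
    by auto
  then show ?thesis by (simp only: mrank_def)
qed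

text \<open>Gaussian elimination over a skew field. Unknowns stand to the right of the coefficients,
  so a pivot is inverted from the left.\<close>

lemma underdetermined_solution:
  fixes V :: qmat
  assumes "finite S" "k < card S"
  shows "\<exists>c. (\<exists>j\<in>S. c j \<noteq> 0) \<and> (\<forall>l<k. (\<Sum>j\<in>S. V l j * c j) = 0)"
  using assms
proof (induction k arbitrary: S V)
  case 0
  then obtain j where "j \<in> S" by fastforce
  then show ?case by (intro exI[of _ "\<lambda>_. 1"]) auto
next
  case (Suc k)
  show ?case
  proof (cases "\<forall>j\<in>S. V k j = 0")
    case True
    obtain c where c: "\<exists>j\<in>S. c j \<noteq> 0" "\<forall>l<k. (\<Sum>j\<in>S. V l j * c j) = 0"
      using Suc.IH[of S V] Suc.prems by auto
    have "(\<Sum>j\<in>S. V l j * c j) = 0" if "l < Suc k" for l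
      using that c(2) True by (cases "l = k") auto
    with c(1) show ?thesis by blast
  next
    case False
    then obtain j0 where j0: "j0 \<in> S" "V k j0 \<noteq> 0" by blast
    define S' where "S' = S - {j0}"
    have S': "finite S'" "k < card S'" using Suc.prems j0 by (auto simp: S'_def)
    define q where "q j = inverse (V k j0) * V k j" for j
    obtain c where c: "\<exists>j\<in>S'. c j \<noteq> 0" "\<forall>l<k. (\<Sum>j\<in>S'. (V l j - V l j0 * q j) * c j) = 0"
      using Suc.IH[OF S', of "\<lambda>l j. V l j - V l j0 * q j"] by blast
    \<comment> \<open>The pivot unknown is determined by equation \<open>k\<close>.\<close>
    define c' where "c' j = (if j = j0 then - (\<Sum>j\<in>S'. q j * c j) else c j)" for j
    have sum': "(\<Sum>j\<in>S. V l j * c' j) = (\<Sum>j\<in>S'. (V l j - V l j0 * q j) * c j)" for l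
    proof -
      have "(\<Sum>j\<in>S. V l j * c' j) = V l j0 * c' j0 + (\<Sum>j\<in>S'. V l j * c' j)"
        unfolding S'_def by (rule sum.remove[OF Suc.prems(1) j0(1)])
      also have "(\<Sum>j\<in>S'. V l j * c' j) = (\<Sum>j\<in>S'. V l j * c j)"
        by (rule sum.cong) (auto simp: c'_def S'_def)
      also have "V l j0 * c' j0 = - (\<Sum>j\<in>S'. V l j0 * q j * c j)"
        by (simp add: c'_def sum_distrib_left mult.assoc)
      finally show ?thesis by (simp add: left_diff_distrib sum_subtractf)
    qed
    have zero: "V k j - V k j0 * q j = 0" for j
      using j0(2) by (simp add: q_def flip: mult.assoc)
    have "(\<Sum>j\<in>S. V l j * c' j) = 0" if "l < Suc k" for l
    proof (cases "l = k")
      case True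
      then show ?thesis by (simp only: sum' zero mult_zero_left sum.neutral_const)
    next
      case False
      then show ?thesis using that c(2) by (simp only: sum')
    qed
    moreover have "\<exists>j\<in>S. c' j \<noteq> 0" using c(1) by (auto simp: c'_def S'_def)
    ultimately show ?thesis by blast
  qed
qed

text \<open>More than \<open>k\<close> independent columns would admit a nontrivial combination
  killed by the \<open>k\<close> rows of \<open>V\<close> that \<open>U\<close> sees, and hence
  killed by \<open>X\<close>.\<close>

lemma mrank_le_factor:
  assumes X: "X = U * V" and U: "U * unitm k = U"
  shows "mrank m n (ent X) \<le> k"
proof (rule ccontr)
  assume "\<not> ?thesis"
  then have k: "k < mrank m n (ent X)" by simp
  obtain S where S: "S \<subseteq> {..<n}" "rlin_indep m (ent X) S" "card S = mrank m n (ent X)"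
    by (rule mrank_witness)
  have fin: "finite S" using S(1) by (rule finite_subset) simp
  obtain c where c: "\<exists>j\<in>S. c j \<noteq> 0" "\<forall>l<k. (\<Sum>j\<in>S. ent V l j * c j) = 0"
    using underdetermined_solution[OF fin, of k "ent V"] k S(3) by auto
  have U0: "ent U i l = 0" if "k \<le> l" for i l
    using that ent_mult_unitm[of U k i l] U by simp
  have "(\<Sum>j\<in>S. ent X i j * c j) = 0" for i
  proof -
    have "(\<Sum>j\<in>S. ent X i j * c j) = (\<Sum>j\<in>S. \<Sum>l<k. ent U i l * (ent V l j * c j))"
      unfolding X by (simp only: ent_mult_bound[of k U, OF U0] sum_distrib_right mult.assoc)
    also have "\<dots> = (\<Sum>l<k. ent U i l * (\<Sum>j\<in>S. ent V l j * c j))"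
      by (subst sum.swap) (simp only: sum_distrib_left)
    finally show ?thesis using c(2) by simp
  qed
  then show False using S(2) c(1) unfolding rlin_indep_def by blast
qed

text \<open>\<open>U\<close> collects a maximal independent set of columns and \<open>V\<close> the
  coefficients of all columns in terms of it. Factorizations survive products and adjoints, which
  gives the rank inequalities without any theory of dimension.\<close>

lemma rank_factorization:
  assumes X: "unitm m * X = X" "X * unitm n = X"
  obtains U V where "X = U * V" "U * unitm (mrank m n (ent X)) = U" "unitm (mrank m n (ent X)) * V = V"
proof -
  define r where "r = mrank m n (ent X)"
  obtain S where S: "S \<subseteq> {..<n}" "rlin_indep m (ent X) S" "card S = r"
    unfolding r_def by (rule mrank_witness)
  have fin: "finite S" using S(1) by (rule finite_subset) simp
  have ex: "\<exists>v. \<forall>k<m. ent X k j = (\<Sum>s\<in>S. ent X k s * v s)" if j: "j < n" for j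
  proof (cases "j \<in> S")
    case True
    have "ent X k j = (\<Sum>s\<in>S. ent X k s * (if s = j then 1 else 0))" for k
      using True fin by (simp add: if_distrib[where f = "\<lambda>c. _ * c"] cong: if_cong)
    then show ?thesis by (intro exI[of _ "\<lambda>s. if s = j then 1 else 0"]) blast
  next
    case False
    have "\<not> rlin_indep m (ent X) (insert j S)"
    proof
      assume "rlin_indep m (ent X) (insert j S)"
      then have "card (insert j S) \<le> r"
        unfolding r_def using S(1) j by (intro mrank_ge) auto
      then show False using False fin S(3) by simp
    qed
    then obtain c where c: "\<forall>k<m. (\<Sum>s\<in>insert j S. ent X k s * c s) = 0" "\<exists>s\<in>insert j S. c s \<noteq> 0"
      unfolding rlin_indep_def by blast
    have c': "ent X k j * c j = - (\<Sum>s\<in>S. ent X k s * c s)" if "k < m" for k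
      using c(1) that False fin by (simp add: eq_neg_iff_add_eq_0)
    have "c j \<noteq> 0"
    proof
      assume "c j = 0"
      then have "\<forall>k<m. (\<Sum>s\<in>S. ent X k s * c s) = 0" using c' by simp
      then have "\<forall>s\<in>S. c s = 0" using S(2) unfolding rlin_indep_def by blast
      with c(2) \<open>c j = 0\<close> show False by auto
    qed
    have "ent X k j = (\<Sum>s\<in>S. ent X k s * (- c s * inverse (c j)))" if "k < m" for k
    proof -
      have "ent X k j = ent X k j * c j * inverse (c j)"
        using \<open>c j \<noteq> 0\<close> by (simp add: mult.assoc)
      also have "\<dots> = (\<Sum>s\<in>S. ent X k s * (- c s * inverse (c j)))"
        unfolding c'[OF that] by (simp add: sum_distrib_right sum_negf mult.assoc)
      finally show ?thesis .
    qed
    then show ?thesis by (intro exI[of _ "\<lambda>s. - c s * inverse (c j)"]) blast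
  qed
  define v where "v j = (SOME v. \<forall>k<m. ent X k j = (\<Sum>s\<in>S. ent X k s * v s))" for j
  have v: "ent X k j = (\<Sum>s\<in>S. ent X k s * v j s)" if "j < n" "k < m" for j k
    using someI_ex[OF ex[OF that(1)]] that(2) unfolding v_def by blast
  obtain h where h: "bij_betw h {..<r} S"
    using ex_bij_betw_nat_finite[OF fin] S(3) by (auto simp: atLeast0LessThan)
  define U where "U = fm m r (\<lambda>i l. ent X i (h l))"
  define V where "V = fm r n (\<lambda>l j. v j (h l))"
  have "X = U * V"
  proof -
    have "ent X i j = mmult r (\<lambda>i l. ent X i (h l)) (\<lambda>l j. v j (h l)) i j" if "i < m" "j < n" for i j
      unfolding mmult_def v[OF that(2,1)] by (rule sum.reindex_bij_betw[OF h, symmetric])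
    then have "fm m n (ent X) = U * V"
      unfolding U_def V_def fm_mult by (intro fmat_eqI) (auto simp: ent_fm)
    then show ?thesis by (simp add: fm_ent[OF X])
  qed
  then show ?thesis
    using that by (simp add: U_def V_def r_def)
qed

lemma mrank_mult_le:
  assumes X: "unitm m * X = X" "X * unitm n = X"
  shows "mrank m' n' (ent (F * X * G)) \<le> mrank m n (ent X)"
proof -
  obtain U V where UV: "X = U * V" "U * unitm (mrank m n (ent X)) = U"
    using rank_factorization[OF X] by metis
  show ?thesis
  proof (rule mrank_le_factor)
    show "F * X * G = (F * U) * (V * G)" by (subst UV(1)) (simp only: mult.assoc)
    show "F * U * unitm (mrank m n (ent X)) = F * U" by (simp only: mult.assoc UV(2))
  qed
qed

lemma mrank_star_le:
  assumes X: "unitm m * X = X" "X * unitm n = X"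
  shows "mrank n m (ent (star X)) \<le> mrank m n (ent X)"
proof -
  obtain U V where UV: "X = U * V" "unitm (mrank m n (ent X)) * V = V"
    using rank_factorization[OF X] by metis
  show ?thesis
  proof (rule mrank_le_factor)
    show "star X = star V * star U" by (subst UV(1)) simp
    show "star V * unitm (mrank m n (ent X)) = star V"
      using arg_cong[OF UV(2), of star] by simp
  qed
qed

lemma mrank_star:
  assumes X: "unitm m * X = X" "X * unitm n = X"
  shows "mrank n m (ent (star X)) = mrank m n (ent X)"
proof (rule antisym)
  have "unitm n * star X = star X" "star X * unitm m = star X"
    using arg_cong[OF X(2), of star] arg_cong[OF X(1), of star] by simp_all
  then show "mrank m n (ent X) \<le> mrank n m (ent (star X))"
    using mrank_star_le[of n "star X" m] by simp
qed (rule mrank_star_le[OF X])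

section \<open>Generalized inverses of Gram matrices\<close>

text \<open>The form \<open>M\<close> pulled back along \<open>X\<close>. It is used with
  \<open>X\<close> equal to A N^(-1/2) and weight \<open>M\<close>, and with B^* P^(1/2) or B^* and
  weight Q^(-1).\<close>

locale gram =
  fixes m n :: nat and M X K :: fmat and r :: nat
  assumes M: "pd m M" and X: "unitm m * X = X" "X * unitm n = X"
    and K_eq: "K = star X * M * X" and r_eq: "r = mrank m n (ent X)"
begin

sublocale herm_fmat n K
proof
  show "star K = K" by (simp add: K_eq pdD[OF M] mult.assoc)
  have "unitm n * star X = star X" using arg_cong[OF X(2), of star] by simp
  then show "unitm n * K = K" by (simp add: K_eq flip: mult.assoc)
qed

lemma sum_restrict:
  assumes "b \<subseteq> {..<n}"
  shows "(\<Sum>l<n. f l * (if l \<in> b then x l else 0)) = (\<Sum>l\<in>b. f l * (x l :: quat))"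
proof -
  have "(\<Sum>l<n. f l * (if l \<in> b then x l else 0)) = (\<Sum>l<n. if l \<in> b then f l * x l else 0)"
    by (rule sum.cong) auto
  also have "\<dots> = (\<Sum>l\<in>{..<n} \<inter> b. f l * x l)"
    by (rule sum.inter_restrict[symmetric]) simp
  also have "{..<n} \<inter> b = b" using assms by blast
  finally show ?thesis .
qed

text \<open>The principal submatrix on \<open>b\<close> is the Gram matrix of the columns of
  \<open>X\<close> in \<open>b\<close>, hence definite if they are independent.\<close>

lemma mdet_indep_pos:
  assumes b: "b \<subseteq> {..<n}" and ind: "rlin_indep m (ent X) b"
  shows "0 < mdet (ent K) b"
proof (rule mdet_pos)
  show "finite b" using b by (rule finite_subset) simp
  fix x :: "nat \<Rightarrow> quat" assume x: "\<exists>i\<in>b. x i \<noteq> 0"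
  let ?y = "\<lambda>i. if i \<in> b then x i else 0"
  have ne: "X * col n ?y \<noteq> 0"
  proof
    assume eq: "X * col n ?y = 0"
    have "(\<Sum>l\<in>b. ent X k l * x l) = 0" for k
      using arg_cong[OF eq, of "\<lambda>Z. ent Z k 0"] by (simp add: ent_mult_col[OF X(2)] sum_restrict[OF b])
    then show False using ind x unfolding rlin_indep_def by blast
  qed
  have "0 < retr (star (X * col n ?y) * M * (X * col n ?y))"
    using pdD(4)[OF M _ ne] X(1) by (simp flip: mult.assoc)
  also have "star (X * col n ?y) * M * (X * col n ?y) = star (col n ?y) * fm n n (ent K) * col n ?y"
    unfolding fm_ent_H by (simp add: K_eq mult.assoc)
  also have "retr \<dots> = qre (\<Sum>i<n. \<Sum>j<n. Defs.cnj (?y i) * ent K i j * ?y j)"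
    by (rule retr_quadratic_col)
  also have "(\<Sum>i<n. \<Sum>j<n. Defs.cnj (?y i) * ent K i j * ?y j) = (\<Sum>i<n. \<Sum>j\<in>b. Defs.cnj (?y i) * ent K i j * x j)"
    by (simp only: sum_restrict[OF b])
  also have "\<dots> = (\<Sum>j\<in>b. \<Sum>i<n. if i \<in> b then Defs.cnj (x i) * ent K i j * x j else 0)"
    by (subst sum.swap) (intro sum.cong refl, auto)
  also have "\<dots> = (\<Sum>j\<in>b. \<Sum>i\<in>{..<n} \<inter> b. Defs.cnj (x i) * ent K i j * x j)"
    by (intro sum.cong refl sum.inter_restrict[symmetric]) simp
  also have "{..<n} \<inter> b = b" using b by blast
  also have "(\<Sum>j\<in>b. \<Sum>i\<in>b. Defs.cnj (x i) * ent K i j * x j) = (\<Sum>i\<in>b. \<Sum>j\<in>b. Defs.cnj (x i) * ent K i j * x j)"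
    by (rule sum.swap)
  finally show "0 < qre (\<Sum>i\<in>b. \<Sum>j\<in>b. Defs.cnj (x i) * ent K i j * x j)" .
qed

text \<open>A linear relation among the columns of \<open>X\<close> in \<open>b\<close> is a null
  vector of the submatrix.\<close>

lemma mdet_dep_eq_0:
  assumes b: "b \<subseteq> {..<n}" and dep: "\<not> rlin_indep m (ent X) b"
  shows "mdet (ent K) b = 0"
proof -
  obtain c i where c: "\<And>k. k < m \<Longrightarrow> (\<Sum>j\<in>b. ent X k j * c j) = 0" and i: "i \<in> b" "c i \<noteq> 0"
    using dep unfolding rlin_indep_def by blast
  let ?y = "\<lambda>i. if i \<in> b then c i else 0"
  have "ent X k j = 0" if "m \<le> k" for k j
    using that ent_unitm_mult[of m X k j] X(1) by simp
  then have "(\<Sum>j\<in>b. ent X k j * c j) = 0" for k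
    using c[of k] by (cases "k < m") auto
  then have "X * col n ?y = 0"
    by (intro fmat_eqI) (simp add: ent_mult_col[OF X(2)] sum_restrict[OF b])
  then have eq: "K * col n ?y = 0"
    by (simp add: K_eq mult.assoc)
  have "(\<Sum>l\<in>b. ent K a l * c l) = 0" for a
    using arg_cong[OF eq, of "\<lambda>Z. ent Z a 0"] by (simp add: ent_mult_col sum_restrict[OF b])
  then show ?thesis
    by (intro mdet_eq_0[where x = c and i = i]) (use b i in \<open>auto intro: finite_subset\<close>)
qed

text \<open>No cancellation can occur: all minors are nonnegative, and a maximal independent set of
  columns contributes a positive one.\<close>

lemma detsum_rank_pos: "0 < detsum (ent K) n r"
proof -
  obtain S where S: "S \<subseteq> {..<n}" "rlin_indep m (ent X) S" "card S = r"
    unfolding r_eq by (rule mrank_witness)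
  show ?thesis
    unfolding detsum_def
  proof (rule sum_pos2[OF finite_idx_sets])
    show "S \<in> idx_sets n r" using S by (simp add: idx_sets_def)
    show "0 < mdet (ent K) S" by (rule mdet_indep_pos[OF S(1,2)])
    show "0 \<le> mdet (ent K) b" if "b \<in> idx_sets n r" for b
      using mdet_indep_pos[OF idx_setsD(2)[OF that]] mdet_dep_eq_0[OF idx_setsD(2)[OF that]]
      by (cases "rlin_indep m (ent X) b") auto
  qed
qed

lemma detsum_eq_0: "r < k \<Longrightarrow> detsum (ent K) n k = 0"
  unfolding detsum_def
proof (rule sum.neutral, rule ballI)
  fix b assume k: "r < k" and b: "b \<in> idx_sets n k"
  then have "\<not> rlin_indep m (ent X) b"
    using mrank_ge[OF idx_setsD(2)[OF b], of m "ent X"] idx_setsD(3)[OF b] r_eq by auto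
  then show "mdet (ent K) b = 0" by (rule mdet_dep_eq_0[OF idx_setsD(2)[OF b]])
qed

text \<open>Downward induction from orders above \<open>n\<close>. Beyond the rank the recursion
  reads \<open>adjm K n (Suc k) = - (K * adjm K n k)\<close>, so the hypothesis for
  \<open>Suc k\<close> says that the square of \<open>K\<close> kills \<open>adjm K n k\<close>, and
  a Hermitian square can be cancelled.\<close>

lemma mult_adjm_eq_0: "r < k \<Longrightarrow> K * adjm K n k = 0"
proof (induction "Suc n - k" arbitrary: k)
  case 0
  then show ?case by (simp add: adjm_large)
next
  case (Suc d)
  have "K * adjm K n (Suc k) = 0" using Suc by (intro Suc.hyps) auto
  moreover have "adjm K n (Suc k) = - (K * adjm K n k)"
    using mult_adjm[of k] detsum_eq_0[OF Suc.prems] by (simp add: eq_neg_iff_add_eq_0 add.commute)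
  ultimately have "K * (K * adjm K n k) = 0" by simp
  then have "star (K * adjm K n k) * (K * adjm K n k) = 0"
    by (simp add: mult.assoc)
  then show ?case by (rule star_mult_self_eq_0)
qed

definition ginv :: fmat where
  "ginv = (1 / detsum (ent K) n r) *\<^sub>R adjm K n r"

lemma ginv [simp]: "star ginv = ginv" "unitm n * ginv = ginv" "ginv * unitm n = ginv"
  by (simp_all add: ginv_def)

lemma ginv_commute: "K * ginv = ginv * K"
  by (simp add: ginv_def adjm_commute)

text \<open>Multiply the recursion at order \<open>r\<close> by \<open>K\<close>; the term of order
  \<open>Suc r\<close> vanishes.\<close>

lemma ginv_inner: "K * ginv * K = K"
proof -
  have "K * (K * adjm K n r) = detsum (ent K) n r *\<^sub>R K"
    using arg_cong[OF mult_adjm[of r], of "\<lambda>Z. K * Z"] mult_adjm_eq_0[of "Suc r"]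
    by (simp add: distrib_left)
  then have "K * adjm K n r * K = detsum (ent K) n r *\<^sub>R K"
    by (simp add: mult.assoc flip: adjm_commute)
  then show ?thesis using detsum_rank_pos by (simp add: ginv_def)
qed

lemma ginv_full: "r = n \<Longrightarrow> K * ginv = unitm n"
  using mult_adjm[of n] detsum_rank_pos unfolding ginv_def by (simp add: adjm_large)

end

section \<open>The weighted Moore--Penrose inverse\<close>

definition is_wmp :: "nat \<Rightarrow> nat \<Rightarrow> fmat \<Rightarrow> fmat \<Rightarrow> fmat \<Rightarrow> fmat \<Rightarrow> bool" where
  "is_wmp m n A M N Y \<longleftrightarrow> unitm n * Y = Y \<and> Y * unitm m = Y \<and> A * Y * A = A \<and> Y * A * Y = Y
     \<and> star (M * (A * Y)) = M * (A * Y) \<and> star (N * (Y * A)) = N * (Y * A)"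

lemma pd_cancel_left:
  assumes "pd n H" "unitm n * X = X" "unitm n * Y = Y" "H * X = H * Y"
  shows "X = Y"
proof -
  obtain G where "G * H = unitm n" using pd_inverse[OF assms(1)] by blast
  then show ?thesis using assms(2-4) by (metis mult.assoc)
qed

text \<open>\<open>A * Y\<close> and \<open>A * Z\<close> are projections onto the same range, both
  self-adjoint for \<open>M\<close>, hence equal; likewise \<open>Y * A\<close> and
  \<open>Z * A\<close> for \<open>N\<close>. Then
  \<open>Y = Y * A * Y = Z * A * Z = Z\<close>.\<close>

lemma is_wmp_unique:
  assumes M: "pd m M" and N: "pd n N" and A: "unitm m * A = A"
    and Y: "is_wmp m n A M N Y" and Z: "is_wmp m n A M N Z"
  shows "Y = Z"
proof -
  note Y = Y[unfolded is_wmp_def] and Z = Z[unfolded is_wmp_def]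
  have Ms: "star M = M" and Ns: "star N = N" using pdD(1) M N by auto
  have "A * Y = A * Z"
  proof (rule pd_cancel_left[OF M])
    have "M * (A * Z) = M * (A * Y) * (A * Z)"
      using Y by (metis mult.assoc)
    also have "\<dots> = star (A * Y) * (M * (A * Z))"
      using Y Ms by (metis mult.assoc star_mult)
    finally have "M * (A * Z) = star (star (A * Y) * (M * (A * Z)))"
      using Z by metis
    also have "\<dots> = M * (A * Z) * (A * Y)"
      using Z by (metis star_mult star_star)
    also have "\<dots> = M * (A * Y)"
      using Z by (metis mult.assoc)
    finally show "M * (A * Y) = M * (A * Z)" by simp
  qed (use A in \<open>simp_all flip: mult.assoc\<close>)
  moreover have "Y * A = Z * A"
  proof (rule pd_cancel_left[OF N])
    have "N * (Y * A) = N * (Y * A) * (Z * A)"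
      using Z by (metis mult.assoc)
    also have "\<dots> = star (Y * A) * (N * (Z * A))"
      using Y Ns by (metis mult.assoc star_mult)
    finally have "N * (Y * A) = star (star (Y * A) * (N * (Z * A)))"
      using Y by metis
    also have "\<dots> = N * (Z * A) * (Y * A)"
      using Z by (metis star_mult star_star)
    also have "\<dots> = N * (Z * A)"
      using Y by (metis mult.assoc)
    finally show "N * (Y * A) = N * (Z * A)" .
  qed (use Y Z in \<open>metis mult.assoc\<close>)+
  ultimately show ?thesis
    using Y Z by (metis mult.assoc)
qed

lemma wmp_eqI:
  assumes M: "hpd m M" and N: "hpd n N" and Y: "is_wmp m n (fm m n A) (fm m m M) (fm n n N) Y"
  shows "fm n m (wmp m n A M N) = Y"
proof -
  have conv: "(zero_out n m Z \<and> meq m n (mmult m (mmult n A Z) A) A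
      \<and> meq n m (mmult n (mmult m Z A) Z) Z
      \<and> herm m (mmult m M (mmult n A Z))
      \<and> herm n (mmult n N (mmult m Z A))) \<longleftrightarrow>
     zero_out n m Z \<and> is_wmp m n (fm m n A) (fm m m M) (fm n n N) (fm n m Z)" for Z
    unfolding meq_iff_fm herm_iff_fm fm_mult[symmetric] is_wmp_def by auto
  have fY: "fm n m (ent Y) = Y"
    using Y by (intro fm_ent) (auto simp: is_wmp_def)
  have "wmp m n A M N = ent Y"
    unfolding wmp_def conv
  proof (rule the_equality)
    show "zero_out n m (ent Y) \<and> is_wmp m n (fm m n A) (fm m m M) (fm n n N) (fm n m (ent Y))"
      using Y by (simp add: fY zero_out_ent is_wmp_def)
    fix Z assume Z: "zero_out n m Z \<and> is_wmp m n (fm m n A) (fm m m M) (fm n n N) (fm n m Z)"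
    have "fm n m Z = Y"
      by (rule is_wmp_unique[OF M[unfolded hpd_iff_pd] N[unfolded hpd_iff_pd] unitm_mult_fm conjunct2[OF Z] Y])
    then show "Z = ent Y" using Z by (metis zero_out_iff_fm)
  qed
  then show ?thesis by (simp add: fY)
qed

text \<open>The candidate is an inner inverse of the Hermitian matrix \<open>H\<close> times the
  weighted adjoint of \<open>A\<close>. The inner inverse equation is first strengthened by
  cancelling the outer factor on one side.\<close>

lemma is_wmp_left:
  assumes A: "unitm m * A = A" "A * unitm n = A" and M: "pd m M" and N: "pd n N"
    and Ni: "pd n Ni" "N * Ni = unitm n"
    and H: "H = Ni * (star A * M) * A" "star H = H"
    and Y: "star Y = Y" "unitm n * Y = Y" "H * Y = Y * H" "H * Y * H = H"
  shows "is_wmp m n A M N (Y * (Ni * (star A * M)))"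
proof -
  define s where "s = Ni * (star A * M)"
  have sA: "s * A = H" by (simp add: s_def H)
  have As: "unitm n * star A = star A" "star A * unitm m = star A"
    using arg_cong[OF A(2), of star] arg_cong[OF A(1), of star] by simp_all
  have Ns: "N * s = star A * M"
    using Ni(2) As by (simp add: s_def flip: mult.assoc)
  note Mp = pdD[OF M] and Np = pdD[OF N] and Nip = pdD[OF Ni(1)]
  have AYH: "A * Y * H = A"
  proof -
    \<comment> \<open>The defect of the claim. Its adjoint starts with a multiple of
      \<open>star A\<close>, so \<open>star A * M * Z = 0\<close> makes its \<open>M\<close>-form
      vanish.\<close>
    define Z where "Z = A * Y * H - A"
    have "s * Z = H * Y * H - H"
      by (simp add: Z_def right_diff_distrib sA flip: mult.assoc)
    then have "star A * M * Z = 0"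
      using Y(4) by (simp add: mult.assoc flip: Ns)
    moreover have "star Z = H * Y * star A - star A"
      by (simp add: Z_def H(2) Y(1) mult.assoc)
    ultimately have "star Z * M * Z = 0"
      by (simp add: left_diff_distrib mult.assoc)
    moreover have "unitm m * Z = Z"
      using A(1) by (simp add: Z_def right_diff_distrib flip: mult.assoc)
    ultimately have "Z = 0" using pd_eq_0[OF M] by blast
    then show ?thesis by (simp add: Z_def)
  qed
  have HYs: "H * Y * s = s"
  proof -
    \<comment> \<open>The defect with the factor \<open>M\<close> split off on the right. The
      adjoint of \<open>Z\<close> starts with \<open>A\<close>, so \<open>Z * M * A = 0\<close>
      gives \<open>Z * M * star Z = 0\<close>.\<close>
    define Z where "Z = H * Y * (Ni * star A) - Ni * star A"
    have "Z * M * A = H * Y * H - H"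
      by (simp add: Z_def left_diff_distrib mult.assoc H(1))
    then have "Z * M * A = 0" using Y(4) by simp
    moreover have "star Z = A * (Ni * (Y * H) - Ni)"
      by (simp add: Z_def H(2) Y(1) Nip(1) mult.assoc right_diff_distrib)
    ultimately have "Z * M * star Z = 0"
      by (simp flip: mult.assoc)
    moreover have "unitm m * star Z = star Z"
      using \<open>star Z = _\<close> A(1) by (simp flip: mult.assoc)
    ultimately have "star Z = 0" using pd_eq_0[OF M, of "star Z"] by simp
    then have "Z = 0" by (metis star_0 star_star)
    then have "H * Y * (Ni * star A) * M = Ni * star A * M" by (simp add: Z_def)
    then show ?thesis by (simp add: s_def mult.assoc)
  qed
  have E: "star (M * (A * (Y * s))) = M * (A * (Y * s))"
  proof -
    define E where "E = A * (Y * s)"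
    have "star A * M * E = N * (H * Y * s)"
      by (simp add: E_def sA[symmetric] Ns[symmetric] mult.assoc)
    then have "star A * M * E = star A * M" by (simp add: HYs Ns)
    then have "star (star A * M * E) = star (star A * M)" by simp
    then have "star E * M * A = M * A" by (simp add: Mp(1) mult.assoc)
    then have "star E * M * E = M * E" by (simp add: E_def flip: mult.assoc)
    moreover have "star (star E * M * E) = star E * M * E" by (simp add: Mp(1) mult.assoc)
    ultimately show ?thesis by (simp add: E_def)
  qed
  \<comment> \<open>\<open>Y\<close> is not assumed to commute with \<open>N\<close>. But
    \<open>N * H\<close> and \<open>H\<close> are Hermitian, so \<open>H\<close> commutes with
    \<open>N\<close>, and this allows \<open>N * (Y * H)\<close> to be rewritten in a visibly
    Hermitian form.\<close>
  have F: "star (N * (Y * H)) = N * (Y * H)"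
  proof -
    have NH: "N * H = star A * M * A" using Ns sA by (metis mult.assoc)
    then have "star (N * H) = N * H" by (simp add: Mp(1) mult.assoc)
    then have HN: "H * N = N * H" by (simp add: H(2) Np(1))
    have "Y * H * N * (Y * H) = H * Y * (N * H) * Y"
      by (simp add: Y(3)[symmetric] mult.assoc)
    also have "\<dots> = H * Y * H * N * Y" by (simp add: mult.assoc flip: HN)
    also have "\<dots> = N * H * Y" by (simp add: Y(4) HN)
    also have "\<dots> = N * (Y * H)" by (simp add: Y(3) mult.assoc)
    finally have "N * (Y * H) = Y * H * N * (Y * H)" by simp
    moreover have "star (Y * H * N * (Y * H)) = Y * H * N * (Y * H)"
      by (simp add: H(2) Y(1,3) Np(1) mult.assoc)
    ultimately show ?thesis by simp
  qed
  have "Y * s * A * (Y * s) = Y * (H * Y * s)"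
    by (simp only: sA[symmetric] mult.assoc)
  then have "Y * s * A * (Y * s) = Y * s" by (simp only: HYs)
  moreover have "A * (Y * s) * A = A" using AYH by (simp add: mult.assoc sA)
  moreover have "Y * s * A = Y * H" by (simp add: mult.assoc sA)
  moreover have "unitm n * (Y * s) = Y * s" using Y(2) by (simp flip: mult.assoc)
  moreover have "Y * s * unitm m = Y * s" by (simp add: s_def mult.assoc Mp(3))
  ultimately show ?thesis
    using E F unfolding is_wmp_def s_def[symmetric] by simp
qed

text \<open>The weighted product of \<open>B\<close> with its sharp is conjugated by
  \<open>R\<close>, the square root of \<open>P\<close>, into the Hermitian matrix \<open>K\<close>;
  the candidate undoes this conjugation.\<close>

lemma is_wmp_right:
  assumes B: "unitm p * B = B" "B * unitm q = B" and Q: "pd q Q" and Qi: "pd q Qi" "Q * Qi = unitm q"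
    and R: "pd p R" "R * R = P" and K: "K = R * B * Qi * star B * R"
    and Y: "star Y = Y" "K * Y = Y * K" "K * Y * K = K"
  shows "is_wmp p q B P Q (Qi * star B * R * Y * R)"
proof -
  have Bs: "unitm q * star B = star B" "star B * unitm p = star B"
    using arg_cong[OF B(2), of star] arg_cong[OF B(1), of star] by simp_all
  note Rp = pdD[OF R(1)] and Qip = pdD[OF Qi(1)]
  have Ks: "star K = K" by (simp add: K Rp(1) Qip(1) mult.assoc)
  obtain Ri where Ri: "Ri * R = unitm p" using pd_inverse[OF R(1)] by blast
  have KYB: "K * Y * (R * B) = R * B"
  proof -
    \<comment> \<open>The defect again: cancelling the weight \<open>Qi\<close> removes the right
      factor \<open>Qi * star B * R\<close> from \<open>K * Y * K = K\<close>.\<close>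
    define V where "V = K * Y * (R * B) - R * B"
    have "V * Qi * star B * R = K * Y * K - K"
      by (simp add: V_def left_diff_distrib mult.assoc K)
    then have "V * Qi * star B * R = 0" using Y(3) by simp
    moreover have sV: "star V = star B * R * (Y * K) - star B * R"
      by (simp add: V_def Rp(1) Y(1) Ks mult.assoc)
    ultimately have "V * Qi * star V = 0"
      by (simp add: right_diff_distrib flip: mult.assoc)
    moreover have "unitm q * star V = star V"
      unfolding sV right_diff_distrib using Bs(1) by (simp flip: mult.assoc)
    ultimately have "star V = 0" using pd_eq_0[OF Qi(1), of "star V"] by simp
    then have "V = 0" by (metis star_0 star_star)
    then show ?thesis by (simp add: V_def)
  qed
  have BYK: "star B * R * (Y * K) = star B * R"
    using arg_cong[OF KYB, of star] by (simp add: Rp(1) Y(1) Ks mult.assoc)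
  define Z where "Z = Qi * star B * R * Y * R"
  have RBZ: "R * (B * Z) = K * Y * R" by (simp add: Z_def K mult.assoc)
  have "B * Z * B = Ri * (R * (B * Z)) * B"
    using Ri B(1) by (simp flip: mult.assoc)
  also have "\<dots> = Ri * (K * Y * (R * B))" by (simp add: RBZ mult.assoc)
  also have "\<dots> = B" unfolding KYB using Ri B(1) by (simp flip: mult.assoc)
  finally have 1: "B * Z * B = B" .
  have "Z * B * Z = Qi * (star B * R * (Y * K)) * Y * R"
    by (simp add: Z_def K mult.assoc)
  then have "Z * B * Z = Qi * (star B * R) * Y * R" by (simp only: BYK)
  then have 2: "Z * B * Z = Z" by (simp only: Z_def mult.assoc)
  have "P * (B * Z) = R * (K * Y) * R" by (simp add: R(2)[symmetric] RBZ mult.assoc)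
  moreover have "star (R * (K * Y) * R) = R * (K * Y) * R"
    by (simp add: Rp(1) Ks Y(1,2) mult.assoc)
  ultimately have 3: "star (P * (B * Z)) = P * (B * Z)" by simp
  have "Q * (Z * B) = Q * Qi * (star B * R * Y * R * B)" by (simp add: Z_def mult.assoc)
  also have "\<dots> = star B * R * Y * R * B" using Bs(1) by (simp add: Qi(2) flip: mult.assoc)
  finally have 4: "star (Q * (Z * B)) = Q * (Z * B)"
    by (simp add: Rp(1) Y(1) mult.assoc)
  have 5: "unitm q * Z = Z" by (simp add: Z_def Qip(2) flip: mult.assoc)
  have 6: "Z * unitm p = Z" by (simp add: Z_def Rp(3) mult.assoc)
  show ?thesis
    unfolding is_wmp_def using 1 2 3 4 5 6 by (simp only: Z_def[symmetric])
qed

text \<open>Here the candidate is a right inverse of \<open>B\<close>, so the symmetry condition for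
  \<open>P\<close> reduces to that of \<open>P\<close> itself.\<close>

lemma is_wmp_right_full:
  assumes B: "unitm p * B = B" "B * unitm q = B" and P: "pd p P" and Qi: "pd q Qi" "Q * Qi = unitm q"
    and K: "K = B * Qi * star B"
    and Y: "star Y = Y" "unitm p * Y = Y" "Y * unitm p = Y" "K * Y = unitm p"
  shows "is_wmp p q B P Q (Qi * star B * Y)"
proof -
  have Bs: "unitm q * star B = star B" "star B * unitm p = star B"
    using arg_cong[OF B(2), of star] arg_cong[OF B(1), of star] by simp_all
  define Z where "Z = Qi * star B * Y"
  have BZ: "B * Z = unitm p" using Y(4) by (simp add: Z_def K mult.assoc)
  have 1: "B * Z * B = B" by (simp add: BZ B)
  have 6: "Z * unitm p = Z" by (simp add: Z_def Y(3) mult.assoc)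
  have 2: "Z * B * Z = Z" by (simp add: mult.assoc BZ 6)
  have 3: "star (P * (B * Z)) = P * (B * Z)" by (simp add: BZ pdD[OF P])
  have "Q * (Z * B) = Q * Qi * (star B * Y * B)" by (simp add: Z_def mult.assoc)
  also have "\<dots> = star B * Y * B" using Bs(1) by (simp add: Qi(2) flip: mult.assoc)
  finally have 4: "star (Q * (Z * B)) = Q * (Z * B)"
    by (simp add: Y(1) mult.assoc)
  have 5: "unitm q * Z = Z" by (simp add: Z_def pdD(2)[OF Qi(1)] flip: mult.assoc)
  show ?thesis
    unfolding is_wmp_def using 1 2 3 4 5 6 by (simp only: Z_def[symmetric])
qed

lemma inverse_square:
  assumes "S * S = N" "S * T = unitm n" "unitm n * T = T" "S * unitm n = S" "Ni * N = unitm n" "Ni * unitm n = Ni"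
  shows "Ni = T * T"
proof -
  have "N * (T * T) = unitm n" using assms(1-4) by (metis mult.assoc)
  then show ?thesis using assms(3,5,6) by (metis mult.assoc)
qed

text \<open>A Hermitian \<open>Ni * W\<close> commutes with \<open>N\<close> and therefore with its
  square root \<open>S\<close>, so half of the weight can be moved to the other side. This exhibits
  the matrix as a Gram matrix.\<close>

lemma hermitian_sharp_eq_gram:
  assumes N: "pd n N" "N * Ni = unitm n" "Ni * N = unitm n" and S: "pd n S" "S * S = N"
    and T: "S * T = unitm n" "T * S = unitm n"
    and W: "star W = W" "unitm n * W = W"
    and H: "H = Ni * W" "star H = H" "unitm n * H = H"
  shows "H = T * W * T"
proof -
  note Sp = pdD[OF S(1)] and Np = pdD[OF N(1)]
  have HI: "H * unitm n = H" using arg_cong[OF H(3), of star] by (simp add: H(2))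
  have NH: "N * H = W" using N(2) W(2) by (simp add: H(1) flip: mult.assoc)
  then have "star (N * H) = star W" by (rule arg_cong)
  then have "H * N = W" unfolding star_mult H(2) Np(1) W(1) .
  then have HN: "H * N = N * H" by (simp only: NH)
  \<comment> \<open>The commutator solves a Sylvester equation whose right-hand side is the
    commutator of \<open>N\<close> and \<open>H\<close>.\<close>
  have "S * H - H * S = 0"
  proof (rule sylvester_eq_0[OF S(1) S(1)])
    show "unitm n * (S * H - H * S) = S * H - H * S"
      by (simp add: right_diff_distrib Sp(2) H(3) flip: mult.assoc)
    show "(S * H - H * S) * unitm n = S * H - H * S"
      by (simp add: left_diff_distrib mult.assoc Sp(3) HI)
    have "S * (S * H - H * S) + (S * H - H * S) * S = S * S * H - H * (S * S)"
      by (simp add: algebra_simps)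
    then show "S * (S * H - H * S) + (S * H - H * S) * S = 0"
      by (simp add: S(2) HN)
  qed
  then have SH: "S * H = H * S" by simp
  have "T * W * T = T * S * (S * H) * T"
    by (simp add: NH[symmetric] S(2)[symmetric] mult.assoc)
  also have "\<dots> = S * H * T" by (simp add: T(2) Sp(2) flip: mult.assoc)
  also have "\<dots> = H * (S * T)" by (simp add: SH mult.assoc)
  also have "\<dots> = H" by (simp add: T(1) HI)
  finally show ?thesis by simp
qed

section \<open>Determinantal representations\<close>

text \<open>The matrices of the theorem agree with the padded ones only below the dimension; a
  determinant on \<open>S\<close> reads nothing else.\<close>

lemma rdet_on_cong:
  assumes S: "finite S" "i \<in> S" and C: "\<And>x y. x \<in> S \<Longrightarrow> y \<in> S \<Longrightarrow> C x y = C' x y"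
  shows "rdet_on C S i = rdet_on C' S i"
  unfolding rdet_on_cycle_sum[OF S]
proof (rule sum.cong[OF refl])
  fix xs assume "xs \<in> dlists (S - {i})"
  then have "set (i # xs @ [i]) \<subseteq> S" using S by (auto simp: dlists_def)
  then have "spw C (i # xs @ [i]) = spw C' (i # xs @ [i])"
    by (intro spw_cong C) blast+
  moreover have "psum C (S - set (i # xs)) = psum C' (S - set (i # xs))"
    by (intro psum_cong C) blast+
  ultimately show "- spw C (i # xs @ [i]) * psum C (S - set (i # xs)) = - spw C' (i # xs @ [i]) * psum C' (S - set (i # xs))"
    by (simp only:)
qed

lemma cdet_on_cong:
  assumes S: "finite S" "i \<in> S" and C: "\<And>x y. x \<in> S \<Longrightarrow> y \<in> S \<Longrightarrow> C x y = C' x y"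
  shows "cdet_on C S i = cdet_on C' S i"
  unfolding cdet_on_cycle_sum[OF S]
proof (rule sum.cong[OF refl])
  fix xs assume "xs \<in> dlists (S - {i})"
  then have "set (i # xs @ [i]) \<subseteq> S" using S by (auto simp: dlists_def)
  then have "spw C (i # xs @ [i]) = spw C' (i # xs @ [i])"
    by (intro spw_cong C) blast+
  moreover have "psum_rev C (S - set (i # xs)) = psum_rev C' (S - set (i # xs))"
    by (intro psum_rev_cong C) blast+
  ultimately show "psum_rev C (S - set (i # xs)) * - spw C (i # xs @ [i]) = psum_rev C' (S - set (i # xs)) * - spw C' (i # xs @ [i])"
    by (simp only:)
qed

lemma ent_eq_0: "W * unitm n = W \<Longrightarrow> n \<le> j \<Longrightarrow> ent W i j = 0"
  using ent_mult_unitm[of W n i j] by simp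

lemma idx_sets_full_filter: "i < n \<Longrightarrow> {b \<in> idx_sets n n. i \<in> b} = {{..<n}}"
  by (auto simp: idx_sets_full)

section \<open>Determinantal numerators as entries of products with the inner inverse\<close>

context gram
begin

lemma adjm_eq_ginv: "adjm K n r = detsum (ent K) n r *\<^sub>R ginv"
  using detsum_rank_pos by (simp add: ginv_def)

text \<open>Cramer's rule for the inner inverse: \<open>v\<close> is column \<open>j\<close> of a
  matrix \<open>W\<close>, and the sum is an entry of \<open>ginv * W\<close> up to the
  denominator.\<close>

lemma sum_cdet_eq:
  assumes C: "fm n n C = K" and i: "i < n" and v: "\<And>c. c < n \<Longrightarrow> v c = ent W c j"
  shows "(\<Sum>b\<in>{b \<in> idx_sets n r. i \<in> b}. cdet_on (col_repl C i v) b i)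
    = detsum (ent K) n r *\<^sub>R ent (ginv * W) i j"
proof -
  have "(\<Sum>b\<in>{b \<in> idx_sets n r. i \<in> b}. cdet_on (col_repl C i v) b i)
      = (\<Sum>b\<in>{b \<in> idx_sets n r. i \<in> b}. cdet_on (col_repl (ent K) i v) b i)"
  proof (rule sum.cong[OF refl], rule cdet_on_cong)
    fix b x y assume b: "b \<in> {b \<in> idx_sets n r. i \<in> b}" "x \<in> b" "y \<in> b"
    then have "x < n" "y < n" using idx_setsD(2) by blast+
    then show "col_repl C i v x y = col_repl (ent K) i v x y"
      by (simp add: col_repl_def C[symmetric] ent_fm)
  qed (auto dest: idx_setsD)
  also have "\<dots> = (\<Sum>c<n. adjsum (ent K) n r i c * v c)"
    by (rule sum_cdet_on_col_repl[OF i])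
  also have "\<dots> = (\<Sum>c<n. ent (adjm K n r) i c * ent W c j)"
    by (rule sum.cong) (auto simp: adjm_def ent_fm i v)
  also have "\<dots> = ent (adjm K n r * W) i j"
    by (rule ent_mult_bound[symmetric]) (simp add: adjm_def ent_fm)
  finally show ?thesis by (simp add: adjm_eq_ginv)
qed

lemma sum_rdet_eq:
  assumes C: "fm n n C = K" and l: "l < n" and v: "\<And>c. c < n \<Longrightarrow> v c = ent W t c" and W: "W * unitm n = W"
  shows "(\<Sum>b\<in>{b \<in> idx_sets n r. l \<in> b}. rdet_on (row_repl C l v) b l)
    = detsum (ent K) n r *\<^sub>R ent (W * ginv) t l"
proof -
  have "(\<Sum>b\<in>{b \<in> idx_sets n r. l \<in> b}. rdet_on (row_repl C l v) b l)
      = (\<Sum>b\<in>{b \<in> idx_sets n r. l \<in> b}. rdet_on (row_repl (ent K) l v) b l)"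
  proof (rule sum.cong[OF refl], rule rdet_on_cong)
    fix b x y assume b: "b \<in> {b \<in> idx_sets n r. l \<in> b}" "x \<in> b" "y \<in> b"
    then have "x < n" "y < n" using idx_setsD(2) by blast+
    then show "row_repl C l v x y = row_repl (ent K) l v x y"
      by (simp add: row_repl_def C[symmetric] ent_fm)
  qed (auto dest: idx_setsD)
  also have "\<dots> = (\<Sum>c<n. v c * adjsum (ent K) n r c l)"
    by (rule sum_rdet_on_row_repl[OF l])
  also have "\<dots> = (\<Sum>c<n. ent W t c * ent (adjm K n r) c l)"
    by (rule sum.cong) (auto simp: adjm_def ent_fm l v)
  also have "\<dots> = ent (W * adjm K n r) t l"
    by (rule ent_mult_bound[symmetric]) (rule ent_eq_0[OF W])
  finally show ?thesis by (simp add: adjm_eq_ginv)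
qed

lemma sum_rdet_mult_eq:
  assumes C: "fm n n C = K" and v: "\<And>c. c < n \<Longrightarrow> v c = ent W t c" and W: "W * unitm n = W"
    and j: "j < n"
  shows "(\<Sum>l<n. \<Sum>b\<in>{b \<in> idx_sets n r. l \<in> b}. rdet_on (row_repl C l v) b l * R l j)
    = detsum (ent K) n r *\<^sub>R ent (W * ginv * fm n n R) t j"
proof -
  have "(\<Sum>l<n. \<Sum>b\<in>{b \<in> idx_sets n r. l \<in> b}. rdet_on (row_repl C l v) b l * R l j)
      = (\<Sum>l<n. (detsum (ent K) n r *\<^sub>R ent (W * ginv) t l) * ent (fm n n R) l j)"
  proof (rule sum.cong[OF refl])
    fix l assume "l \<in> {..<n}"
    then have l: "l < n" by simp
    show "(\<Sum>b\<in>{b \<in> idx_sets n r. l \<in> b}. rdet_on (row_repl C l v) b l * R l j)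
       = (detsum (ent K) n r *\<^sub>R ent (W * ginv) t l) * ent (fm n n R) l j"
      using sum_rdet_eq[where v = v and t = t, OF C l _ W] v l j by (simp add: ent_fm flip: sum_distrib_right)
  qed
  also have "\<dots> = detsum (ent K) n r *\<^sub>R (\<Sum>l<n. ent (W * ginv) t l * ent (fm n n R) l j)"
    by (simp add: scaleR_sum_right)
  also have "(\<Sum>l<n. ent (W * ginv) t l * ent (fm n n R) l j) = ent (W * ginv * fm n n R) t j"
    by (rule ent_mult_bound[symmetric], rule ent_eq_0[of _ n]) (simp_all add: mult.assoc)
  finally show ?thesis .
qed

lemma sum_hdet_eq:
  assumes C: "fm n n C = K" and r: "1 \<le> r"
  shows "(\<Sum>b\<in>idx_sets n r. hdet C b) = detsum (ent K) n r"
proof -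
  have "hdet C b = hdet (ent K) b" if b: "b \<in> idx_sets n r" for b
  proof -
    have "b \<noteq> {}" using idx_setsD(3)[OF b] r by auto
    then have "Min b \<in> b" using idx_setsD(1)[OF b] by simp
    moreover have "C x y = ent K x y" if "x \<in> b" "y \<in> b" for x y
    proof -
      have "x < n" "y < n" using that idx_setsD(2)[OF b] by blast+
      then show ?thesis by (simp add: C[symmetric] ent_fm)
    qed
    ultimately show ?thesis
      unfolding hdet_def using rdet_on_cong[OF idx_setsD(1)[OF b]] by metis
  qed
  then show ?thesis using sum_hdet[OF r, of n] by simp
qed

end

text \<open>Every quotient is an entry of the inner inverse for \<open>A\<close>, times the
  transformed \<open>D\<close>, times the inner inverse for \<open>B\<close>, followed by the square
  root of \<open>P\<close> unless \<open>r2 = p\<close>. The two quotients of a case differ only in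
  which side is multiplied first, and at full rank the sum over index sets has a single
  term.\<close>

theorem theorem3p3:
  fixes m n p q r1 r2 :: nat and A B D M N P Q :: qmat
  assumes "r1 = mrank m n A" and "1 \<le> r1"
    and "r2 = mrank p q B" and "1 \<le> r2"
    and "hpd m M" and "hpd n N" and "hpd p P" and "hpd q Q"
    and "herm n (mmult m (asharp m n A M N) A)"
    and "\<not> herm p (mmult q B (asharp p q B P Q))"
  shows "let AA = mmult m (asharp m n A M N) A;
             Bt = btilde p q B P Q;
             BBt = mmult q Bt (adj Bt);
             BQB = mmult q (mmult q B (minv q Q)) (adj B);
             Ph = msqrt p P;
             X = mmult q (mmult m (wmp m n A M N) D) (wmp p q B P Q);
             Dt1 = mmult p (mmult q (mmult q (mmult m (asharp m n A M N) D) (minv q Q)) (adj B)) Ph;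
             Dt2 = mmult q (mmult q (mmult m (asharp m n A M N) D) (minv q Q)) (adj B);
             DeltaA = (\<Sum>b\<in>idx_sets n r1. hdet AA b);
             DeltaB = (\<Sum>a\<in>idx_sets p r2. hdet BBt a)
         in \<forall>i<n. \<forall>j<p.
    (r1 < n \<and> r2 < p \<longrightarrow>
       X i j = qscale (1 / (DeltaA * DeltaB))
                 (\<Sum>b\<in>{b \<in> idx_sets n r1. i \<in> b}.
                    cdet_on (col_repl AA i (dB_minor p q B P Q r2 Dt1 j)) b i)
     \<and> X i j = qscale (1 / (DeltaA * DeltaB))
                 (\<Sum>l<p. \<Sum>a\<in>{a \<in> idx_sets p r2. l \<in> a}.
                    rdet_on (row_repl BBt l (dA_minor m n A M N r1 Dt1 i)) a l * Ph l j))
  \<and> (r1 = n \<and> r2 = p \<longrightarrow>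
       X i j = qscale (1 / (hdet AA {..<n} * hdet BQB {..<p}))
                 (cdet_on (col_repl AA i (dB_full p q B Q Dt2 j)) {..<n} i)
     \<and> X i j = qscale (1 / (hdet AA {..<n} * hdet BQB {..<p}))
                 (rdet_on (row_repl BQB j (dA_full m n A M N Dt2 i)) {..<p} j))
  \<and> (r1 = n \<and> r2 < p \<longrightarrow>
       X i j = qscale (1 / (hdet AA {..<n} * DeltaB))
                 (cdet_on (col_repl AA i (dB_minor p q B P Q r2 Dt1 j)) {..<n} i)
     \<and> X i j = qscale (1 / (hdet AA {..<n} * DeltaB))
                 (\<Sum>l<p. \<Sum>a\<in>{a \<in> idx_sets p r2. l \<in> a}.
                    rdet_on (row_repl BBt l (dA_full m n A M N Dt1 i)) a l * Ph l j))
  \<and> (r1 < n \<and> r2 = p \<longrightarrow>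
       X i j = qscale (1 / (DeltaA * hdet BQB {..<p}))
                 (rdet_on (row_repl BQB j (dA_minor m n A M N r1 Dt2 i)) {..<p} j)
     \<and> X i j = qscale (1 / (DeltaA * hdet BQB {..<p}))
                 (\<Sum>b\<in>{b \<in> idx_sets n r1. i \<in> b}.
                    cdet_on (col_repl AA i (dB_full p q B Q Dt2 j)) b i))"
proof -
  define AA where "AA = mmult m (asharp m n A M N) A"
  define Bt where "Bt = btilde p q B P Q"
  define BBt where "BBt = mmult q Bt (adj Bt)"
  define BQB where "BQB = mmult q (mmult q B (minv q Q)) (adj B)"
  define Ph where "Ph = msqrt p P"
  define X where "X = mmult q (mmult m (wmp m n A M N) D) (wmp p q B P Q)"
  define Dt1 where "Dt1 = mmult p (mmult q (mmult q (mmult m (asharp m n A M N) D) (minv q Q)) (adj B)) Ph"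
  define Dt2 where "Dt2 = mmult q (mmult q (mmult m (asharp m n A M N) D) (minv q Q)) (adj B)"
  define a where "a = fm m n A"
  define b where "b = fm p q B"
  define Ni where "Ni = fm n n (minv n N)"
  define Qi where "Qi = fm q q (minv q Q)"
  define S where "S = fm n n (msqrt n N)"
  define R where "R = fm p p Ph"
  define Sq where "Sq = fm q q (msqrt q Q)"
  define Tq where "Tq = fm q q (minv q (msqrt q Q))"
  define s where "s = Ni * (star a * fm m m M)"

  have aI: "unitm m * a = a" "a * unitm n = a" and bI: "unitm p * b = b" "b * unitm q = b"
    by (simp_all add: a_def b_def)
  have saI: "unitm n * star a = star a" and sbI: "unitm q * star b = star b" "star b * unitm p = star b"
    using arg_cong[OF aI(2), of star] arg_cong[OF bI(2), of star] arg_cong[OF bI(1), of star] by simp_all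
  have Mp: "pd m (fm m m M)" and Np: "pd n (fm n n N)" and Pp: "pd p (fm p p P)" and Qp: "pd q (fm q q Q)"
    using assms(5-8) by (simp_all add: hpd_iff_pd)
  have Ni: "pd n Ni" "fm n n N * Ni = unitm n" "Ni * fm n n N = unitm n"
    unfolding Ni_def by (rule minv_props[OF assms(6)])+
  have Qi: "pd q Qi" "fm q q Q * Qi = unitm q" "Qi * fm q q Q = unitm q"
    unfolding Qi_def by (rule minv_props[OF assms(8)])+
  have S: "pd n S" "S * S = fm n n N"
    unfolding S_def by (rule msqrt_props[OF assms(6)])+
  have R: "pd p R" "R * R = fm p p P"
    unfolding R_def Ph_def by (rule msqrt_props[OF assms(7)])+
  have Sq: "pd q Sq" "Sq * Sq = fm q q Q"
    unfolding Sq_def by (rule msqrt_props[OF assms(8)])+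
  have "hpd q (msqrt q Q)" using Sq(1) by (simp add: hpd_iff_pd Sq_def)
  then have Tq: "pd q Tq" "Sq * Tq = unitm q"
    unfolding Tq_def Sq_def by (rule minv_props)+
  \<comment> \<open>Hence the product of the transformed \<open>B\<close> with its adjoint involves
    the inverse of \<open>Q\<close> and no square root of \<open>Q\<close>.\<close>
  have QiTq: "Qi = Tq * Tq"
    by (rule inverse_square[OF Sq(2) Tq(2) pdD(2)[OF Tq(1)] pdD(3)[OF Sq(1)] Qi(3) pdD(3)[OF Qi(1)]])
  obtain T where T: "pd n T" "S * T = unitm n" "T * S = unitm n"
    using pd_inverse[OF S(1)] by blast
  obtain Ri where Ri: "R * Ri = unitm p"
    using pd_inverse[OF R(1)] by blast
  note Tp = pdD[OF T(1)] and Rp = pdD[OF R(1)]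

  have fs: "fm n m (asharp m n A M N) = s"
    by (simp only: asharp_def s_def Ni_def a_def star_fm fm_mult)
  have fAA: "fm n n AA = s * a"
    by (simp only: AA_def fs[symmetric] a_def fm_mult)
  have fBt: "fm p q Bt = R * b * Tq"
    by (simp only: Bt_def btilde_def R_def Ph_def b_def Tq_def fm_mult)
  have "fm p p BBt = fm p q Bt * star (fm p q Bt)"
    by (simp only: BBt_def star_fm fm_mult)
  then have fBBt: "fm p p BBt = R * b * Qi * star b * R"
    by (simp add: fBt QiTq Rp(1) pdD(1)[OF Tq(1)] mult.assoc)
  have fBQB: "fm p p BQB = b * Qi * star b"
    by (simp only: BQB_def b_def Qi_def star_fm fm_mult)
  have fDt2: "fm n p Dt2 = s * fm m q D * Qi * star b"
    by (simp only: Dt2_def fs[symmetric] b_def Qi_def star_fm fm_mult)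
  have fDt1: "fm n p Dt1 = s * fm m q D * Qi * star b * R"
    by (simp only: Dt1_def fs[symmetric] b_def Qi_def R_def star_fm fm_mult)
  have fX: "fm n p X = fm n m (wmp m n A M N) * fm m q D * fm q p (wmp p q B P Q)"
    by (simp only: X_def fm_mult)

  have sH: "star (s * a) = s * a"
    using assms(9) unfolding herm_iff_fm AA_def[symmetric] fAA .
  have gA: "s * a = star (a * T) * fm m m M * (a * T)"
  proof -
    have "s * a = T * (star a * fm m m M * a) * T"
    proof (rule hermitian_sharp_eq_gram[OF Np Ni(2,3) S T(2,3)])
      show "star (star a * fm m m M * a) = star a * fm m m M * a"
        by (simp add: pdD(1)[OF Mp] mult.assoc)
      show "unitm n * (star a * fm m m M * a) = star a * fm m m M * a"
        by (simp add: saI flip: mult.assoc)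
      show "s * a = Ni * (star a * fm m m M * a)" by (simp add: s_def mult.assoc)
      show "unitm n * (s * a) = s * a" by (simp add: s_def pdD(2)[OF Ni(1)] flip: mult.assoc)
    qed (rule sH)
    then show ?thesis by (simp add: Tp(1) mult.assoc)
  qed
  \<comment> \<open>\<open>T\<close> is undone by \<open>S\<close>, so the rank inequality for
    products applies in both directions.\<close>
  have rA: "r1 = mrank m n (ent (a * T))"
  proof -
    have aT: "unitm m * (a * T) = a * T" "a * T * unitm n = a * T"
      using aI Tp(3) by (simp_all add: mult.assoc) (simp flip: mult.assoc)
    have "mrank m n (ent (unitm m * a * T)) \<le> mrank m n (ent a)"
      by (rule mrank_mult_le[OF aI])
    moreover have "mrank m n (ent (unitm m * (a * T) * S)) \<le> mrank m n (ent (a * T))"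
      by (rule mrank_mult_le[OF aT])
    moreover have "unitm m * (a * T) * S = a"
      using T(3) aI(2) by (simp add: aT(1)) (simp add: mult.assoc)
    moreover have "mrank m n (ent a) = r1"
      by (simp add: a_def mrank_ent_fm assms(1))
    ultimately show ?thesis by (simp add: aI)
  qed
  \<comment> \<open>On this side the factor of the Gram matrix is the adjoint of \<open>B\<close>,
    so the rank has to be carried over to it.\<close>
  have rQ: "r2 = mrank q p (ent (star b))"
    using mrank_star[OF bI] by (simp add: b_def mrank_ent_fm assms(3))
  have bR: "unitm q * (star b * R) = star b * R" "star b * R * unitm p = star b * R"
    using sbI Rp(3) by (simp_all add: mult.assoc) (simp flip: mult.assoc)
  have rB: "r2 = mrank q p (ent (star b * R))"
  proof -
    have "mrank q p (ent (unitm q * star b * R)) \<le> mrank q p (ent (star b))"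
      by (rule mrank_mult_le[OF sbI])
    moreover have "mrank q p (ent (unitm q * (star b * R) * Ri)) \<le> mrank q p (ent (star b * R))"
      by (rule mrank_mult_le[OF bR])
    moreover have "unitm q * (star b * R) * Ri = star b"
      unfolding bR(1) by (simp add: mult.assoc Ri sbI)
    ultimately show ?thesis by (simp add: sbI rQ)
  qed

  interpret GA: gram m n "fm m m M" "a * T" "s * a" r1
    using Mp gA rA aI Tp(3) by unfold_locales (simp_all add: mult.assoc, simp flip: mult.assoc)
  interpret GB: gram q p Qi "star b * R" "R * b * Qi * star b * R" r2
    using Qi(1) bR rB by unfold_locales (simp_all add: Rp(1) mult.assoc)
  interpret GQ: gram q p Qi "star b" "b * Qi * star b" r2
    using Qi(1) sbI rQ by unfold_locales simp_all

  define dA where "dA = detsum (ent (s * a)) n r1"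
  define dB where "dB = detsum (ent (R * b * Qi * star b * R)) p r2"
  define dQ where "dQ = detsum (ent (b * Qi * star b)) p r2"
  have pos: "0 < dA" "0 < dB" "0 < dQ"
    unfolding dA_def dB_def dQ_def
    by (rule GA.detsum_rank_pos GB.detsum_rank_pos GQ.detsum_rank_pos)+

  have wA: "fm n m (wmp m n A M N) = GA.ginv * s"
    by (rule wmp_eqI[OF assms(5,6)], fold a_def,
        rule is_wmp_left[OF aI Mp Np Ni(1,2) _ sH GA.ginv(1,2) GA.ginv_commute GA.ginv_inner, folded s_def])
       (rule refl)
  have wB: "fm q p (wmp p q B P Q) = Qi * star b * R * GB.ginv * R"
    by (rule wmp_eqI[OF assms(7,8)], fold b_def,
        rule is_wmp_right[OF bI Qp Qi(1,2) R refl GB.ginv(1) GB.ginv_commute GB.ginv_inner])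
  \<comment> \<open>At full row rank \<open>GQ.ginv\<close> is a genuine inverse, and the square
    root of \<open>P\<close> disappears from the representation.\<close>
  have wQ: "fm q p (wmp p q B P Q) = Qi * star b * GQ.ginv" if "r2 = p"
    by (rule wmp_eqI[OF assms(7,8)], fold b_def,
        rule is_wmp_right_full[OF bI Pp Qi(1,2) refl GQ.ginv GQ.ginv_full[OF that]])
  have X1: "fm n p X = GA.ginv * fm n p Dt1 * GB.ginv * R"
    by (simp only: fX wA wB fDt1 mult.assoc)
  have X2: "fm n p X = GA.ginv * fm n p Dt2 * GQ.ginv" if "r2 = p"
    by (simp only: fX wA wQ[OF that] fDt2 mult.assoc)

  have DA: "(\<Sum>b\<in>idx_sets n r1. hdet AA b) = dA"
    unfolding dA_def by (rule GA.sum_hdet_eq[OF fAA assms(2)])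
  have DB: "(\<Sum>b\<in>idx_sets p r2. hdet BBt b) = dB"
    unfolding dB_def by (rule GB.sum_hdet_eq[OF fBBt assms(4)])
  have DQ: "(\<Sum>b\<in>idx_sets p r2. hdet BQB b) = dQ"
    unfolding dQ_def by (rule GQ.sum_hdet_eq[OF fBQB assms(4)])
  have DA_full: "hdet AA {..<n} = dA" if "r1 = n"
    using DA by (simp add: that idx_sets_full)
  have DQ_full: "hdet BQB {..<p} = dQ" if "r2 = p"
    using DQ by (simp add: that idx_sets_full)

  \<comment> \<open>The factor \<open>c\<close> allows nesting: with \<open>c = 1\<close> this
    evaluates the inner vector, and with \<open>c\<close> the other denominator it evaluates the
    outer determinant, whose replaced column is already such a multiple.\<close>
  have colA: "(\<Sum>b\<in>{b \<in> idx_sets n r1. i \<in> b}. cdet_on (col_repl AA i v) b i) = (dA * c) *\<^sub>R ent (GA.ginv * W) i j"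
    if "i < n" "\<And>t. t < n \<Longrightarrow> v t = c *\<^sub>R ent W t j" for i j v c W
    using GA.sum_cdet_eq[OF fAA that(1), of v "c *\<^sub>R W" j] that(2) by (simp add: dA_def)
  have colA_full: "cdet_on (col_repl AA i v) {..<n} i = (dA * c) *\<^sub>R ent (GA.ginv * W) i j"
    if "r1 = n" "i < n" "\<And>t. t < n \<Longrightarrow> v t = c *\<^sub>R ent W t j" for i j v c W
    using colA[OF that(2,3)] by (simp add: that(1) idx_sets_full_filter[OF that(2)])
  have rowB: "(\<Sum>l<p. \<Sum>a\<in>{a \<in> idx_sets p r2. l \<in> a}. rdet_on (row_repl BBt l v) a l * Ph l j)
      = (dB * c) *\<^sub>R ent (W * GB.ginv * R) t j"
    if "j < p" "W * unitm p = W" "\<And>f. f < p \<Longrightarrow> v f = c *\<^sub>R ent W t f" for t j v c W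
    using GB.sum_rdet_mult_eq[OF fBBt, of v "c *\<^sub>R W" t j Ph] that by (simp add: dB_def R_def)
  have rowQ: "rdet_on (row_repl BQB j v) {..<p} j = (dQ * c) *\<^sub>R ent (W * GQ.ginv) t j"
    if "r2 = p" "j < p" "W * unitm p = W" "\<And>f. f < p \<Longrightarrow> v f = c *\<^sub>R ent W t f" for t j v c W
    using GQ.sum_rdet_eq[OF fBQB that(2), of v "c *\<^sub>R W" t] that
    by (simp add: dQ_def idx_sets_full_filter[OF that(2)])

  have dBm: "dB_minor p q B P Q r2 Dt j t = dB *\<^sub>R ent (fm n p Dt * GB.ginv * R) t j"
    if "j < p" "t < n" for Dt j t
    using rowB[where v = "Dt t" and c = 1 and t = t and W = "fm n p Dt", OF that(1) fm_mult_unitm] that(2)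
    unfolding dB_minor_def by (simp add: ent_fm Ph_def BBt_def Bt_def)
  have dAm: "dA_minor m n A M N r1 Dt i f = dA *\<^sub>R ent (GA.ginv * fm n p Dt) i f"
    if "i < n" "f < p" for Dt i f
    using colA[where v = "\<lambda>c. Dt c f" and c = 1 and W = "fm n p Dt" and j = f, OF that(1)] that(2)
    unfolding dA_minor_def by (simp add: ent_fm AA_def)
  have dBf: "dB_full p q B Q Dt j t = dQ *\<^sub>R ent (fm n p Dt * GQ.ginv) t j"
    if "r2 = p" "j < p" "t < n" for Dt j t
    using rowQ[where v = "Dt t" and c = 1 and t = t and W = "fm n p Dt", OF that(1,2) fm_mult_unitm] that(3)
    unfolding dB_full_def by (simp add: ent_fm BQB_def)
  have dAf: "dA_full m n A M N Dt i f = dA *\<^sub>R ent (GA.ginv * fm n p Dt) i f"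
    if "r1 = n" "i < n" "f < p" for Dt i f
    using colA_full[where v = "\<lambda>c. Dt c f" and c = 1 and W = "fm n p Dt" and j = f, OF that(1,2)] that(3)
    unfolding dA_full_def by (simp add: ent_fm AA_def)

  have W: "GA.ginv * fm n p Dt * unitm p = GA.ginv * fm n p Dt" for Dt
    by (simp add: mult.assoc)
  have X1': "X i j = ent (GA.ginv * (fm n p Dt1 * GB.ginv * R)) i j" if "i < n" "j < p" for i j
    using arg_cong[OF X1, of "\<lambda>Z. ent Z i j"] that by (simp add: ent_fm mult.assoc)
  have X2': "X i j = ent (GA.ginv * (fm n p Dt2 * GQ.ginv)) i j" if "r2 = p" "i < n" "j < p" for i j
    using arg_cong[OF X2[OF that(1)], of "\<lambda>Z. ent Z i j"] that by (simp add: ent_fm mult.assoc)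
  \<comment> \<open>Both orders occur: resolving the column determinant last produces the
    denominators in the stated order, resolving the row determinant last in the opposite
    order.\<close>
  have cancel: "qscale (1 / (x * y)) ((x * y) *\<^sub>R z) = z" "qscale (1 / (x * y)) ((y * x) *\<^sub>R z) = z"
    if "0 < x" "0 < y" for x y z
    using that by (simp_all add: qscale_eq_scaleR)

  show ?thesis
    unfolding Let_def AA_def[symmetric] Bt_def[symmetric] Ph_def[symmetric]
    unfolding BBt_def[symmetric] BQB_def[symmetric] X_def[symmetric]
    unfolding Dt1_def[symmetric]
    unfolding Dt2_def[symmetric] DA DB
  proof (intro allI impI conjI; (elim conjE)?)
    fix i j assume i: "i < n" and j: "j < p"
    show "X i j = qscale (1 / (dA * dB)) (\<Sum>b\<in>{b \<in> idx_sets n r1. i \<in> b}.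
        cdet_on (col_repl AA i (dB_minor p q B P Q r2 Dt1 j)) b i)"
      by (simp only: colA[OF i dBm[OF j]] cancel pos X1'[OF i j])
    show "X i j = qscale (1 / (dA * dB)) (\<Sum>l<p. \<Sum>a\<in>{a \<in> idx_sets p r2. l \<in> a}.
        rdet_on (row_repl BBt l (dA_minor m n A M N r1 Dt1 i)) a l * Ph l j)"
      by (simp only: rowB[OF j W dAm[OF i]] cancel pos X1'[OF i j] mult.assoc)
    {
      assume r1: "r1 = n" and r2: "r2 = p"
      show "X i j = qscale (1 / (hdet AA {..<n} * hdet BQB {..<p}))
          (cdet_on (col_repl AA i (dB_full p q B Q Dt2 j)) {..<n} i)"
        by (simp only: DA_full[OF r1] DQ_full[OF r2] colA_full[OF r1 i dBf[OF r2 j]] cancel pos X2'[OF r2 i j])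
      show "X i j = qscale (1 / (hdet AA {..<n} * hdet BQB {..<p}))
          (rdet_on (row_repl BQB j (dA_full m n A M N Dt2 i)) {..<p} j)"
        by (simp only: DA_full[OF r1] DQ_full[OF r2] rowQ[OF r2 j W dAf[OF r1 i]] cancel pos X2'[OF r2 i j] mult.assoc)
    }
    {
      assume r1: "r1 = n"
      show "X i j = qscale (1 / (hdet AA {..<n} * dB))
          (cdet_on (col_repl AA i (dB_minor p q B P Q r2 Dt1 j)) {..<n} i)"
        by (simp only: DA_full[OF r1] colA_full[OF r1 i dBm[OF j]] cancel pos X1'[OF i j])
      show "X i j = qscale (1 / (hdet AA {..<n} * dB)) (\<Sum>l<p. \<Sum>a\<in>{a \<in> idx_sets p r2. l \<in> a}.
          rdet_on (row_repl BBt l (dA_full m n A M N Dt1 i)) a l * Ph l j)"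
        by (simp only: DA_full[OF r1] rowB[OF j W dAf[OF r1 i]] cancel pos X1'[OF i j] mult.assoc)
    }
    {
      assume r2: "r2 = p"
      show "X i j = qscale (1 / (dA * hdet BQB {..<p}))
          (rdet_on (row_repl BQB j (dA_minor m n A M N r1 Dt2 i)) {..<p} j)"
        by (simp only: DQ_full[OF r2] rowQ[OF r2 j W dAm[OF i]] cancel pos X2'[OF r2 i j] mult.assoc)
      show "X i j = qscale (1 / (dA * hdet BQB {..<p})) (\<Sum>b\<in>{b \<in> idx_sets n r1. i \<in> b}.
          cdet_on (col_repl AA i (dB_full p q B Q Dt2 j)) b i)"
        by (simp only: DQ_full[OF r2] colA[OF i dBf[OF r2 j]] cancel pos X2'[OF r2 i j])
    }
  qed
qed

end
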